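(* Let $T>0$, let $m\ge1$ be an integer, let $\{X_s,\ s\ge 0\}$ be a real-valued Lévy process with Lévy exponent $\psi_X$, and set $$c(u)=\sqrt{\frac{\|\psi_X(u)\|^2}{2\,\mathrm{Re}[\psi_X(u)]}}$$ for $u\in\mathbb R$ with $\mathrm{Re}[\psi_X(u)]\neq0$. Let $\theta=(\theta_1,\dots,\theta_m)\in\mathbb R^m$ be such that $\mathrm{Re}[\psi_X(\theta_j)]\,\mathrm{Re}[\psi_X(2\theta_j)]\neq0$ for all $j\in\{1,\dots,m\}$ and $\mathrm{Re}[\psi_X(\theta_j+c_1\theta_h)]\neq0$ for all $j,h\in\{1,\dots,m\}$ with $j\neq h$ and all $c_1\in\{-1,1\}$. For $\varepsilon>0$ and $1\le j\le m$ define $$x_\varepsilon^{\theta_j}(t)=\varepsilon\,c(\theta_j)\int_0^{\frac{2t}{\varepsilon^2}}e^{i\theta_jX_s}\,ds,\qquad t\in[0,T],$$ and let $P_\varepsilon^\theta$ be the image law of $x_\varepsilon^\theta=(x_\varepsilon^{\theta_1},\dots,x_\varepsilon^{\theta_m})$ in the Banach space $\mathcal C([0,T],\mathbb C^m)$ of continuous functions on $[0,T]$. Then $P_\varepsilon^\theta$ converges weakly, as $\varepsilon$ tends to zero, towards the law on $\mathcal C([0,T],\mathbb C^m)$ of an $m$-dimensional complex Brownian motion.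
   Context: A Lévy process $X$ has stationary and independent increments, is continuous in probability, is càdlàg and satisfies $X_0=0$. Its Lévy exponent $\psi_X$ is defined (with this sign convention) by $E(e^{iuX_t})=e^{-t\psi_X(u)}$ for $u\in\mathbb R$, $t\ge0$. $\|z\|$ is the modulus of a complex number $z$ and $\mathrm{Re}$ denotes the real part. A complex Brownian motion is a $\mathbb C$-valued process whose real and imaginary parts are two independent standard Brownian motions (started at $0$); an $m$-dimensional complex Brownian motion is a $\mathbb C^m$-valued process whose $m$ components are independent complex Brownian motions. *)

theory Defs
  imports "HOL-Probability.Probability"
begin

section \<open>Levy processes\<close>

text \<open>Processes indexed by $[0,\infty)$ are functions on \<^typ>\<open>real\<close> whose values at negative
  times are irrelevant.\<close>

definition independent_increments :: "'a measure \<Rightarrow> (real \<Rightarrow> 'a \<Rightarrow> real) \<Rightarrow> bool" where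
  "independent_increments M X \<longleftrightarrow>
     (\<forall>(n::nat) (t :: nat \<Rightarrow> real). 0 \<le> t 0 \<longrightarrow> (\<forall>k<n. t k \<le> t (Suc k)) \<longrightarrow>
        prob_space.indep_vars M (\<lambda>_. borel) (\<lambda>k \<omega>. X (t (Suc k)) \<omega> - X (t k) \<omega>) {..<n})"

definition stationary_increments :: "'a measure \<Rightarrow> (real \<Rightarrow> 'a \<Rightarrow> real) \<Rightarrow> bool" where
  "stationary_increments M X \<longleftrightarrow>
     (\<forall>s\<ge>0. \<forall>t\<ge>0. distr M borel (\<lambda>\<omega>. X (s + t) \<omega> - X s \<omega>) = distr M borel (\<lambda>\<omega>. X t \<omega> - X 0 \<omega>))"

definition continuous_in_probability :: "'a measure \<Rightarrow> (real \<Rightarrow> 'a \<Rightarrow> real) \<Rightarrow> bool" where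
  "continuous_in_probability M X \<longleftrightarrow>
     (\<forall>t\<ge>0. \<forall>r>0. ((\<lambda>s. measure M {\<omega> \<in> space M. \<bar>X s \<omega> - X t \<omega>\<bar> > r}) \<longlongrightarrow> 0) (at t within {0..}))"

definition cadlag :: "(real \<Rightarrow> real) \<Rightarrow> bool" where
  "cadlag f \<longleftrightarrow> (\<forall>t\<ge>0. (f \<longlongrightarrow> f t) (at_right t)) \<and> (\<forall>t>0. \<exists>l. (f \<longlongrightarrow> l) (at_left t))"

definition levy_process :: "'a measure \<Rightarrow> (real \<Rightarrow> 'a \<Rightarrow> real) \<Rightarrow> bool" where
  "levy_process M X \<longleftrightarrow>
     prob_space M \<and>
     (\<forall>t\<ge>0. X t \<in> borel_measurable M) \<and>
     (AE \<omega> in M. X 0 \<omega> = 0) \<and>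
     independent_increments M X \<and>
     stationary_increments M X \<and>
     continuous_in_probability M X \<and>
     (\<forall>\<omega>\<in>space M. cadlag (\<lambda>t. X t \<omega>))"

text \<open>The equation for all $t \ge 0$ determines \<open>\<psi> u\<close> uniquely, with no choice of a
  branch of the logarithm.\<close>

definition levy_exponent :: "'a measure \<Rightarrow> (real \<Rightarrow> 'a \<Rightarrow> real) \<Rightarrow> (real \<Rightarrow> complex) \<Rightarrow> bool" where
  "levy_exponent M X \<psi> \<longleftrightarrow>
     (\<forall>u. \<forall>t\<ge>0. (LINT \<omega>|M. exp (\<i> * complex_of_real (u * X t \<omega>))) = exp (- (complex_of_real t * \<psi> u)))"

section \<open>Complex Brownian motion\<close>

definition std_brownian_motion :: "'a measure \<Rightarrow> (real \<Rightarrow> 'a \<Rightarrow> real) \<Rightarrow> bool" where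
  "std_brownian_motion M B \<longleftrightarrow>
     prob_space M \<and>
     (\<forall>t\<ge>0. B t \<in> borel_measurable M) \<and>
     (AE \<omega> in M. B 0 \<omega> = 0) \<and>
     independent_increments M B \<and>
     (\<forall>s\<ge>0. \<forall>t>s. distributed M lborel (\<lambda>\<omega>. B t \<omega> - B s \<omega>) (normal_density 0 (sqrt (t - s)))) \<and>
     (\<forall>\<omega>\<in>space M. continuous_on {0..} (\<lambda>t. B t \<omega>))"

text \<open>Independence of processes is independence of their sample paths as random elements of
  $\prod_{t \ge 0} \mathbb{R}$, respectively $\prod_{t \ge 0} \mathbb{C}$, with the product
  sigma-algebra.\<close>

definition complex_brownian_motion :: "'a measure \<Rightarrow> (real \<Rightarrow> 'a \<Rightarrow> complex) \<Rightarrow> bool" where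
  "complex_brownian_motion M Z \<longleftrightarrow>
     std_brownian_motion M (\<lambda>t \<omega>. Re (Z t \<omega>)) \<and>
     std_brownian_motion M (\<lambda>t \<omega>. Im (Z t \<omega>)) \<and>
     prob_space.indep_var M
       (PiM {0..} (\<lambda>_. borel)) (\<lambda>\<omega>. \<lambda>t\<in>{0..}. Re (Z t \<omega>))
       (PiM {0..} (\<lambda>_. borel)) (\<lambda>\<omega>. \<lambda>t\<in>{0..}. Im (Z t \<omega>))"

definition multi_complex_brownian_motion ::
    "'a measure \<Rightarrow> (real \<Rightarrow> 'a \<Rightarrow> complex ^ 'm) \<Rightarrow> bool" where
  "multi_complex_brownian_motion M W \<longleftrightarrow>
     (\<forall>j. complex_brownian_motion M (\<lambda>t \<omega>. W t \<omega> $ j)) \<and>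
     prob_space.indep_vars M (\<lambda>_. PiM {0..} (\<lambda>_. borel)) (\<lambda>j \<omega>. \<lambda>t\<in>{0..}. W t \<omega> $ j) UNIV"

section \<open>Laws on the space of continuous paths and weak convergence\<close>

text \<open>$C([0,T],\mathbb{C}^m)$ with the uniform distance; its points are functions on
  \<^typ>\<open>real\<close> that are \<^const>\<open>undefined\<close> outside $[0,T]$.\<close>

definition path_space :: "real \<Rightarrow> (real \<Rightarrow> complex ^ 'm) topology" where
  "path_space T = mtopology_of (cfunspace (top_of_set {0..T}) euclidean_metric)"

definition borel_of :: "'a topology \<Rightarrow> 'a measure" where
  "borel_of S = sigma (topspace S) {U. openin S U}"

definition path_law :: "'a measure \<Rightarrow> real \<Rightarrow> (real \<Rightarrow> 'a \<Rightarrow> complex ^ 'm) \<Rightarrow> (real \<Rightarrow> complex ^ 'm) measure" where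
  "path_law M T Y = distr M (borel_of (path_space T)) (\<lambda>\<omega>. \<lambda>t\<in>{0..T}. Y t \<omega>)"

definition converges_weakly ::
    "'a topology \<Rightarrow> ('i \<Rightarrow> 'a measure) \<Rightarrow> 'a measure \<Rightarrow> 'i filter \<Rightarrow> bool" where
  "converges_weakly S P Q F \<longleftrightarrow>
     (\<forall>f :: 'a \<Rightarrow> real. continuous_map S euclideanreal f \<and> bounded (f ` topspace S) \<longrightarrow>
        ((\<lambda>i. LINT x|P i. f x) \<longlongrightarrow> (LINT x|Q. f x)) F)"

section \<open>The approximating processes\<close>

definition levy_c :: "(real \<Rightarrow> complex) \<Rightarrow> real \<Rightarrow> real" where
  "levy_c \<psi> u = sqrt ((cmod (\<psi> u))\<^sup>2 / (2 * Re (\<psi> u)))"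

definition approx_process ::
    "(real \<Rightarrow> 'a \<Rightarrow> real) \<Rightarrow> (real \<Rightarrow> complex) \<Rightarrow> real ^ 'm \<Rightarrow> real \<Rightarrow> real \<Rightarrow> 'a \<Rightarrow> complex ^ 'm" where
  "approx_process X \<psi> \<theta> \<epsilon> t \<omega> =
     (\<chi> j. complex_of_real (\<epsilon> * levy_c \<psi> (\<theta> $ j)) *
           (LINT s:{0..2 * t / \<epsilon>\<^sup>2}|lborel. exp (\<i> * complex_of_real (\<theta> $ j * X s \<omega>))))"

end

theory Submission
  imports Defs
begin

text \<open>
  Put $e_u(t) = e^{iuX_t}$. If $K$ is an adapted process with
  $K_t - K_s = \sum_j L^j_s \int_s^t e_{v_j}(r)\,dr + O((t-s)^2)$, then the Markov property makes
  $t \mapsto E(K_t e_u(t))$ differentiable with derivative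
  $\sum_j E(L^j_t e_{u+v_j}(t)) - \psi(u) E(K_t e_u(t))$, so that expectations of functionals of the
  occupation integrals $\int e^{i\theta X}$ satisfy closed systems of linear differential equations.

  Applied to the powers of an occupation integral this bounds its fourth moment, which controls the
  increments of $x_\varepsilon$ uniformly in $\varepsilon$. Applied to
  $G_u(t) = E(H \exp(i\varepsilon \int_a^t \sum_j \alpha_j e_{v_j}(r)\,dr)\, e_u(t))$ with $H$ in the
  past of $a$ it gives $G_u' = -\psi(u) G_u + i\varepsilon \sum_j \alpha_j G_{u+v_j}$. Adding to $G_0$ the
  correctors of order $\varepsilon$ and $\varepsilon^2$ that cancel all oscillating terms (this uses that
  $\psi$ does not vanish at the frequencies $\theta_j$, $2\theta_j$, $\theta_j \pm \theta_h$) leaves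
  $F' = -\varepsilon^2 \kappa F + O(\varepsilon^3)$, hence the Gaussian limit on the time scale
  $\varepsilon^{-2}$; since $H$ is arbitrary, consecutive time intervals decouple.

  Convergence of characteristic functions gives convergence of the finite-dimensional laws by
  approximating $g(v)$, on a large cube, by a polynomial in $\sin(v_i/R)$. For Lipschitz functionals on
  the path space, which determine weak convergence, the dyadic interpolation error is summed over the
  levels with the fourth moment bound.
\<close>

section \<open>Linear differential equations\<close>

text \<open>The integrand exp(i u X) may jump, so an occupation integral need not have a classical
  derivative at every instant. Pathwise expansions therefore keep the integral over the short
  interval, and differentiation takes place only after expectation.

  Real test vectors bring in both \<theta>_j and -\<theta>_j. Where two frequencies cancel, the
  product has frequency zero; \<psi> vanishes there, no corrector exists, and what remains is the
  drift \<kappa>. Each conjugate pair contributes 1/\<psi> + 1/cnj \<psi> = 2 Re \<psi> /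
  |\<psi>|^2, which \<open>levy_c\<close> normalises to one; the clock 2t/\<epsilon>^2 then turns
  the rate |l|^2/4 into the Brownian |l|^2/2. The conditions at 2\<theta>_j and \<theta>_j +-
  \<theta>_h exclude every other cancellation.

  Second moments of increments are of order t - s, and their sum over 2^n dyadic cells does not
  decay; fourth moments sum to order 2^(-n). This makes the interpolation error uniform in
  \<epsilon>, so that finite-dimensional limits together with an error estimate take the place of a
  compactness argument for families of laws.\<close>

lemma has_vector_derivative_of_quadratic_expansion:
  fixes f f' :: "real \<Rightarrow> 'b::real_normed_vector"
  assumes cont: "continuous_on {a..b} f'"
    and exp: "\<And>s t. a \<le> s \<Longrightarrow> s \<le> t \<Longrightarrow> t \<le> b \<Longrightarrow> norm (f t - f s - (t - s) *\<^sub>R f' s) \<le> C * (t - s)\<^sup>2"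
    and x: "x \<in> {a..b}"
  shows "(f has_vector_derivative f' x) (at x within {a..b})"
  unfolding has_vector_derivative_def has_derivative_within_alt
proof (intro conjI allI impI)
  show "bounded_linear (\<lambda>h. h *\<^sub>R f' x)"
    by (rule bounded_linear_scaleR_left)
  fix e :: real assume e: "e > 0"
  have "\<exists>d>0. \<forall>y\<in>{a..b}. dist y x < d \<longrightarrow> dist (f' y) (f' x) < e/2"
    using cont x e unfolding continuous_on_iff by (metis half_gt_zero)
  then obtain d where d: "d > 0" "\<And>y. y \<in> {a..b} \<Longrightarrow> dist y x < d \<Longrightarrow> dist (f' y) (f' x) < e/2"
    by blast
  \<comment> \<open>The first bound makes f' vary by less than e/2; the second makes the quadratic
    remainder at most e/2 times |y - x|, the added 1 covering \<open>C = 0\<close>.\<close>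
  define d' where "d' = min d (e / (2 * (\<bar>C\<bar> + 1)))"
  have d': "d' > 0" using d e by (simp add: d'_def)
  show "\<exists>d>0. \<forall>y\<in>{a..b}. norm (y - x) < d \<longrightarrow> norm (f y - f x - (y - x) *\<^sub>R f' x) \<le> e * norm (y - x)"
  proof (intro exI[of _ d'] conjI ballI impI d')
    fix y assume y: "y \<in> {a..b}" "norm (y - x) < d'"
    have "\<bar>C\<bar> * \<bar>y - x\<bar> \<le> (\<bar>C\<bar> + 1) * (e / (2 * (\<bar>C\<bar> + 1)))"
      using y(2) unfolding d'_def by (intro mult_mono) auto
    also have "\<dots> = e/2" using e by (simp add: field_simps)
    finally have *: "\<bar>C\<bar> * \<bar>y - x\<bar> * \<bar>y - x\<bar> \<le> e/2 * \<bar>y - x\<bar>"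
      by (intro mult_right_mono) auto
    have Cs: "C * (y - x)\<^sup>2 \<le> e/2 * \<bar>y - x\<bar>"
    proof -
      have "C * (\<bar>y - x\<bar> * \<bar>y - x\<bar>) \<le> \<bar>C\<bar> * (\<bar>y - x\<bar> * \<bar>y - x\<bar>)"
        by (rule mult_right_mono) auto
      then have "C * (\<bar>y - x\<bar> * \<bar>y - x\<bar>) \<le> e/2 * \<bar>y - x\<bar>"
        using * unfolding mult.assoc by (rule order_trans)
      then show ?thesis unfolding power2_eq_square abs_mult_self_eq .
    qed
    show "norm (f y - f x - (y - x) *\<^sub>R f' x) \<le> e * norm (y - x)"
    proof (cases "x \<le> y")
      case True
      then have "norm (f y - f x - (y - x) *\<^sub>R f' x) \<le> C * (y - x)\<^sup>2"
        using exp[of x y] x y by auto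
      moreover have "0 \<le> e * \<bar>y - x\<bar>" using e by simp
      ultimately show ?thesis using Cs unfolding real_norm_def by linarith
    next
      \<comment> \<open>The hypothesis expands only forward in time. For y < x the expansion is
        taken at y, and \<open>f' y\<close> is then replaced by \<open>f' x\<close> through
        continuity of f'.\<close>
      case False
      have "norm (f y - f x - (y - x) *\<^sub>R f' x)
          = norm ((f x - f y - (x - y) *\<^sub>R f' y) + (x - y) *\<^sub>R (f' y - f' x))"
        by (subst norm_minus_cancel[symmetric]) (simp add: algebra_simps)
      also have "\<dots> \<le> C * (x - y)\<^sup>2 + \<bar>x - y\<bar> * norm (f' y - f' x)"
        using exp[of y x] x y False by (intro norm_triangle_mono) auto
      also have "\<dots> \<le> e/2 * \<bar>y - x\<bar> + \<bar>x - y\<bar> * (e/2)"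
        using Cs d(2)[OF y(1)] y(2) unfolding d'_def
        by (intro add_mono mult_left_mono) (auto simp: dist_norm power2_commute)
      finally show ?thesis by (simp add: abs_minus_commute)
    qed
  qed
qed

text \<open>Variation of constants: the factor exp((r - b) c) removes the linear term and leaves the
  derivative exp((r - b) c) g r, of norm at most \<gamma> exp((r - b) Re c). Bounding that
  exponential by 1 gives the factor b - a; integrating it gives 1 / Re c, uniformly in the length of
  the interval. The first form works without damping, as at frequency zero.\<close>

lemma linear_ode_bounds:
  fixes f g :: "real \<Rightarrow> complex"
  assumes ab: "a \<le> b"
    and f: "\<And>t. t \<in> {a..b} \<Longrightarrow> (f has_vector_derivative (g t - c * f t)) (at t within {a..b})"
    and g: "\<And>t. t \<in> {a..b} \<Longrightarrow> norm (g t) \<le> \<gamma>"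
    and c: "Re c \<ge> 0"
  shows linear_ode_bound_length: "norm (f b - exp (- (of_real (b - a) * c)) * f a) \<le> \<gamma> * (b - a)"
    and linear_ode_bound_rate: "Re c > 0 \<Longrightarrow> norm (f b - exp (- (of_real (b - a) * c)) * f a) \<le> \<gamma> / Re c"
proof -
  define h where "h r = exp (of_real (r - b) * c) * f r" for r
  have g0: "\<gamma> \<ge> 0" using order_trans[OF norm_ge_zero g[of a]] ab by simp
  have hd: "(h has_vector_derivative exp (of_real (r - b) * c) * g r) (at r within {a..b})" if "r \<in> {a..b}" for r
  proof -
    have "((\<lambda>z. exp ((z - of_real b) * c)) has_field_derivative c * exp (of_real (r - b) * c)) (at (of_real r))"
      by (auto intro!: derivative_eq_intros)
    then have "((\<lambda>r. exp (of_real (r - b) * c)) has_vector_derivative c * exp (of_real (r - b) * c)) (at r within {a..b})"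
      unfolding of_real_diff by (rule has_vector_derivative_real_field)
    from has_vector_derivative_mult[OF this f[OF that]]
    show ?thesis unfolding h_def by (simp add: algebra_simps)
  qed
  have hc: "continuous_on {a..b} h"
    using hd by (rule continuous_on_vector_derivative)
  have hd': "(h has_vector_derivative exp (of_real (r - b) * c) * g r) (at r)" if "a < r" "r < b" for r
    using hd[of r] that by (simp add: at_within_Icc_at)
  have ne: "norm (exp (of_real (r - b) * c) * g r) \<le> exp ((r - b) * Re c) * \<gamma>" if "a < r" "r < b" for r
    using g[of r] that by (simp add: norm_mult)
  have hba: "f b - exp (- (of_real (b - a) * c)) * f a = h b - h a"
    unfolding h_def by (simp add: algebra_simps)
  show "norm (f b - exp (- (of_real (b - a) * c)) * f a) \<le> \<gamma> * (b - a)"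
  proof (cases "a = b")
    case False
    have "norm (h b - h a) \<le> \<gamma> * b - \<gamma> * a"
    proof (rule differentiable_bound_general[OF _ hc _ hd', of "\<lambda>x. \<gamma> * x" "\<lambda>_. \<gamma>"])
      show "norm (exp (of_real (x - b) * c) * g x) \<le> \<gamma>" if "a < x" "x < b" for x
      proof -
        have "(x - b) * Re c \<le> 0" using that c by (simp add: mult_nonpos_nonneg)
        then have "exp ((x - b) * Re c) * \<gamma> \<le> 1 * \<gamma>" using g0 by (intro mult_right_mono) auto
        then show ?thesis using ne[OF that] by simp
      qed
      show "((\<lambda>x. \<gamma> * x) has_vector_derivative \<gamma>) (at x)" for x
        unfolding has_real_derivative_iff_has_vector_derivative[symmetric]
        by (auto intro!: derivative_eq_intros)
    qed (use ab False in \<open>auto intro!: continuous_intros\<close>)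
    then show ?thesis unfolding hba by (simp add: algebra_simps)
  qed simp
  show "norm (f b - exp (- (of_real (b - a) * c)) * f a) \<le> \<gamma> / Re c" if c: "Re c > 0"
  proof (cases "a = b")
    case False
    have "norm (h b - h a) \<le> \<gamma> / Re c * exp ((b - b) * Re c) - \<gamma> / Re c * exp ((a - b) * Re c)"
    proof (rule differentiable_bound_general[OF _ hc _ hd', of "\<lambda>x. \<gamma> / Re c * exp ((x - b) * Re c)" "\<lambda>x. exp ((x - b) * Re c) * \<gamma>"])
      show "((\<lambda>x. \<gamma> / Re c * exp ((x - b) * Re c)) has_vector_derivative exp ((x - b) * Re c) * \<gamma>) (at x)" for x
        unfolding has_real_derivative_iff_has_vector_derivative[symmetric]
        using c by (auto intro!: derivative_eq_intros)
    qed (use ab False ne c in \<open>auto intro!: continuous_intros\<close>)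
    also have "\<dots> \<le> \<gamma> / Re c" using g0 c by simp
    finally show ?thesis unfolding hba .
  qed (use g0 c in simp)
qed

section \<open>Convergence of characteristic functions\<close>

inductive trig_poly :: "nat \<Rightarrow> ((nat \<Rightarrow> 'b::euclidean_space) \<Rightarrow> complex) \<Rightarrow> bool" for n where
  char: "trig_poly n (\<lambda>v. c * exp (\<i> * of_real (\<Sum>k<n. l k \<bullet> v k)))"
| add: "trig_poly n p \<Longrightarrow> trig_poly n q \<Longrightarrow> trig_poly n (\<lambda>v. p v + q v)"

lemma trig_poly_const: "trig_poly n (\<lambda>v. c)"
  using trig_poly.char[of n c "\<lambda>_. 0"] by simp

lemma trig_poly_mult:
  assumes "trig_poly n p" "trig_poly n q"
  shows "trig_poly n (\<lambda>v. p v * q v)"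
  using assms
proof (induction arbitrary: q)
  case (char c l)
  from char.prems show ?case
  proof induction
    case (char c' l')
    have "(\<lambda>v. c * exp (\<i> * of_real (\<Sum>k<n. l k \<bullet> v k)) * (c' * exp (\<i> * of_real (\<Sum>k<n. l' k \<bullet> v k))))
      = (\<lambda>v. (c * c') * exp (\<i> * of_real (\<Sum>k<n. (l k + l' k) \<bullet> v k)))"
      by (simp add: fun_eq_iff exp_add[symmetric] inner_add_left sum.distrib algebra_simps)
    then show ?case using trig_poly.char[of n "c * c'" "\<lambda>k. l k + l' k"] by simp
  next
    case (add p q)
    then show ?case using trig_poly.add by (fastforce simp: distrib_left)
  qed
next
  case (add p p')
  have "trig_poly n (\<lambda>v. p v * q v + p' v * q v)"
    using add by (intro trig_poly.add) auto
  then show ?case by (simp add: distrib_right)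
qed

lemma trig_poly_sin:
  assumes "k < n"
  shows "trig_poly n (\<lambda>v. of_real (sin (v k \<bullet> b / R)))"
proof -
  define l where "l s j = (if j = k then (s / R) *\<^sub>R b else 0)" for s :: real and j
  have l: "(\<Sum>j<n. l s j \<bullet> v j) = s * (v k \<bullet> b / R)" for v s
  proof -
    have "(\<Sum>j<n. l s j \<bullet> v j) = (\<Sum>j\<in>{k}. l s j \<bullet> v j)"
      using assms by (intro sum.mono_neutral_right) (auto simp: l_def)
    then show ?thesis by (simp add: l_def inner_commute)
  qed
  have "trig_poly n (\<lambda>v. 1/(2*\<i>) * exp (\<i> * of_real (\<Sum>j<n. l 1 j \<bullet> v j)) + (-1/(2*\<i>)) * exp (\<i> * of_real (\<Sum>j<n. l (-1) j \<bullet> v j)))"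
    by (intro trig_poly.intros)
  also have "(\<lambda>v. 1/(2*\<i>) * exp (\<i> * of_real (\<Sum>j<n. l 1 j \<bullet> v j)) + (-1/(2*\<i>)) * exp (\<i> * of_real (\<Sum>j<n. l (-1) j \<bullet> v j)))
    = (\<lambda>v. of_real (sin (v k \<bullet> b / R)))"
    unfolding l by (rule ext, subst sin_of_real[symmetric], subst sin_exp_eq) (simp add: field_simps)
  finally show ?thesis .
qed

text \<open>The algebra for Stone--Weierstrass. Points are infinite sequences, whose cube is compact
  in the product topology, so one type serves every number of coordinates.\<close>

inductive coord_poly :: "((nat \<Rightarrow> 'b::euclidean_space) \<Rightarrow> real) \<Rightarrow> bool" where
  const: "coord_poly (\<lambda>s. c)"
| coord: "b \<in> Basis \<Longrightarrow> coord_poly (\<lambda>s. s k \<bullet> b)"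
| add: "coord_poly p \<Longrightarrow> coord_poly q \<Longrightarrow> coord_poly (\<lambda>s. p s + q s)"
| mult: "coord_poly p \<Longrightarrow> coord_poly q \<Longrightarrow> coord_poly (\<lambda>s. p s * q s)"

text \<open>Sends every sequence into the cube. A coordinate polynomial composed with it is a
  trigonometric polynomial in the first \<open>n\<close> entries, and a bound on the cube becomes a
  bound for all \<open>v\<close>.\<close>

definition sin_fold :: "nat \<Rightarrow> real \<Rightarrow> (nat \<Rightarrow> 'b::euclidean_space) \<Rightarrow> nat \<Rightarrow> 'b" where
  "sin_fold n R v k = (if k < n then (\<Sum>b\<in>Basis. sin (v k \<bullet> b / R) *\<^sub>R b) else 0)"

lemma sin_fold_inner:
  "b \<in> Basis \<Longrightarrow> sin_fold n R v k \<bullet> b = (if k < n then sin (v k \<bullet> b / R) else 0)"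
  by (simp add: sin_fold_def)

lemma trig_poly_coord_poly:
  assumes "coord_poly p"
  shows "trig_poly n (\<lambda>v. of_real (p (sin_fold n R v)))"
  using assms
proof induction
  case (coord b k)
  then show ?case
    by (cases "k < n") (simp_all add: sin_fold_inner trig_poly_sin trig_poly_const)
qed (auto simp: trig_poly_const intro: trig_poly.add trig_poly_mult)

lemma compact_cube_fun: "compact {s :: nat \<Rightarrow> 'b::euclidean_space. \<forall>k. s k \<in> cbox (-One) One}"
proof -
  have "compactin (product_topology (\<lambda>_::nat. euclidean) UNIV) (PiE UNIV (\<lambda>_. cbox (-One) One :: 'b set))"
    unfolding compactin_PiE by auto
  then show ?thesis
    unfolding euclidean_product_topology by (simp add: PiE_UNIV_domain Pi_def)
qed

lemma coord_poly_continuous: "coord_poly p \<Longrightarrow> continuous_on UNIV p"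
proof (induction rule: coord_poly.induct)
  case (coord b k)
  have "continuous_on UNIV (\<lambda>s :: nat \<Rightarrow> 'a. s k)"
    by (rule continuous_on_product_coordinates)
  then show ?case by (intro continuous_intros)
qed (auto intro!: continuous_intros)

text \<open>Stone--Weierstrass applies to $s \mapsto g(R \arcsin s)$ on the cube $[-1,1]^d$, and substituting
  $s = \sin(v/R)$ gives back $g(v)$ as long as $|v| \le R$, with a bound for all $v$.\<close>

lemma trig_poly_approx:
  fixes g :: "(nat \<Rightarrow> 'b::euclidean_space) \<Rightarrow> real"
  assumes g: "continuous_on UNIV g" and dep: "\<And>v w. (\<forall>k<n. v k = w k) \<Longrightarrow> g v = g w"
    and bnd: "\<And>v. \<bar>g v\<bar> \<le> B" and R: "R > 0" and e: "e > 0"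
  obtains p where "trig_poly n (\<lambda>v. of_real (p v))"
    "\<And>v. \<bar>p v\<bar> \<le> B + e" "\<And>v. (\<forall>k<n. norm (v k) \<le> R) \<Longrightarrow> \<bar>p v - g v\<bar> < e"
proof -
  define S where "S = {s :: nat \<Rightarrow> 'b. \<forall>k. s k \<in> cbox (-One) One}"
  define u where "u s k = (\<Sum>b\<in>Basis. (R * arcsin (s k \<bullet> b)) *\<^sub>R b)" for s :: "nat \<Rightarrow> 'b" and k :: nat
  have S: "\<bar>s k \<bullet> b\<bar> \<le> 1" if "s \<in> S" "b \<in> Basis" for s k b
    using that unfolding S_def by (auto simp: mem_box abs_le_iff)
  have cc: "continuous_on A (\<lambda>s :: nat \<Rightarrow> 'b. s k)" for A k
    by (rule continuous_on_subset[OF continuous_on_product_coordinates]) auto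
  have cu: "continuous_on S u"
    unfolding u_def
    by (intro continuous_on_coordinatewise_then_product continuous_intros cc) (use S in \<open>auto simp: abs_le_iff minus_le_iff\<close>)
  have cg: "continuous_on S (\<lambda>s. g (u s))"
    by (rule continuous_on_compose2[OF g cu]) auto
  have "\<exists>p. coord_poly p \<and> (\<forall>s\<in>S. \<bar>g (u s) - p s\<bar> < e)"
  proof (rule Stone_Weierstrass_HOL[OF _ _ _ _ _ _ cg e])
    show "compact S" unfolding S_def by (rule compact_cube_fun)
    show "\<exists>f. coord_poly f \<and> f x \<noteq> f y" if "x \<in> S \<and> y \<in> S \<and> x \<noteq> y" for x y :: "nat \<Rightarrow> 'b"
    proof -
      from that obtain k where "x k \<noteq> y k" by blast
      then obtain b where "b \<in> Basis" "x k \<bullet> b \<noteq> y k \<bullet> b" by (meson euclidean_eqI)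
      then show ?thesis using coord_poly.coord[of b k] by auto
    qed
  qed (auto intro: coord_poly.intros continuous_on_subset[OF coord_poly_continuous])
  then obtain p where p: "coord_poly p" "\<And>s. s \<in> S \<Longrightarrow> \<bar>g (u s) - p s\<bar> < e" by blast
  have inS: "sin_fold n R v \<in> S" for v
    unfolding S_def by (auto simp: mem_box sin_fold_inner)
  show ?thesis
  proof (rule that[of "\<lambda>v. p (sin_fold n R v)"])
    show "trig_poly n (\<lambda>v. of_real (p (sin_fold n R v)))" by (rule trig_poly_coord_poly[OF p(1)])
    show "\<bar>p (sin_fold n R v)\<bar> \<le> B + e" for v
      using p(2)[OF inS[of v]] bnd[of "u (sin_fold n R v)"] by linarith
    fix v :: "nat \<Rightarrow> 'b" assume v: "\<forall>k<n. norm (v k) \<le> R"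
    have "u (sin_fold n R v) k = v k" if k: "k < n" for k
    proof (rule euclidean_eqI)
      fix b :: 'b assume b: "b \<in> Basis"
      have "\<bar>v k \<bullet> b\<bar> \<le> R" using v k Basis_le_norm[OF b, of "v k"] by force
      then have "\<bar>v k \<bullet> b / R\<bar> \<le> 1" using R by (simp add: abs_mult)
      \<comment> \<open>\<open>arcsin\<close> inverts \<open>sin\<close> on [-pi/2, pi/2], and the
        bound by \<open>R\<close> puts the argument into [-1, 1].\<close>
      moreover have "1 \<le> pi/2" using pi_ge_two by simp
      ultimately have "arcsin (sin (v k \<bullet> b / R)) = v k \<bullet> b / R"
        by (intro arcsin_sin) linarith+
      then show "u (sin_fold n R v) k \<bullet> b = v k \<bullet> b"
        unfolding u_def using b k R by (simp add: sin_fold_inner)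
    qed
    then have "g (u (sin_fold n R v)) = g v" by (intro dep) auto
    then show "\<bar>p (sin_fold n R v) - g v\<bar> < e" using p(2)[OF inS[of v]] by linarith
  qed
qed

lemma integral_exp_linear_tendsto_trig_poly:
  fixes V :: "'i \<Rightarrow> 'a \<Rightarrow> nat \<Rightarrow> 'b::euclidean_space" and W :: "'c \<Rightarrow> nat \<Rightarrow> 'b"
  assumes M: "prob_space M" and N: "prob_space N"
    and V: "\<And>i k. (\<lambda>\<omega>. V i \<omega> k) \<in> borel_measurable M"
    and W: "\<And>k. (\<lambda>\<omega>. W \<omega> k) \<in> borel_measurable N"
    and char: "\<And>l. ((\<lambda>i. LINT \<omega>|M. exp (\<i> * of_real (\<Sum>k<n. l k \<bullet> V i \<omega> k))) \<longlongrightarrow>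
                  (LINT \<omega>|N. exp (\<i> * of_real (\<Sum>k<n. l k \<bullet> W \<omega> k)))) F"
    and p: "trig_poly n p"
  shows "((\<lambda>i. LINT \<omega>|M. p (V i \<omega>)) \<longlongrightarrow> (LINT \<omega>|N. p (W \<omega>))) F"
proof -
  interpret M: prob_space M by fact
  interpret N: prob_space N by fact
  \<comment> \<open>Integrability is carried through the induction, since the integral of a sum
    splits only for integrable summands.\<close>
  have "(\<forall>i. integrable M (\<lambda>\<omega>. p (V i \<omega>))) \<and> integrable N (\<lambda>\<omega>. p (W \<omega>)) \<and> ?thesis"
    using p
  proof induction
    case (char c l)
    have "integrable M (\<lambda>\<omega>. exp (\<i> * of_real (\<Sum>k<n. l k \<bullet> V i \<omega> k)))" for i
      using V by (intro M.integrable_const_bound[of _ 1]) auto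
    moreover have "integrable N (\<lambda>\<omega>. exp (\<i> * of_real (\<Sum>k<n. l k \<bullet> W \<omega> k)))"
      using W by (intro N.integrable_const_bound[of _ 1]) auto
    ultimately show ?case using tendsto_mult_left[OF assms(5)[of l], of c] by simp
  next
    case (add p q)
    then show ?case by (auto intro: tendsto_add)
  qed
  then show ?thesis by blast
qed

text \<open>While all entries stay below a large \<open>R\<close>, g is uniformly close to a
  trigonometric polynomial p, for which convergence is linear in the hypothesis; elsewhere |g - p|
  is bounded and the probability is small. Tightness enters as a separate hypothesis because the
  application reads it off the fourth moments.\<close>

theorem levy_continuity_finite_dim:
  fixes V :: "'i \<Rightarrow> 'a \<Rightarrow> nat \<Rightarrow> 'b::euclidean_space" and W :: "'c \<Rightarrow> nat \<Rightarrow> 'b"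
  assumes M: "prob_space M" and N: "prob_space N"
    and V: "\<And>i k. (\<lambda>\<omega>. V i \<omega> k) \<in> borel_measurable M"
    and W: "\<And>k. (\<lambda>\<omega>. W \<omega> k) \<in> borel_measurable N"
    and char: "\<And>l. ((\<lambda>i. LINT \<omega>|M. exp (\<i> * of_real (\<Sum>k<n. l k \<bullet> V i \<omega> k))) \<longlongrightarrow>
                  (LINT \<omega>|N. exp (\<i> * of_real (\<Sum>k<n. l k \<bullet> W \<omega> k)))) F"
    and tightV: "\<And>e. e > 0 \<Longrightarrow> \<exists>R>0. eventually (\<lambda>i. measure M {\<omega> \<in> space M. \<exists>k<n. norm (V i \<omega> k) > R} \<le> e) F"
    and g: "continuous_on UNIV g" and dep: "\<And>v w. (\<forall>k<n. v k = w k) \<Longrightarrow> g v = g w"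
    and bnd: "\<And>v. \<bar>g v\<bar> \<le> B"
  shows "((\<lambda>i. LINT \<omega>|M. g (V i \<omega>)) \<longlongrightarrow> (LINT \<omega>|N. g (W \<omega>) :: real)) F"
proof (rule tendstoI)
  interpret M: prob_space M by fact
  interpret N: prob_space N by fact
  fix e :: real assume e: "e > 0"
  have B: "B \<ge> 0" using bnd[of undefined] by linarith
  have mV: "V i \<in> borel_measurable M" for i
    by (rule measurable_coordinatewise_then_product) (rule V)
  have mW: "W \<in> borel_measurable N"
    by (rule measurable_coordinatewise_then_product) (rule W)
  have mg: "g \<in> borel_measurable borel" by (rule borel_measurable_continuous_onI[OF g])
  \<comment> \<open>The exceptional event costs at most (2 B + 2) \<delta> = e/8 and the
    approximation \<eta> \<le> e/8, so replacing g by p costs e/4 on either side. The cap \<eta>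
    \<le> 1 keeps |g - p| \<le> 2 B + 1 everywhere.\<close>
  define \<delta> where "\<delta> = e / (8 * (2 * B + 2))"
  have \<delta>: "\<delta> > 0" using e B by (simp add: \<delta>_def)
  define \<eta> where "\<eta> = min 1 (e / 8)"
  have \<eta>: "\<eta> > 0" "\<eta> \<le> 1" "\<eta> \<le> e/8" using e by (auto simp: \<eta>_def)
  obtain R1 where R1: "R1 > 0" "eventually (\<lambda>i. measure M {\<omega> \<in> space M. \<exists>k<n. norm (V i \<omega> k) > R1} \<le> \<delta>) F"
    using tightV[OF \<delta>] by blast
  \<comment> \<open>The single limit law is tight by itself: the events that some entry exceeds r
    decrease to the empty set.\<close>
  have "(\<lambda>r. measure N {\<omega> \<in> space N. \<exists>k<n. norm (W \<omega> k) > real r}) \<longlonglongrightarrow> measure N (\<Inter>r. {\<omega> \<in> space N. \<exists>k<n. norm (W \<omega> k) > real r})"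
    using W by (intro N.finite_Lim_measure_decseq) (auto simp: decseq_def intro: le_less_trans)
  also have "(\<Inter>r. {\<omega> \<in> space N. \<exists>k<n. norm (W \<omega> k) > real r}) = {}"
  proof -
    { fix \<omega> assume *: "\<forall>r::nat. \<exists>k<n. norm (W \<omega> k) > real r"
      obtain r where "(\<Sum>k<n. norm (W \<omega> k)) \<le> real r" using real_arch_simple by blast
      moreover from * obtain k where "k < n" "norm (W \<omega> k) > real r" by blast
      moreover have "norm (W \<omega> k) \<le> (\<Sum>k<n. norm (W \<omega> k))" using \<open>k < n\<close> by (intro member_le_sum) auto
      ultimately have False by linarith }
    then show ?thesis by blast
  qed
  finally have "eventually (\<lambda>r. measure N {\<omega> \<in> space N. \<exists>k<n. norm (W \<omega> k) > real r} < \<delta>) sequentially"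
    using \<delta> by (auto dest: order_tendstoD(2))
  then obtain r where r: "measure N {\<omega> \<in> space N. \<exists>k<n. norm (W \<omega> k) > real r} < \<delta>"
    by (auto simp: eventually_sequentially)
  define R where "R = max R1 (real r)"
  have R: "R > 0" using R1 by (simp add: R_def)
  have RM: "measure M {\<omega> \<in> space M. \<exists>k<n. norm (V i \<omega> k) > R} \<le> measure M {\<omega> \<in> space M. \<exists>k<n. norm (V i \<omega> k) > R1}" for i
    using V by (intro M.finite_measure_mono) (auto simp: R_def)
  have "measure N {\<omega> \<in> space N. \<exists>k<n. norm (W \<omega> k) > R} \<le> measure N {\<omega> \<in> space N. \<exists>k<n. norm (W \<omega> k) > real r}"
    using W by (intro N.finite_measure_mono) (auto simp: R_def)
  then have RN: "measure N {\<omega> \<in> space N. \<exists>k<n. norm (W \<omega> k) > R} \<le> \<delta>" using r by simp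
  obtain p where p: "trig_poly n (\<lambda>v. of_real (p v))" "\<And>v. \<bar>p v\<bar> \<le> B + \<eta>"
      "\<And>v. (\<forall>k<n. norm (v k) \<le> R) \<Longrightarrow> \<bar>p v - g v\<bar> < \<eta>"
    using trig_poly_approx[OF g dep bnd R \<eta>(1)] by blast
  have key: "\<bar>(LINT \<omega>|K. g (U \<omega>)) - (LINT \<omega>|K. p (U \<omega>))\<bar> \<le> e / 4"
    if K: "prob_space K" and U: "\<And>k. (\<lambda>\<omega>. U \<omega> k) \<in> borel_measurable K" and mU: "U \<in> borel_measurable K"
      and pU: "(\<lambda>\<omega>. p (U \<omega>)) \<in> borel_measurable K"
      and PU: "measure K {\<omega> \<in> space K. \<exists>k<n. norm (U \<omega> k) > R} \<le> \<delta>" for K :: "'k measure" and U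
  proof -
    interpret K: prob_space K by fact
    define A where "A = {\<omega> \<in> space K. \<exists>k<n. norm (U \<omega> k) > R}"
    have A: "A \<in> sets K" unfolding A_def using U by measurable
    have i1: "integrable K (\<lambda>\<omega>. g (U \<omega>))"
      using measurable_compose[OF mU mg] bnd by (intro K.integrable_const_bound[of _ B]) auto
    have i2: "integrable K (\<lambda>\<omega>. p (U \<omega>))"
      using pU p(2) by (intro K.integrable_const_bound[of _ "B + \<eta>"]) auto
    have i3: "integrable K (\<lambda>\<omega>. (2 * B + 1) * indicator A \<omega>)"
    proof -
      have "integrable K (indicator A :: _ \<Rightarrow> real)"
        using A by (rule integrable_real_indicator) (simp add: K.emeasure_eq_measure)
      then show ?thesis by (rule integrable_mult_right)
    qed
    have "\<bar>(LINT \<omega>|K. g (U \<omega>)) - (LINT \<omega>|K. p (U \<omega>))\<bar> = \<bar>LINT \<omega>|K. g (U \<omega>) - p (U \<omega>)\<bar>"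
      using i1 i2 by simp
    also have "\<dots> \<le> (LINT \<omega>|K. \<bar>g (U \<omega>) - p (U \<omega>)\<bar>)" by (rule integral_abs_bound)
    also have "\<dots> \<le> (LINT \<omega>|K. \<eta> + (2 * B + 1) * indicator A \<omega>)"
    proof (rule integral_mono)
      fix \<omega> assume w: "\<omega> \<in> space K"
      show "\<bar>g (U \<omega>) - p (U \<omega>)\<bar> \<le> \<eta> + (2 * B + 1) * indicator A \<omega>"
      proof (cases "\<omega> \<in> A")
        case True
        then show ?thesis using bnd[of "U \<omega>"] p(2)[of "U \<omega>"] \<eta> by simp
      next
        case False
        then have "\<forall>k<n. norm (U \<omega> k) \<le> R" using w False unfolding A_def by (metis (mono_tags, lifting) mem_Collect_eq not_less)
        from p(3)[OF this] have "\<bar>g (U \<omega>) - p (U \<omega>)\<bar> \<le> \<eta>" by linarith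
        then show ?thesis using False by simp
      qed
    next
      show "integrable K (\<lambda>\<omega>. \<bar>g (U \<omega>) - p (U \<omega>)\<bar>)"
        using i1 i2 by (intro integrable_abs Bochner_Integration.integrable_diff)
      show "integrable K (\<lambda>\<omega>. \<eta> + (2 * B + 1) * indicator A \<omega>)"
        by (rule Bochner_Integration.integrable_add[OF K.integrable_const i3])
    qed
    also have "\<dots> = \<eta> + (2 * B + 1) * measure K A"
      unfolding Bochner_Integration.integral_add[OF K.integrable_const i3]
      using A by (simp add: K.prob_space Int_absorb1 sets.sets_into_space)
    also have "\<dots> \<le> \<eta> + (2 * B + 2) * \<delta>"
      using PU B unfolding A_def[symmetric] by (intro add_left_mono mult_mono) auto
    also have "(2 * B + 2) * \<delta> = e / 8" using B unfolding \<delta>_def by (simp add: field_simps)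
    also have "\<eta> + e / 8 \<le> e / 4" using \<eta> by simp
    finally show ?thesis .
  qed
  have pm: "(\<lambda>\<omega>. p (U \<omega>)) \<in> borel_measurable K"
    if U: "\<And>k. (\<lambda>\<omega>. U \<omega> k) \<in> borel_measurable K" for K :: "'k measure" and U
  proof -
    have "(\<lambda>\<omega>. q (U \<omega>)) \<in> borel_measurable K" if "trig_poly n q" for q
      using that by induction (use U in measurable)
    from this[OF p(1)] have "(\<lambda>\<omega>. Re (of_real (p (U \<omega>)))) \<in> borel_measurable K" by measurable
    then show ?thesis by simp
  qed
  have "((\<lambda>i. LINT \<omega>|M. complex_of_real (p (V i \<omega>))) \<longlongrightarrow> (LINT \<omega>|N. complex_of_real (p (W \<omega>)))) F"
    by (rule integral_exp_linear_tendsto_trig_poly[OF M N V W char p(1)])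
  then have "((\<lambda>i. LINT \<omega>|M. p (V i \<omega>)) \<longlongrightarrow> (LINT \<omega>|N. p (W \<omega>))) F"
    by (simp add: tendsto_of_real_iff)
  then have "eventually (\<lambda>i. dist (LINT \<omega>|M. p (V i \<omega>)) (LINT \<omega>|N. p (W \<omega>)) < e / 4) F"
    using e by (intro tendstoD) auto
  then show "eventually (\<lambda>i. dist (LINT \<omega>|M. g (V i \<omega>)) (LINT \<omega>|N. g (W \<omega>)) < e) F"
    using R1(2)
  proof eventually_elim
    case (elim i)
    have "\<bar>(LINT \<omega>|M. g (V i \<omega>)) - (LINT \<omega>|M. p (V i \<omega>))\<bar> \<le> e / 4"
      using elim(2) RM[of i] by (intro key M V mV pm) auto
    moreover have "\<bar>(LINT \<omega>|N. g (W \<omega>)) - (LINT \<omega>|N. p (W \<omega>))\<bar> \<le> e / 4"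
      using RN by (intro key N W mW pm) auto
    ultimately show ?case using elim(1) e unfolding dist_real_def by linarith
  qed
qed

section \<open>Weak convergence through Lipschitz test functions\<close>

lemma lipschitz_continuous_map:
  fixes g :: "'p \<Rightarrow> real"
  assumes lip: "\<And>x y. x \<in> mspace m \<Longrightarrow> y \<in> mspace m \<Longrightarrow> \<bar>g x - g y\<bar> \<le> L * mdist m x y"
  shows "continuous_map (mtopology_of m) euclideanreal g"
proof -
  interpret Metric_space "mspace m" "mdist m" by (rule Metric_space_mspace_mdist)
  have "continuous_map mtopology (Metric_space.mtopology UNIV dist) g"
  proof (subst Metric_space.continuous_map_to_metric[OF Met_TC.Metric_space_axioms], intro ballI allI impI)
    fix x and r :: real assume x: "x \<in> topspace mtopology" and r: "r > 0"
    then have xm: "x \<in> mspace m" by simp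
    have "g y \<in> Met_TC.mball (g x) r" if "y \<in> mball x (r / (\<bar>L\<bar> + 1))" for y
    proof -
      from that have y: "y \<in> mspace m" "mdist m x y < r / (\<bar>L\<bar> + 1)" by (auto simp: in_mball)
      have "L * mdist m x y \<le> (\<bar>L\<bar> + 1) * mdist m x y" by (intro mult_right_mono) auto
      also have "\<dots> < r" using y(2) by (simp add: field_simps)
      finally show ?thesis using lip[OF xm y(1)] by (simp add: dist_real_def)
    qed
    then show "\<exists>U. openin mtopology U \<and> x \<in> U \<and> (\<forall>y\<in>U. g y \<in> Met_TC.mball (g x) r)"
      using xm r by (intro exI[of _ "mball x (r / (\<bar>L\<bar> + 1))"]) auto
  qed
  then show ?thesis by (simp add: mtopology_of_def)
qed

text \<open>Inf-convolution: \<open>g k\<close> x = inf over y of f y + k d(x, y) is k-Lipschitz,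
  lies below f, and tends to f pointwise by continuity. Dominated convergence under the limit law
  selects k; since \<open>g k\<close> \<le> f, only a lower bound for the integrals of f
  results.\<close>

lemma lower_semicontinuity_from_lipschitz:
  fixes f :: "'p \<Rightarrow> real"
  assumes M: "prob_space M" and N: "prob_space N"
    and Y: "\<And>i \<omega>. \<omega> \<in> space M \<Longrightarrow> Y i \<omega> \<in> mspace m"
    and Z: "\<And>\<omega>. \<omega> \<in> space N \<Longrightarrow> Z \<omega> \<in> mspace m"
    and mY: "\<And>i f. continuous_map (mtopology_of m) euclideanreal f \<Longrightarrow> (\<lambda>\<omega>. f (Y i \<omega>)) \<in> borel_measurable M"
    and mZ: "\<And>f. continuous_map (mtopology_of m) euclideanreal f \<Longrightarrow> (\<lambda>\<omega>. f (Z \<omega>)) \<in> borel_measurable N"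
    and lip: "\<And>f L B. (\<And>x y. x \<in> mspace m \<Longrightarrow> y \<in> mspace m \<Longrightarrow> \<bar>f x - f y\<bar> \<le> L * mdist m x y) \<Longrightarrow>
        (\<And>x. x \<in> mspace m \<Longrightarrow> \<bar>f x\<bar> \<le> B) \<Longrightarrow>
        ((\<lambda>i. LINT \<omega>|M. f (Y i \<omega>)) \<longlongrightarrow> (LINT \<omega>|N. f (Z \<omega>) :: real)) F"
    and f: "continuous_map (mtopology_of m) euclideanreal f"
    and B: "\<And>x. x \<in> mspace m \<Longrightarrow> \<bar>f x\<bar> \<le> B" and e: "e > 0"
  shows "eventually (\<lambda>i. (LINT \<omega>|M. f (Y i \<omega>)) > (LINT \<omega>|N. f (Z \<omega>)) - e) F"
proof -
  interpret M: prob_space M by fact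
  interpret N: prob_space N by fact
  interpret Metric_space "mspace m" "mdist m" by (rule Metric_space_mspace_mdist)
  have mt: "mtopology_of m = mtopology" by (simp add: mtopology_of_def)
  obtain \<omega>0 where w0: "\<omega>0 \<in> space N" using N.not_empty by blast
  define z0 where "z0 = Z \<omega>0"
  have z0: "z0 \<in> mspace m" using Z w0 by (simp add: z0_def)
  then have B0: "B \<ge> 0" using B[OF z0] by linarith
  define g where "g k x = (INF y\<in>mspace m. f y + real k * mdist m x y)" for k x
  have bdd: "bdd_below ((\<lambda>y. f y + real k * mdist m x y) ` mspace m)" for k x
    using B by (intro bdd_belowI2[of _ "-B"]) (smt (verit, best) mdist_nonneg mult_nonneg_nonneg of_nat_0_le_iff)
  have g_le: "g k x \<le> f y + real k * mdist m x y" if "y \<in> mspace m" for k x y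
    unfolding g_def by (rule cINF_lower[OF bdd that])
  have g_ge: "g k x \<ge> c" if "\<And>y. y \<in> mspace m \<Longrightarrow> c \<le> f y + real k * mdist m x y" for k x c
    unfolding g_def using z0 that by (intro cINF_greatest) auto
  have g_f: "g k x \<le> f x" if "x \<in> mspace m" for k x
    using g_le[OF that, of k x] that by simp
  have g_B: "\<bar>g k x\<bar> \<le> B" if x: "x \<in> mspace m" for k x
  proof -
    have "-B \<le> g k x"
      using B by (intro g_ge) (smt (verit, best) mdist_nonneg mult_nonneg_nonneg of_nat_0_le_iff)
    then show ?thesis using g_f[OF x, of k] B[OF x] by linarith
  qed
  have g_lip1: "g k x \<le> g k x' + real k * mdist m x x'" if x: "x \<in> mspace m" "x' \<in> mspace m" for k x x'
  proof -
    have "g k x - real k * mdist m x x' \<le> g k x'"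
    proof (rule g_ge)
      fix y assume y: "y \<in> mspace m"
      have "real k * mdist m x y \<le> real k * (mdist m x x' + mdist m x' y)"
        using triangle[OF x y] by (intro mult_left_mono) auto
      then show "g k x - real k * mdist m x x' \<le> f y + real k * mdist m x' y"
        using g_le[OF y, of k x] by (simp add: algebra_simps)
    qed
    then show ?thesis by simp
  qed
  have g_lip: "\<bar>g k x - g k x'\<bar> \<le> real k * mdist m x x'" if x: "x \<in> mspace m" "x' \<in> mspace m" for k x x'
    using g_lip1[OF x, of k] g_lip1[OF x(2,1), of k] unfolding commute[of x' x] by linarith
  have g_cont: "continuous_map (mtopology_of m) euclideanreal (g k)" for k
    by (rule lipschitz_continuous_map[OF g_lip])
  have g_lim: "(\<lambda>k. g k x) \<longlonglongrightarrow> f x" if x: "x \<in> mspace m" for x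
  proof (rule LIMSEQ_I)
    fix r :: real assume r: "r > 0"
    have "openin mtopology {y \<in> topspace mtopology. f y \<in> {f x - r / 2<..}}"
      using f unfolding mt by (rule openin_continuous_map_preimage) auto
    then obtain d where d: "d > 0" "mball x d \<subseteq> {y \<in> topspace mtopology. f y \<in> {f x - r/2<..}}"
      using x r unfolding openin_mtopology by fastforce
    \<comment> \<open>From distance d on, the penalty K d exceeds 2 B and thus any gap between
      values of f, so only points near x can lower the infimum appreciably.\<close>
    obtain K :: nat where K: "2 * B / d \<le> real K" using real_arch_simple by blast
    show "\<exists>no. \<forall>n\<ge>no. norm (g n x - f x) < r"
    proof (intro exI[of _ K] allI impI)
      fix n assume n: "n \<ge> K"
      have "f x - r/2 \<le> g n x"
      proof (rule g_ge)
        fix y assume y: "y \<in> mspace m"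
        show "f x - r/2 \<le> f y + real n * mdist m x y"
        proof (cases "mdist m x y < d")
          case True
          then have "f y > f x - r/2" using d(2) x y by (auto simp: in_mball subset_iff)
          moreover have "0 \<le> real n * mdist m x y" by simp
          ultimately show ?thesis by linarith
        next
          case False
          have "2 * B \<le> real K * d" using K d(1) by (simp add: field_simps)
          also have "\<dots> \<le> real n * mdist m x y" using n False d(1) by (intro mult_mono) auto
          finally show ?thesis using B[OF x] B[OF y] r by linarith
        qed
      qed
      then show "norm (g n x - f x) < r" using g_f[OF x, of n] r by simp
    qed
  qed
  have "(\<lambda>k. LINT \<omega>|N. g k (Z \<omega>)) \<longlonglongrightarrow> (LINT \<omega>|N. f (Z \<omega>))"
    by (rule integral_dominated_convergence[where w = "\<lambda>_. B"])
       (use mZ f g_cont g_lim g_B Z in \<open>auto intro!: AE_I2\<close>)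
  then have "eventually (\<lambda>k. (LINT \<omega>|N. g k (Z \<omega>)) > (LINT \<omega>|N. f (Z \<omega>)) - e/2) sequentially"
    using e by (intro order_tendstoD(1)) auto
  then obtain k where k: "(LINT \<omega>|N. g k (Z \<omega>)) > (LINT \<omega>|N. f (Z \<omega>)) - e/2"
    by (auto simp: eventually_sequentially)
  have "((\<lambda>i. LINT \<omega>|M. g k (Y i \<omega>)) \<longlongrightarrow> (LINT \<omega>|N. g k (Z \<omega>))) F"
    by (rule lip[OF g_lip g_B])
  then have "eventually (\<lambda>i. (LINT \<omega>|M. g k (Y i \<omega>)) > (LINT \<omega>|N. g k (Z \<omega>)) - e/2) F"
    using e by (intro order_tendstoD(1)) auto
  then show ?thesis
  proof eventually_elim
    case (elim i)
    have "(LINT \<omega>|M. g k (Y i \<omega>)) \<le> (LINT \<omega>|M. f (Y i \<omega>))"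
    proof (rule integral_mono)
      show "integrable M (\<lambda>\<omega>. g k (Y i \<omega>))"
        using mY[OF g_cont] g_B Y by (intro M.integrable_const_bound[of _ B]) auto
      show "integrable M (\<lambda>\<omega>. f (Y i \<omega>))"
        using mY[OF f] B Y by (intro M.integrable_const_bound[of _ B]) auto
    qed (use g_f Y in auto)
    then show ?case using elim k by linarith
  qed
qed

text \<open>The one-sided bound applied to f and to -f.\<close>

lemma weak_convergence_from_lipschitz:
  fixes f :: "'p \<Rightarrow> real"
  assumes M: "prob_space M" and N: "prob_space N"
    and Y: "\<And>i \<omega>. \<omega> \<in> space M \<Longrightarrow> Y i \<omega> \<in> mspace m"
    and Z: "\<And>\<omega>. \<omega> \<in> space N \<Longrightarrow> Z \<omega> \<in> mspace m"
    and mY: "\<And>i f. continuous_map (mtopology_of m) euclideanreal f \<Longrightarrow> (\<lambda>\<omega>. f (Y i \<omega>)) \<in> borel_measurable M"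
    and mZ: "\<And>f. continuous_map (mtopology_of m) euclideanreal f \<Longrightarrow> (\<lambda>\<omega>. f (Z \<omega>)) \<in> borel_measurable N"
    and lip: "\<And>f L B. (\<And>x y. x \<in> mspace m \<Longrightarrow> y \<in> mspace m \<Longrightarrow> \<bar>f x - f y\<bar> \<le> L * mdist m x y) \<Longrightarrow>
        (\<And>x. x \<in> mspace m \<Longrightarrow> \<bar>f x\<bar> \<le> B) \<Longrightarrow>
        ((\<lambda>i. LINT \<omega>|M. f (Y i \<omega>)) \<longlongrightarrow> (LINT \<omega>|N. f (Z \<omega>) :: real)) F"
    and f: "continuous_map (mtopology_of m) euclideanreal f"
    and B: "\<And>x. x \<in> mspace m \<Longrightarrow> \<bar>f x\<bar> \<le> B"
  shows "((\<lambda>i. LINT \<omega>|M. f (Y i \<omega>)) \<longlongrightarrow> (LINT \<omega>|N. f (Z \<omega>))) F"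
proof (rule tendstoI)
  fix e :: real assume e: "e > 0"
  have "eventually (\<lambda>i. (LINT \<omega>|M. f (Y i \<omega>)) > (LINT \<omega>|N. f (Z \<omega>)) - e) F"
    by (rule lower_semicontinuity_from_lipschitz[OF M N Y Z mY mZ lip f B e])
  moreover have "eventually (\<lambda>i. (LINT \<omega>|M. - f (Y i \<omega>)) > (LINT \<omega>|N. - f (Z \<omega>)) - e) F"
    using f B by (intro lower_semicontinuity_from_lipschitz[OF M N Y Z mY mZ lip _ _ e, where f="\<lambda>x. - f x" and B=B])
      (auto intro: continuous_map_minus)
  ultimately show "eventually (\<lambda>i. dist (LINT \<omega>|M. f (Y i \<omega>)) (LINT \<omega>|N. f (Z \<omega>)) < e) F"
    by eventually_elim (auto simp: dist_real_def)
qed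

section \<open>The Markov property of a Levy process\<close>

text \<open>Right continuity allows sampling at the next grid point strictly to the right, which
  turns the process into one with countably many sampling times. Clamping the time to [0, s]
  confines the samples to times where \<open>Y\<close> is measurable for \<open>K\<close>, so
  \<open>K\<close> may be the past of time s.\<close>

lemma cadlag_joint_measurable:
  fixes Y :: "real \<Rightarrow> 'a \<Rightarrow> real"
  assumes s: "s \<ge> 0" and Y: "\<And>r. r \<in> {0..s} \<Longrightarrow> Y r \<in> borel_measurable K"
    and cad: "\<And>\<omega>. \<omega> \<in> space K \<Longrightarrow> cadlag (\<lambda>r. Y r \<omega>)"
  shows "(\<lambda>(r, \<omega>). Y (max 0 (min s r)) \<omega>) \<in> borel_measurable (borel \<Otimes>\<^sub>M K)"
proof -
  define q where "q n i = min s (max 0 ((real_of_int i + 1) / real (Suc n)))" for n i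
  define c where "c r = max 0 (min s r)" for r
  have c: "c r \<in> {0..s}" for r using s by (auto simp: c_def)
  have qs: "q n i \<in> {0..s}" for n i using s by (auto simp: q_def)
  show ?thesis
  proof (rule borel_measurable_LIMSEQ_real)
    fix n
    have "(\<lambda>p. (\<lambda>i p. Y (q n i) (snd p)) (\<lfloor>real (Suc n) * c (fst p)\<rfloor>) p) \<in> borel_measurable (borel \<Otimes>\<^sub>M K)"
    proof (rule measurable_compose_countable)
      show "(\<lambda>p. Y (q n i) (snd p)) \<in> borel_measurable (borel \<Otimes>\<^sub>M K)" for i
        using Y[OF qs[of n i]] by measurable
      show "(\<lambda>p. \<lfloor>real (Suc n) * c (fst p)\<rfloor>) \<in> measurable (borel \<Otimes>\<^sub>M K) (count_space UNIV)"
        unfolding c_def by measurable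
    qed
    then show "(\<lambda>p. Y (q n \<lfloor>real (Suc n) * c (fst p)\<rfloor>) (snd p)) \<in> borel_measurable (borel \<Otimes>\<^sub>M K)" .
  next
    fix p :: "real \<times> 'a" assume p: "p \<in> space (borel \<Otimes>\<^sub>M K)"
    obtain r \<omega> where rw: "p = (r, \<omega>)" by force
    have w: "\<omega> \<in> space K" using p rw by (simp add: space_pair_measure)
    let ?t = "\<lambda>n. q n \<lfloor>real (Suc n) * c r\<rfloor>"
    have c0: "c r \<ge> 0" "c r \<le> s" using c[of r] by auto
    have gt: "(real_of_int \<lfloor>real (Suc n) * c r\<rfloor> + 1) / real (Suc n) > c r" for n
    proof -
      have "real (Suc n) * c r < real_of_int \<lfloor>real (Suc n) * c r\<rfloor> + 1" by linarith
      then show ?thesis by (simp add: field_simps)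
    qed
    have le: "(real_of_int \<lfloor>real (Suc n) * c r\<rfloor> + 1) / real (Suc n) \<le> c r + 1 / real (Suc n)" for n
    proof -
      have "real_of_int \<lfloor>real (Suc n) * c r\<rfloor> + 1 \<le> real (Suc n) * c r + 1" by linarith
      then have "(real_of_int \<lfloor>real (Suc n) * c r\<rfloor> + 1) / real (Suc n) \<le> (real (Suc n) * c r + 1) / real (Suc n)"
        by (rule divide_right_mono) simp
      then show ?thesis by (simp add: add_divide_distrib)
    qed
    have "(\<lambda>n. Y (?t n) \<omega>) \<longlonglongrightarrow> Y (c r) \<omega>"
    \<comment> \<open>At the right end no admissible point lies further to the right; there the
      clamp makes every sample equal to the value at s.\<close>
    proof (cases "c r = s")
      case True
      have "?t n = s" for n
        unfolding q_def using gt[of n] True s by (simp add: min_def max_def)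
      then show ?thesis using True by simp
    next
      case False
      then have cs: "c r < s" using c0 by simp
      have gt': "?t n > c r" for n unfolding q_def using gt[of n] cs c0 by (simp add: max_def)
      have le': "?t n \<le> c r + 1 / real (Suc n)" for n
        unfolding q_def using le[of n] gt[of n] c0 by (simp add: max_def min_def)
      have "(\<lambda>n. c r + 1 / real (Suc n)) \<longlonglongrightarrow> c r + 0"
        by (intro tendsto_intros LIMSEQ_Suc[OF lim_inverse_n'])
      then have lim: "(\<lambda>n. c r + 1 / real (Suc n)) \<longlonglongrightarrow> c r" unfolding add_0_right .
      have "?t \<longlonglongrightarrow> c r"
        by (rule tendsto_sandwich[OF always_eventually always_eventually tendsto_const lim])
           (intro allI less_imp_le gt' le')+
      then have "filterlim ?t (at_right (c r)) sequentially"
        using gt'[THEN less_imp_neq, THEN not_sym] gt'[THEN greaterThan_iff[THEN iffD2]]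
        unfolding filterlim_at by (intro conjI always_eventually allI)
      moreover have "((\<lambda>x. Y x \<omega>) \<longlongrightarrow> Y (c r) \<omega>) (at_right (c r))"
        using cad[OF w] c0 unfolding cadlag_def by blast
      ultimately show ?thesis by (rule filterlim_compose[rotated])
    qed
    then show "(\<lambda>n. Y (q n \<lfloor>real (Suc n) * c (fst p)\<rfloor>) (snd p)) \<longlonglongrightarrow> (case p of (r, \<omega>) \<Rightarrow> Y (max 0 (min s r)) \<omega>)"
      by (simp add: rw c_def)
  qed
qed

lemma Int_stable_preimages: "Int_stable {f -` A \<inter> \<Omega> | A. A \<in> sets N}"
proof (rule Int_stableI)
  fix a b assume "a \<in> {f -` A \<inter> \<Omega> | A. A \<in> sets N}" "b \<in> {f -` A \<inter> \<Omega> | A. A \<in> sets N}"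
  then obtain A B where "A \<in> sets N" "a = f -` A \<inter> \<Omega>" "B \<in> sets N" "b = f -` B \<inter> \<Omega>" by blast
  then show "a \<inter> b \<in> {f -` A \<inter> \<Omega> | A. A \<in> sets N}"
    by (intro CollectI exI[of _ "A \<inter> B"]) auto
qed

text \<open>The start at zero holds at every sample point instead of almost surely, so that values
  of X are sums of increments everywhere and past events can be written in terms of increments. The
  general case is recovered by subtracting \<open>X 0\<close>.\<close>

locale pinned_levy_process = prob_space M for M :: "'a measure" +
  fixes X :: "real \<Rightarrow> 'a \<Rightarrow> real" and \<psi> :: "real \<Rightarrow> complex"
  assumes X_measurable: "\<And>t. t \<ge> 0 \<Longrightarrow> X t \<in> borel_measurable M"
    and X_0: "\<And>\<omega>. \<omega> \<in> space M \<Longrightarrow> X 0 \<omega> = 0"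
    and increments_indep: "independent_increments M X"
    and increments_stationary: "stationary_increments M X"
    and X_cadlag: "\<And>\<omega>. \<omega> \<in> space M \<Longrightarrow> cadlag (\<lambda>t. X t \<omega>)"
    and exponent: "levy_exponent M X \<psi>"
begin

definition wave :: "real \<Rightarrow> real \<Rightarrow> 'a \<Rightarrow> complex" where
  "wave u t \<omega> = exp (\<i> * of_real (u * X t \<omega>))"

text \<open>The natural filtration, generated by the stopped path as one random element: cylinders
  of the product sigma-algebra pull back to an intersection-stable generator.\<close>

definition past :: "real \<Rightarrow> 'a measure" where
  "past s = vimage_algebra (space M) (\<lambda>\<omega>. \<lambda>r\<in>{0..s}. X r \<omega>) (PiM {0..s} (\<lambda>_. borel))"

lemma space_past[simp]: "space (past s) = space M"
  by (simp add: past_def)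

lemma path_into_space: "(\<lambda>\<omega>. \<lambda>r\<in>{0..s}. X r \<omega>) \<in> space M \<rightarrow> space (PiM {0..s} (\<lambda>_. borel))"
  by (auto simp: space_PiM)

lemma X_past: "r \<in> {0..s} \<Longrightarrow> X r \<in> borel_measurable (past s)"
proof -
  assume r: "r \<in> {0..s}"
  have "(\<lambda>\<omega>. (\<lambda>r\<in>{0..s}. X r \<omega>) r) \<in> borel_measurable (past s)"
    unfolding past_def
    by (rule measurable_compose[OF measurable_vimage_algebra1[OF path_into_space] measurable_component_singleton[OF r]])
  then show ?thesis using r by simp
qed

lemma sets_past: "sets (past s) = {(\<lambda>\<omega>. \<lambda>r\<in>{0..s}. X r \<omega>) -` A \<inter> space M | A. A \<in> sets (PiM {0..s} (\<lambda>_. borel))}"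
  unfolding past_def by (rule sets_vimage_algebra2[OF path_into_space])

lemma past_mono_id:
  assumes "\<And>r. r \<in> {0..s} \<Longrightarrow> X r \<in> borel_measurable K" "space K = space M"
  shows "(\<lambda>\<omega>. \<omega>) \<in> measurable K (past s)"
  unfolding past_def using assms
  by (intro measurable_vimage_algebra2) (auto intro!: measurable_restrict)

lemma past_mono:
  assumes f: "f \<in> measurable (past s) N" and st: "s \<le> t"
  shows "f \<in> measurable (past t) N"
proof -
  have "(\<lambda>\<omega>. \<omega>) \<in> measurable (past t) (past s)"
    using st by (intro past_mono_id X_past) auto
  from measurable_compose[OF this f] show ?thesis .
qed

lemma past_M:
  assumes f: "f \<in> measurable (past s) N"
  shows "f \<in> measurable M N"
proof -
  have "(\<lambda>\<omega>. \<omega>) \<in> measurable M (past s)"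
    by (intro past_mono_id X_measurable) auto
  from measurable_compose[OF this f] show ?thesis .
qed

lemma wave_past: "0 \<le> r \<Longrightarrow> r \<le> s \<Longrightarrow> wave u r \<in> borel_measurable (past s)"
  unfolding wave_def[abs_def] using X_past[of r s] by measurable

lemma wave_measurable: "0 \<le> r \<Longrightarrow> wave u r \<in> borel_measurable M"
  by (rule past_M[OF wave_past[of r r]]) auto

lemma norm_wave[simp]: "norm (wave u t \<omega>) = 1"
  by (simp add: wave_def)

lemma wave_mult: "wave u t \<omega> * wave v t \<omega> = wave (u + v) t \<omega>"
  by (simp add: wave_def exp_add[symmetric] algebra_simps)

lemma cnj_wave: "cnj (wave u t \<omega>) = wave (- u) t \<omega>"
  by (simp add: wave_def exp_cnj)

lemma expectation_wave: "t \<ge> 0 \<Longrightarrow> expectation (wave u t) = exp (- (of_real t * \<psi> u))"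
  using exponent unfolding levy_exponent_def wave_def[abs_def] by blast

lemma expectation_norm_le:
  fixes f :: "'a \<Rightarrow> complex"
  assumes "\<And>\<omega>. \<omega> \<in> space M \<Longrightarrow> norm (f \<omega>) \<le> C" "C \<ge> 0"
  shows "norm (expectation f) \<le> C"
\<comment> \<open>A function that is not integrable has integral 0, so the bound requires no
  measurability.\<close>
proof (cases "integrable M f")
  case True
  have "norm (expectation f) \<le> expectation (\<lambda>\<omega>. norm (f \<omega>))" by (rule integral_norm_bound)
  also have "\<dots> \<le> expectation (\<lambda>\<omega>. C)"
    using True assms by (intro integral_mono) auto
  finally show ?thesis by (simp add: prob_space)
qed (use assms in \<open>simp add: not_integrable_integral_eq\<close>)

lemma Re_exponent_nonneg: "Re (\<psi> u) \<ge> 0"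
proof -
  have "norm (expectation (wave u 1)) \<le> 1" by (rule expectation_norm_le) auto
  then show ?thesis by (simp add: expectation_wave)
qed

text \<open>Independence of increments is given along finite increasing sequences of times. Listing
  the times of \<open>J\<close> in order and appending s and t makes each past value a partial sum
  of the first n increments, while X t - X s is the last one.\<close>

lemma increment_indep_past_cylinder:
  assumes st: "0 \<le> s" "s \<le> t" and J: "finite J" "J \<subseteq> {0..s}" and E: "\<And>r. r \<in> J \<Longrightarrow> E r \<in> sets (borel :: real measure)"
    and B: "B \<in> sets (borel :: real measure)"
  shows "prob ({\<omega>\<in>space M. \<forall>r\<in>J. X r \<omega> \<in> E r} \<inter> {\<omega>\<in>space M. X t \<omega> - X s \<omega> \<in> B})
    = prob {\<omega>\<in>space M. \<forall>r\<in>J. X r \<omega> \<in> E r} * prob {\<omega>\<in>space M. X t \<omega> - X s \<omega> \<in> B}"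
proof -
  \<comment> \<open>Time 0 is inserted because the partial sums must start from X 0 = 0.\<close>
  define l where "l = sorted_list_of_set (insert 0 J)"
  define n where "n = length l"
  have l: "set l = insert 0 J" "sorted l" unfolding l_def using J set_sorted_list_of_set[of "insert 0 J"] by (simp_all del: sorted_list_of_set_insert_remove)
  have n0: "n > 0" using l(1) unfolding n_def by (metis insert_not_empty length_greater_0_conv set_empty)
  have ln: "l ! k \<in> insert 0 J" if "k < n" for k using that l(1) unfolding n_def by (metis nth_mem)
  have ls: "0 \<le> l ! k" "l ! k \<le> s" if "k < n" for k using ln[OF that] J(2) st by auto
  obtain k0 where "k0 < n" "l ! k0 = 0" using l(1) unfolding n_def by (metis in_set_conv_nth insertI1)
  then have l0: "l ! 0 = 0" using l(2) ls(1)[of 0] n0 unfolding n_def by (metis antisym le0 sorted_nth_mono)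
  \<comment> \<open>The list occupies the indices below n; index n carries s and all later ones t,
    so increment number n is X t - X s.\<close>
  define \<tau> where "\<tau> k = (if k < n then l ! k else if k = n then s else t)" for k
  have inc: "\<tau> k \<le> \<tau> (Suc k)" if "k < Suc n" for k
    using that ls[of k] st l(2) unfolding \<tau>_def n_def by (auto simp: sorted_iff_nth_mono)
  define D where "D k \<omega> = X (\<tau> (Suc k)) \<omega> - X (\<tau> k) \<omega>" for k \<omega>
  have "indep_vars (\<lambda>_. borel) D {..<Suc n}"
    unfolding D_def[abs_def]
    using increments_indep[unfolded independent_increments_def, rule_format, of \<tau> "Suc n"] inc l0 n0
    by (simp add: \<tau>_def[of 0])
  then have ind: "indep_var (PiM {..<n} (\<lambda>_. borel)) (\<lambda>\<omega>. \<lambda>i\<in>{..<n}. D i \<omega>) (PiM {n} (\<lambda>_. borel)) (\<lambda>\<omega>. \<lambda>i\<in>{n}. D i \<omega>)"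
    by (rule indep_var_restrict) auto
  have sumD: "X (l ! k) \<omega> = (\<Sum>i<k. D i \<omega>)" if "k < n" "\<omega> \<in> space M" for k \<omega>
  proof -
    have "(\<Sum>i<k. D i \<omega>) = X (\<tau> k) \<omega> - X (\<tau> 0) \<omega>" unfolding D_def by (rule sum_lessThan_telescope)
    then show ?thesis using that l0 n0 X_0 by (simp add: \<tau>_def)
  qed
  define U where "U = {d \<in> space (PiM {..<n} (\<lambda>_. borel)). \<forall>k\<in>{..<n}. l ! k \<in> J \<longrightarrow> (\<Sum>i<k. d i) \<in> E (l ! k)}"
  define V where "V = {d \<in> space (PiM {n} (\<lambda>_. borel)). d n \<in> B}"
  have U: "U \<in> sets (PiM {..<n} (\<lambda>_. borel))"
  proof -
    have "{d \<in> space (PiM {..<n} (\<lambda>_. borel)). l ! k \<in> J \<longrightarrow> (\<Sum>i<k. d i) \<in> E (l ! k)} \<in> sets (PiM {..<n} (\<lambda>_. borel :: real measure))"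
      if k: "k \<in> {..<n}" for k
    proof (cases "l ! k \<in> J")
      case True
      have "(\<lambda>d. \<Sum>i<k. d i) \<in> borel_measurable (PiM {..<n} (\<lambda>_. borel :: real measure))"
        using k by (intro borel_measurable_sum measurable_component_singleton) auto
      from measurable_sets_Collect[OF this, of "\<lambda>x. x \<in> E (l ! k)"] show ?thesis
        using E[OF True] True by simp
    qed simp
    then show ?thesis unfolding U_def by (intro sets.sets_Collect_finite_All) auto
  qed
  have V: "V \<in> sets (PiM {n} (\<lambda>_. borel))"
    unfolding V_def using measurable_sets_Collect[OF measurable_component_singleton[of n "{n}" "\<lambda>_. borel :: real measure"], of "\<lambda>x. x \<in> B"] B
    by simp
  have eq1: "{\<omega>\<in>space M. \<forall>r\<in>J. X r \<omega> \<in> E r} = (\<lambda>\<omega>. \<lambda>i\<in>{..<n}. D i \<omega>) -` U \<inter> space M"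
  proof (intro set_eqI iffI)
    fix \<omega> assume "\<omega> \<in> {\<omega>\<in>space M. \<forall>r\<in>J. X r \<omega> \<in> E r}"
    then have w: "\<omega> \<in> space M" "\<And>r. r \<in> J \<Longrightarrow> X r \<omega> \<in> E r" by auto
    have "(\<Sum>i<k. (\<lambda>i\<in>{..<n}. D i \<omega>) i) = X (l ! k) \<omega>" if "k < n" for k
      unfolding sumD[OF that w(1)] using that by (intro sum.cong) auto
    then show "\<omega> \<in> (\<lambda>\<omega>. \<lambda>i\<in>{..<n}. D i \<omega>) -` U \<inter> space M"
      using w by (auto simp: U_def space_PiM)
  next
    fix \<omega> assume "\<omega> \<in> (\<lambda>\<omega>. \<lambda>i\<in>{..<n}. D i \<omega>) -` U \<inter> space M"
    then have w: "\<omega> \<in> space M" "\<And>k. k < n \<Longrightarrow> l ! k \<in> J \<Longrightarrow> (\<Sum>i<k. (\<lambda>i\<in>{..<n}. D i \<omega>) i) \<in> E (l ! k)"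
      by (auto simp: U_def)
    have "X r \<omega> \<in> E r" if r: "r \<in> J" for r
    proof -
      obtain k where k: "k < n" "l ! k = r" using r l(1) unfolding n_def by (metis in_set_conv_nth insertI2)
      have "(\<Sum>i<k. (\<lambda>i\<in>{..<n}. D i \<omega>) i) = X (l ! k) \<omega>"
        unfolding sumD[OF k(1) w(1)] using k(1) by (intro sum.cong) auto
      then show ?thesis using w(2)[OF k(1)] k(2) r by simp
    qed
    then show "\<omega> \<in> {\<omega>\<in>space M. \<forall>r\<in>J. X r \<omega> \<in> E r}" using w(1) by auto
  qed
  have eq2: "{\<omega>\<in>space M. X t \<omega> - X s \<omega> \<in> B} = (\<lambda>\<omega>. \<lambda>i\<in>{n}. D i \<omega>) -` V \<inter> space M"
    by (auto simp: V_def space_PiM D_def \<tau>_def)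
  have "{\<omega>\<in>space M. \<forall>r\<in>J. X r \<omega> \<in> E r} \<inter> {\<omega>\<in>space M. X t \<omega> - X s \<omega> \<in> B}
      = (\<lambda>\<omega>. (\<lambda>i\<in>{..<n}. D i \<omega>, \<lambda>i\<in>{n}. D i \<omega>)) -` (U \<times> V) \<inter> space M"
    unfolding eq1 eq2 by auto
  then show ?thesis using indep_varD[OF ind U V] unfolding eq1 eq2 by simp
qed

text \<open>Cylinder events form an intersection-stable generator of the past, so the product rule
  for them extends to the whole sigma-algebra.\<close>

lemma increment_indep_past:
  assumes st: "0 \<le> s" "s \<le> t"
  shows "indep_set (sets (past s)) {(\<lambda>\<omega>. X t \<omega> - X s \<omega>) -` B \<inter> space M | B. B \<in> sets borel}"
proof -
  let ?Y = "\<lambda>\<omega>. \<lambda>r\<in>{0..s}. X r \<omega>"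
  let ?D = "\<lambda>\<omega>. X t \<omega> - X s \<omega>"
  let ?A = "{?Y -` A \<inter> space M | A. A \<in> prod_algebra {0..s} (\<lambda>_. borel :: real measure)}"
  let ?B = "{?D -` B \<inter> space M | B. B \<in> sets borel}"
  have D: "?D \<in> borel_measurable M" using st X_measurable by (intro borel_measurable_diff) auto
  have "indep_set ?A ?B"
  proof (rule indep_setI)
    show "?A \<subseteq> events"
    proof
      fix a assume "a \<in> ?A"
      then obtain A where A: "A \<in> prod_algebra {0..s} (\<lambda>_. borel :: real measure)" "a = ?Y -` A \<inter> space M" by blast
      have "?Y \<in> measurable M (PiM {0..s} (\<lambda>_. borel))" using X_measurable by (intro measurable_restrict) auto
      moreover have "A \<in> sets (PiM {0..s} (\<lambda>_. borel :: real measure))" using A(1) by (simp add: sets_PiM)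
      ultimately show "a \<in> events" unfolding A(2) by (rule measurable_sets)
    qed
    show "?B \<subseteq> events" using measurable_sets[OF D] by blast
    fix a b assume "a \<in> ?A" "b \<in> ?B"
    then obtain A B where A: "A \<in> prod_algebra {0..s} (\<lambda>_. borel :: real measure)" "a = ?Y -` A \<inter> space M"
      and B: "B \<in> sets borel" "b = ?D -` B \<inter> space M" by blast
    from A(1) obtain J E where JE: "A = prod_emb {0..s} (\<lambda>_. borel :: real measure) J (Pi\<^sub>E J E)" "finite J" "J \<subseteq> {0..s}"
      "\<And>i. i \<in> J \<Longrightarrow> E i \<in> sets borel" by (rule prod_algebraE) blast
    have a: "a = {\<omega>\<in>space M. \<forall>r\<in>J. X r \<omega> \<in> E r}"
      unfolding A(2) JE(1) using JE(3) by (auto simp: prod_emb_def PiE_iff restrict_def subset_iff extensional_def)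
    have b: "b = {\<omega>\<in>space M. ?D \<omega> \<in> B}" unfolding B(2) by auto
    show "prob (a \<inter> b) = prob a * prob b"
      unfolding a b by (rule increment_indep_past_cylinder[OF st JE(2,3,4) B(1)])
  qed
  moreover have "Int_stable ?A"
  proof (rule Int_stableI)
    fix a b assume "a \<in> ?A" "b \<in> ?A"
    then obtain A B where AB: "A \<in> prod_algebra {0..s} (\<lambda>_. borel :: real measure)" "a = ?Y -` A \<inter> space M"
       "B \<in> prod_algebra {0..s} (\<lambda>_. borel :: real measure)" "b = ?Y -` B \<inter> space M" by blast
    have "A \<inter> B \<in> prod_algebra {0..s} (\<lambda>_. borel :: real measure)"
      using Int_stable_prod_algebra AB(1,3) unfolding Int_stable_def by blast
    then show "a \<inter> b \<in> ?A"
      unfolding AB(2,4) by (intro CollectI exI[of _ "A \<inter> B"]) auto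
  qed
  moreover have "Int_stable ?B"
    by (rule Int_stable_preimages)
  ultimately have "indep_set (sigma_sets (space M) ?A) (sigma_sets (space M) ?B)"
    by (rule indep_set_sigma_sets)
  moreover have "sigma_sets (space M) ?A = sets (past s)"
    unfolding sets_past sets_PiM
    by (rule sigma_sets_vimage_commute[symmetric]) auto
  ultimately have *: "indep_set (sets (past s)) (sigma_sets (space M) ?B)" by simp
  show ?thesis
    using * unfolding indep_sets2_eq by (meson sigma_sets_superset_generator subset_iff)
qed

lemma expectation_increment:
  assumes st: "0 \<le> s" "s \<le> t"
  shows "expectation (\<lambda>\<omega>. exp (\<i> * of_real (u * (X t \<omega> - X s \<omega>)))) = exp (- (of_real (t - s) * \<psi> u))"
proof -
  have eq: "distr M borel (\<lambda>\<omega>. X t \<omega> - X s \<omega>) = distr M borel (\<lambda>\<omega>. X (t - s) \<omega> - X 0 \<omega>)"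
    using increments_stationary[unfolded stationary_increments_def, rule_format, of s "t - s"] st by simp
  have "expectation (\<lambda>\<omega>. exp (\<i> * of_real (u * (X t \<omega> - X s \<omega>))))
      = (LINT x|distr M borel (\<lambda>\<omega>. X t \<omega> - X s \<omega>). exp (\<i> * of_real (u * x)))"
    using st X_measurable by (subst integral_distr) auto
  also have "\<dots> = expectation (\<lambda>\<omega>. exp (\<i> * of_real (u * (X (t - s) \<omega> - X 0 \<omega>))))"
    unfolding eq using st X_measurable by (subst integral_distr) auto
  also have "\<dots> = expectation (wave u (t - s))"
    by (rule Bochner_Integration.integral_cong) (auto simp: X_0 wave_def)
  finally show ?thesis using st by (simp add: expectation_wave)
qed

lemma integrable_bounded:
  fixes f :: "'a \<Rightarrow> complex"
  assumes "f \<in> borel_measurable M" "\<And>\<omega>. \<omega> \<in> space M \<Longrightarrow> norm (f \<omega>) \<le> C"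
  shows "integrable M f"
  using assms by (intro integrable_const_bound[of _ C]) auto

text \<open>The wave at t is the wave at s times exp(i u (X t - X s)). The last factor is
  independent of the past, hence of \<open>K\<close> times the wave at s, and its mean is known by
  stationarity.\<close>

lemma markov:
  assumes st: "0 \<le> s" "s \<le> t" and K: "K \<in> borel_measurable (past s)"
    and C: "\<And>\<omega>. \<omega> \<in> space M \<Longrightarrow> norm (K \<omega>) \<le> C"
  shows "expectation (\<lambda>\<omega>. K \<omega> * wave u t \<omega>) = exp (- (of_real (t - s) * \<psi> u)) * expectation (\<lambda>\<omega>. K \<omega> * wave u s \<omega>)"
proof -
  let ?D = "\<lambda>\<omega>. X t \<omega> - X s \<omega>"
  define P where "P \<omega> = K \<omega> * wave u s \<omega>" for \<omega>
  define Q where "Q \<omega> = exp (\<i> * of_real (u * ?D \<omega>))" for \<omega>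
  have PQ: "K \<omega> * wave u t \<omega> = P \<omega> * Q \<omega>" for \<omega>
  proof -
    have "wave u t \<omega> = wave u s \<omega> * Q \<omega>"
      unfolding wave_def Q_def exp_add[symmetric] by (simp add: algebra_simps)
    then show ?thesis by (simp add: P_def)
  qed
  have P: "P \<in> borel_measurable (past s)"
    unfolding P_def[abs_def] using K wave_past[of s s u] st by measurable
  have D: "?D \<in> borel_measurable M" using st X_measurable by (intro borel_measurable_diff) auto
  have Q: "Q \<in> borel_measurable M" unfolding Q_def[abs_def] using D by measurable
  have "indep_var borel P borel Q"
    unfolding indep_var_eq
  proof (intro conjI)
    show "indep_set (sigma_sets (space M) {P -` A \<inter> space M |A. A \<in> sets borel})
       (sigma_sets (space M) {Q -` A \<inter> space M |A. A \<in> sets borel})"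
    proof (rule indep_set_sigma_sets)
      have "{P -` A \<inter> space M |A. A \<in> sets borel} \<subseteq> sets (past s)"
        using measurable_sets[OF P] by auto
      moreover have "{Q -` A \<inter> space M |A. A \<in> sets borel} \<subseteq> {?D -` B \<inter> space M | B. B \<in> sets borel}"
      proof clarify
        fix A :: "complex set" assume A: "A \<in> sets borel"
        have "(\<lambda>x::real. exp (\<i> * of_real (u * x)) :: complex) \<in> borel_measurable borel" by measurable
        from measurable_sets[OF this A] have "(\<lambda>x::real. exp (\<i> * of_real (u * x)) :: complex) -` A \<in> sets borel" by simp
        then show "\<exists>B. Q -` A \<inter> space M = ?D -` B \<inter> space M \<and> B \<in> sets borel"
          by (intro exI[of _ "(\<lambda>x::real. exp (\<i> * of_real (u * x)) :: complex) -` A"]) (auto simp: Q_def)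
      qed
      ultimately show "indep_set {P -` A \<inter> space M |A. A \<in> sets borel} {Q -` A \<inter> space M |A. A \<in> sets borel}"
        using increment_indep_past[OF st] unfolding indep_sets2_eq by (meson subset_iff)
      show "Int_stable {P -` A \<inter> space M |A. A \<in> sets borel}" "Int_stable {Q -` A \<inter> space M |A. A \<in> sets borel}"
        by (rule Int_stable_preimages)+
    qed
  qed (use past_M[OF P] Q in auto)
  moreover have "integrable M P" unfolding P_def[abs_def]
    using past_M[OF P] C unfolding P_def[abs_def] by (intro integrable_bounded[of _ C]) (auto simp: norm_mult)
  moreover have "integrable M Q"
    using Q by (intro integrable_bounded[of _ 1]) (auto simp: Q_def)
  ultimately have "expectation (\<lambda>\<omega>. P \<omega> * Q \<omega>) = expectation P * expectation Q"
    by (rule indep_var_lebesgue_integral)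
  then show ?thesis
    unfolding PQ using expectation_increment[OF st, of u] unfolding Q_def[symmetric] P_def[symmetric] by (simp add: mult.commute)
qed

end

section \<open>Occupation integrals\<close>

lemma exp_minus_1_bound: "norm (exp z - 1) \<le> exp (norm z) * norm z" for z :: complex
  using Taylor_exp_field[of z 0] by simp

lemma exp_minus_1_minus_bound: "norm (exp z - 1 - z) \<le> exp (norm z) * (norm z)\<^sup>2" for z :: complex
  using Taylor_exp_field[of z 1] by (simp add: numeral_2_eq_2 algebra_simps)

text \<open>The indicator makes the clamped time of the joint measurability result harmless.
  \<open>K\<close> is left arbitrary: the full sigma-algebra gives Fubini, the past gives
  adaptedness of occupation integrals.\<close>

lemma occupation_joint_measurable:
  fixes Y :: "real \<Rightarrow> 'a \<Rightarrow> real"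
  assumes s: "0 \<le> s" and Y: "\<And>r. r \<in> {0..t} \<Longrightarrow> Y r \<in> borel_measurable K"
    and cad: "\<And>\<omega>. \<omega> \<in> space K \<Longrightarrow> cadlag (\<lambda>r. Y r \<omega>)"
  shows "(\<lambda>(r, \<omega>). indicator {s..t} r *\<^sub>R (exp (\<i> * of_real (v * Y r \<omega>)) :: complex)) \<in> borel_measurable (lborel \<Otimes>\<^sub>M K)"
proof (cases "t \<ge> 0")
  case True
  have "(\<lambda>(r, \<omega>). Y (max 0 (min t r)) \<omega>) \<in> borel_measurable (borel \<Otimes>\<^sub>M K)"
    by (rule cadlag_joint_measurable[OF True Y cad])
  then have 1: "(\<lambda>p. Y (max 0 (min t (fst p))) (snd p)) \<in> borel_measurable (lborel \<Otimes>\<^sub>M K)"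
    by (simp add: case_prod_beta' cong: measurable_cong_sets sets_pair_measure_cong)
  have "(\<lambda>p. indicator {s..t} (fst p) *\<^sub>R (exp (\<i> * of_real (v * Y (max 0 (min t (fst p))) (snd p))) :: complex)) \<in> borel_measurable (lborel \<Otimes>\<^sub>M K)"
    using 1 by measurable
  also have "(\<lambda>p. indicator {s..t} (fst p) *\<^sub>R (exp (\<i> * of_real (v * Y (max 0 (min t (fst p))) (snd p))) :: complex))
     = (\<lambda>(r, \<omega>). indicator {s..t} r *\<^sub>R exp (\<i> * of_real (v * Y r \<omega>)))"
    using s by (auto simp: fun_eq_iff indicator_def min_def max_def)
  finally show ?thesis .
next
  case False
  then have "{s..t} = {}" using s by auto
  then show ?thesis by simp
qed

lemma occupation_measurable:
  fixes Y :: "real \<Rightarrow> 'a \<Rightarrow> real"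
  assumes s: "0 \<le> s" and Y: "\<And>r. r \<in> {0..t} \<Longrightarrow> Y r \<in> borel_measurable K"
    and cad: "\<And>\<omega>. \<omega> \<in> space K \<Longrightarrow> cadlag (\<lambda>r. Y r \<omega>)"
  shows "(\<lambda>\<omega>. LINT r:{s..t}|lborel. (exp (\<i> * of_real (v * Y r \<omega>)) :: complex)) \<in> borel_measurable K"
  unfolding set_lebesgue_integral_def
proof (rule lborel.borel_measurable_lebesgue_integral)
  have "(\<lambda>(r, \<omega>). indicator {s..t} r *\<^sub>R (exp (\<i> * of_real (v * Y r \<omega>)) :: complex)) \<in> borel_measurable (lborel \<Otimes>\<^sub>M K)"
    by (rule occupation_joint_measurable[OF assms])
  from measurable_compose[OF measurable_pair_swap' this]
  show "(\<lambda>(\<omega>, r). indicator {s..t} r *\<^sub>R (exp (\<i> * of_real (v * Y r \<omega>)) :: complex)) \<in> borel_measurable (K \<Otimes>\<^sub>M lborel)"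
    by (simp add: case_prod_beta')
qed

lemma occupation_integrable:
  fixes Y :: "real \<Rightarrow> 'a \<Rightarrow> real"
  assumes s: "0 \<le> s" and Y: "\<And>r. r \<in> {0..t} \<Longrightarrow> Y r \<in> borel_measurable K"
    and cad: "\<And>\<omega>. \<omega> \<in> space K \<Longrightarrow> cadlag (\<lambda>r. Y r \<omega>)" and w: "\<omega> \<in> space K"
  shows "set_integrable lborel {s..t} (\<lambda>r. exp (\<i> * of_real (v * Y r \<omega>)) :: complex)"
  unfolding set_integrable_def
proof (rule integrableI_bounded_set[where A="{s..t}" and B=1])
  have *: "(\<lambda>r. (r, \<omega>)) \<in> measurable lborel (lborel \<Otimes>\<^sub>M K)" using w by measurable
  from measurable_compose[OF * occupation_joint_measurable[OF s Y cad]]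
  show "(\<lambda>r. indicator {s..t} r *\<^sub>R (exp (\<i> * of_real (v * Y r \<omega>)) :: complex)) \<in> borel_measurable lborel"
    by simp
qed (auto simp: indicator_def emeasure_lborel_Icc_eq split: if_splits)

lemma occupation_split:
  fixes Y :: "real \<Rightarrow> 'a \<Rightarrow> real"
  assumes s: "0 \<le> s" "s \<le> r" "r \<le> t" and Y: "\<And>r. r \<in> {0..t} \<Longrightarrow> Y r \<in> borel_measurable K"
    and cad: "\<And>\<omega>. \<omega> \<in> space K \<Longrightarrow> cadlag (\<lambda>r. Y r \<omega>)" and w: "\<omega> \<in> space K"
  shows "(LINT x:{s..t}|lborel. (exp (\<i> * of_real (v * Y x \<omega>)) :: complex))
    = (LINT x:{s..r}|lborel. exp (\<i> * of_real (v * Y x \<omega>))) + (LINT x:{r..t}|lborel. exp (\<i> * of_real (v * Y x \<omega>)))"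
proof -
  have "AE x in lborel. x \<noteq> r" by (rule AE_lborel_singleton)
  then have ae: "AE x in lborel. \<not> (x \<in> {s..r} \<and> x \<in> {r..t})" by eventually_elim auto
  have i: "set_integrable lborel {s..t} (\<lambda>r. exp (\<i> * of_real (v * Y r \<omega>)) :: complex)"
    by (rule occupation_integrable[OF s(1) Y cad w])
  have 1: "set_integrable lborel {s..r} (\<lambda>r. exp (\<i> * of_real (v * Y r \<omega>)) :: complex)"
    by (rule set_integrable_subset[OF i]) (use s in auto)
  have 2: "set_integrable lborel {r..t} (\<lambda>r. exp (\<i> * of_real (v * Y r \<omega>)) :: complex)"
    by (rule set_integrable_subset[OF i]) (use s in auto)
  from set_integral_Un_AE[OF ae _ _ 1 2] show ?thesis
    using s by (simp add: ivl_disj_un_two_touch)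
qed

lemma set_integral_near_const:
  fixes \<phi> :: "real \<Rightarrow> complex"
  assumes st: "s \<le> t" and i: "set_integrable lborel {s..t} \<phi>"
    and b: "\<And>r. r \<in> {s..t} \<Longrightarrow> norm (\<phi> r - c) \<le> D"
  shows "norm ((LINT r:{s..t}|lborel. \<phi> r) - (t - s) *\<^sub>R c) \<le> D * (t - s)"
proof -
  have ic: "set_integrable lborel {s..t} (\<lambda>_. k)" for k :: "'b::{banach,second_countable_topology}"
    unfolding set_integrable_def
    by (rule integrableI_bounded_set_indicator[where B="norm k"]) (auto simp: emeasure_lborel_Icc_eq)
  have "(LINT r:{s..t}|lborel. c) = (t - s) *\<^sub>R c"
    unfolding set_lebesgue_integral_def using st by simp
  then have "norm ((LINT r:{s..t}|lborel. \<phi> r) - (t - s) *\<^sub>R c) = norm (LINT r:{s..t}|lborel. \<phi> r - c)"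
    using set_integral_diff(2)[OF i ic[of c]] by simp
  also have "\<dots> \<le> (LINT r:{s..t}|lborel. norm (\<phi> r - c))"
    by (rule set_integral_norm_bound[OF set_integral_diff(1)[OF i ic]])
  also have "\<dots> \<le> (LINT r:{s..t}|lborel. D)"
    using b set_integral_diff(1)[OF i ic[of c]] ic[of D]
    by (intro set_integral_mono set_integrable_norm) auto
  also have "\<dots> = D * (t - s)" unfolding set_lebesgue_integral_def using st by simp
  finally show ?thesis .
qed

section \<open>Differentiating expectations of adapted functionals times waves\<close>

context pinned_levy_process
begin

definition occ :: "real \<Rightarrow> real \<Rightarrow> real \<Rightarrow> 'a \<Rightarrow> complex" where
  "occ v s t \<omega> = (LINT r:{s..t}|lborel. wave v r \<omega>)"

lemma occ_past: "0 \<le> s \<Longrightarrow> t \<le> t' \<Longrightarrow> occ v s t \<in> borel_measurable (past t')"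
  unfolding occ_def[abs_def] wave_def using X_past X_cadlag
  by (intro occupation_measurable) auto

lemma norm_occ_le:
  assumes "0 \<le> s" "s \<le> t" "\<omega> \<in> space M"
  shows "norm (occ v s t \<omega>) \<le> t - s"
proof -
  have i: "set_integrable lborel {s..t} (\<lambda>r. wave v r \<omega>)"
    unfolding wave_def using assms X_measurable X_cadlag by (intro occupation_integrable[where K=M]) auto
  have "norm (occ v s t \<omega>) \<le> (LINT r:{s..t}|lborel. norm (wave v r \<omega>))"
    unfolding occ_def by (rule set_integral_norm_bound[OF i])
  also have "\<dots> = t - s" using assms unfolding norm_wave by (simp add: set_lebesgue_integral_def)
  finally show ?thesis .
qed

lemma occ_split:
  assumes "0 \<le> s" "s \<le> r" "r \<le> t" "\<omega> \<in> space M"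
  shows "occ v s t \<omega> = occ v s r \<omega> + occ v r t \<omega>"
  unfolding occ_def wave_def using assms X_measurable X_cadlag
  by (intro occupation_split[where K=M]) auto

lemma occ_refl [simp]: "occ v s s \<omega> = 0"
proof -
  have "AE x in lborel. x \<noteq> s" by (rule AE_lborel_singleton)
  then have "AE x in lborel. indicator {s..s} x *\<^sub>R wave v x \<omega> = 0" by eventually_elim auto
  then show ?thesis unfolding occ_def set_lebesgue_integral_def by (rule integral_eq_zero_AE)
qed

lemma cnj_occ: "cnj (occ v s t \<omega>) = occ (- v) s t \<omega>"
  unfolding occ_def set_lebesgue_integral_def cnj_wave[symmetric]
  by (subst Bochner_Integration.integral_cnj[symmetric]) simp

lemma
  assumes s: "0 \<le> s" and Z: "Z \<in> borel_measurable M" and C: "\<And>\<omega>. \<omega> \<in> space M \<Longrightarrow> norm (Z \<omega>) \<le> C"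
  shows expectation_occ: "expectation (\<lambda>\<omega>. Z \<omega> * occ v s t \<omega>) = (LINT r:{s..t}|lborel. expectation (\<lambda>\<omega>. Z \<omega> * wave v r \<omega>))"
    and set_integrable_expectation: "set_integrable lborel {s..t} (\<lambda>r. expectation (\<lambda>\<omega>. Z \<omega> * wave v r \<omega>))"
proof -
  interpret P: pair_sigma_finite lborel M ..
  define f where "f r \<omega> = Z \<omega> * (indicator {s..t} r *\<^sub>R wave v r \<omega>)" for r \<omega>
  have m: "case_prod f \<in> borel_measurable (lborel \<Otimes>\<^sub>M M)"
  proof -
    have "(\<lambda>(r, \<omega>). indicator {s..t} r *\<^sub>R wave v r \<omega>) \<in> borel_measurable (lborel \<Otimes>\<^sub>M M)"
      unfolding wave_def using s X_measurable X_cadlag by (intro occupation_joint_measurable) auto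
    then have "(\<lambda>p. Z (snd p) * (indicator {s..t} (fst p) *\<^sub>R wave v (fst p) (snd p))) \<in> borel_measurable (lborel \<Otimes>\<^sub>M M)"
      using Z by (intro borel_measurable_times) (auto simp: case_prod_beta')
    then show ?thesis by (simp add: f_def case_prod_beta')
  qed
  have i: "integrable (lborel \<Otimes>\<^sub>M M) (case_prod f)"
  proof (rule integrableI_bounded_set[where A="{s..t} \<times> space M" and B=C, OF _ m])
    show "emeasure (lborel \<Otimes>\<^sub>M M) ({s..t} \<times> space M) < \<infinity>"
      by (subst emeasure_pair_measure_Times) (auto simp: emeasure_space_1 emeasure_lborel_Icc_eq)
    show "AE x in lborel \<Otimes>\<^sub>M M. x \<in> {s..t} \<times> space M \<longrightarrow> norm (case_prod f x) \<le> C"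
      using C by (intro AE_I2) (auto simp: f_def norm_mult)
    show "AE x in lborel \<Otimes>\<^sub>M M. x \<notin> {s..t} \<times> space M \<longrightarrow> case_prod f x = 0"
      by (intro AE_I2) (auto simp: f_def space_pair_measure indicator_def)
  qed auto
  have 1: "(\<integral>\<omega>. f r \<omega> \<partial>M) = indicator {s..t} r *\<^sub>R expectation (\<lambda>\<omega>. Z \<omega> * wave v r \<omega>)" for r
    unfolding f_def by simp
  have 2: "(\<integral>r. f r \<omega> \<partial>lborel) = Z \<omega> * occ v s t \<omega>" for \<omega>
    unfolding f_def occ_def set_lebesgue_integral_def by (simp del: mult_scaleR_right)
  from P.Fubini_integral[OF i]
  show "expectation (\<lambda>\<omega>. Z \<omega> * occ v s t \<omega>) = (LINT r:{s..t}|lborel. expectation (\<lambda>\<omega>. Z \<omega> * wave v r \<omega>))"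
    unfolding 1 2 set_lebesgue_integral_def by simp
  from P.integrable_fst'[OF i]
  show "set_integrable lborel {s..t} (\<lambda>r. expectation (\<lambda>\<omega>. Z \<omega> * wave v r \<omega>))"
    unfolding set_integrable_def by (simp add: 1)
qed

lemma expectation_mono_bound:
  fixes f g :: "'a \<Rightarrow> complex"
  assumes "f \<in> borel_measurable M" "g \<in> borel_measurable M"
    and "\<And>\<omega>. \<omega> \<in> space M \<Longrightarrow> norm (f \<omega>) \<le> C1" "\<And>\<omega>. \<omega> \<in> space M \<Longrightarrow> norm (g \<omega>) \<le> C2"
    and "\<And>\<omega>. \<omega> \<in> space M \<Longrightarrow> norm (f \<omega> - g \<omega>) \<le> D" "D \<ge> 0"
  shows "norm (expectation f - expectation g) \<le> D"
proof -
  have "expectation f - expectation g = expectation (\<lambda>\<omega>. f \<omega> - g \<omega>)"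
    using assms by (intro Bochner_Integration.integral_diff[symmetric] integrable_bounded) auto
  then show ?thesis using expectation_norm_le[of "\<lambda>\<omega>. f \<omega> - g \<omega>" D] assms by simp
qed

text \<open>By \<open>markov\<close> the later expectation is exp z times the earlier one with z =
  -(t - s) \<psi> u, so both bounds are Taylor estimates of exp z. The length \<open>l\<close> only
  keeps the exponential in the constant uniform over an interval.\<close>

lemma
  assumes st: "0 \<le> s" "s \<le> t" "t - s \<le> l" and Z: "Z \<in> borel_measurable (past s)"
    and C: "\<And>\<omega>. \<omega> \<in> space M \<Longrightarrow> norm (Z \<omega>) \<le> C" "C \<ge> 0"
  shows wave_step1: "norm (expectation (\<lambda>\<omega>. Z \<omega> * wave u t \<omega>) - expectation (\<lambda>\<omega>. Z \<omega> * wave u s \<omega>))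
      \<le> C * exp (l * norm (\<psi> u)) * norm (\<psi> u) * (t - s)"
    and wave_step2: "norm (expectation (\<lambda>\<omega>. Z \<omega> * wave u t \<omega>) - expectation (\<lambda>\<omega>. Z \<omega> * wave u s \<omega>)
        - (t - s) *\<^sub>R (- \<psi> u * expectation (\<lambda>\<omega>. Z \<omega> * wave u s \<omega>)))
      \<le> C * exp (l * norm (\<psi> u)) * (norm (\<psi> u))\<^sup>2 * (t - s)\<^sup>2"
proof -
  define z where "z = - (of_real (t - s) * \<psi> u)"
  define G where "G = expectation (\<lambda>\<omega>. Z \<omega> * wave u s \<omega>)"
  have m: "expectation (\<lambda>\<omega>. Z \<omega> * wave u t \<omega>) = exp z * G"
    unfolding z_def G_def by (rule markov[OF st(1,2) Z C(1)])
  have G: "norm G \<le> C" unfolding G_def using C by (intro expectation_norm_le) (auto simp: norm_mult)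
  have nz: "norm z = (t - s) * norm (\<psi> u)" unfolding z_def using st by (simp add: norm_mult del: of_real_diff)
  have ez: "exp (norm z) \<le> exp (l * norm (\<psi> u))" unfolding nz using st by (simp add: mult_right_mono)
  have "norm (exp z * G - G) = norm (exp z - 1) * norm G" by (simp add: norm_mult[symmetric] algebra_simps)
  also have "\<dots> \<le> (exp (l * norm (\<psi> u)) * norm z) * C"
    using exp_minus_1_bound[of z] G ez C(2)
    by (intro mult_mono order_trans[OF exp_minus_1_bound[of z] mult_right_mono]) auto
  finally show "norm (expectation (\<lambda>\<omega>. Z \<omega> * wave u t \<omega>) - expectation (\<lambda>\<omega>. Z \<omega> * wave u s \<omega>))
      \<le> C * exp (l * norm (\<psi> u)) * norm (\<psi> u) * (t - s)"
    unfolding m nz G_def[symmetric] by (simp add: mult_ac)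
  have "norm (exp z * G - G - (t - s) *\<^sub>R (- \<psi> u * G)) = norm (exp z - 1 - z) * norm G"
    unfolding norm_mult[symmetric] z_def by (simp add: algebra_simps scaleR_conv_of_real)
  also have "\<dots> \<le> (exp (l * norm (\<psi> u)) * (norm z)\<^sup>2) * C"
    using G ez C(2)
    by (intro mult_mono order_trans[OF exp_minus_1_minus_bound[of z] mult_right_mono]) auto
  finally show "norm (expectation (\<lambda>\<omega>. Z \<omega> * wave u t \<omega>) - expectation (\<lambda>\<omega>. Z \<omega> * wave u s \<omega>)
        - (t - s) *\<^sub>R (- \<psi> u * expectation (\<lambda>\<omega>. Z \<omega> * wave u s \<omega>)))
      \<le> C * exp (l * norm (\<psi> u)) * (norm (\<psi> u))\<^sup>2 * (t - s)\<^sup>2"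
    unfolding m nz G_def[symmetric] by (simp add: mult_ac power_mult_distrib)
qed

text \<open>Conditioning back from t to r and then from r to s turns the integrand at time r into
  exp z times a constant, with z of order t - s: after time r only frequency u survives, before it v
  + u. Integrating over r gains another factor t - s.\<close>

lemma occ_step:
  assumes st: "0 \<le> s" "s \<le> t" "t - s \<le> l" and Z: "Z \<in> borel_measurable (past s)"
    and C: "\<And>\<omega>. \<omega> \<in> space M \<Longrightarrow> norm (Z \<omega>) \<le> C" "C \<ge> 0"
    and q: "q = norm (\<psi> u) + norm (\<psi> (v + u))"
  shows "norm (expectation (\<lambda>\<omega>. Z \<omega> * occ v s t \<omega> * wave u t \<omega>) - (t - s) *\<^sub>R expectation (\<lambda>\<omega>. Z \<omega> * wave (v + u) s \<omega>))
      \<le> C * exp (l * q) * q * (t - s)\<^sup>2"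
proof -
  define G where "G = expectation (\<lambda>\<omega>. Z \<omega> * wave (v + u) s \<omega>)"
  have G: "norm G \<le> C" unfolding G_def using C by (intro expectation_norm_le) (auto simp: norm_mult)
  have q0: "q \<ge> 0" unfolding q by simp
  have ZM: "Z \<in> borel_measurable M" by (rule past_M[OF Z])
  have ZW: "(\<lambda>\<omega>. Z \<omega> * wave u t \<omega>) \<in> borel_measurable M"
    using ZM wave_measurable[of t u] st by (intro borel_measurable_times) auto
  have ZWC: "norm (Z \<omega> * wave u t \<omega>) \<le> C" if "\<omega> \<in> space M" for \<omega> using C that by (simp add: norm_mult)
  have e1: "expectation (\<lambda>\<omega>. Z \<omega> * occ v s t \<omega> * wave u t \<omega>)
     = (LINT r:{s..t}|lborel. expectation (\<lambda>\<omega>. Z \<omega> * wave u t \<omega> * wave v r \<omega>))"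
    using expectation_occ[OF st(1) ZW ZWC, of v t] by (simp add: mult_ac)
  have n: "norm (expectation (\<lambda>\<omega>. Z \<omega> * wave u t \<omega> * wave v r \<omega>) - G) \<le> C * exp (l * q) * q * (t - s)"
    if r: "r \<in> {s..t}" for r
  proof -
    define z where "z = - (of_real (t - r) * \<psi> u) + - (of_real (r - s) * \<psi> (v + u))"
    have Zr: "(\<lambda>\<omega>. Z \<omega> * wave v r \<omega>) \<in> borel_measurable (past r)"
      using past_mono[OF Z, of r] wave_past[of r r v] r st by (intro borel_measurable_times) auto
    have "expectation (\<lambda>\<omega>. Z \<omega> * wave u t \<omega> * wave v r \<omega>) = expectation (\<lambda>\<omega>. Z \<omega> * wave v r \<omega> * wave u t \<omega>)"
      by (simp add: mult_ac)
    also have "\<dots> = exp (- (of_real (t - r) * \<psi> u)) * expectation (\<lambda>\<omega>. Z \<omega> * wave v r \<omega> * wave u r \<omega>)"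
      using r st C by (intro markov[OF _ _ Zr, of _ C]) (auto simp: norm_mult)
    also have "expectation (\<lambda>\<omega>. Z \<omega> * wave v r \<omega> * wave u r \<omega>) = expectation (\<lambda>\<omega>. Z \<omega> * wave (v + u) r \<omega>)"
      by (simp add: mult.assoc wave_mult)
    also have "\<dots> = exp (- (of_real (r - s) * \<psi> (v + u))) * G"
      unfolding G_def using r st C by (intro markov[OF _ _ Z, of _ C]) auto
    finally have e: "expectation (\<lambda>\<omega>. Z \<omega> * wave u t \<omega> * wave v r \<omega>) = exp z * G"
      unfolding z_def exp_add by simp
    have nz: "norm z \<le> (t - s) * q"
    proof -
      have "norm z \<le> (t - r) * norm (\<psi> u) + (r - s) * norm (\<psi> (v + u))"
        unfolding z_def using r by (intro order_trans[OF norm_triangle_ineq]) (simp add: norm_mult del: of_real_diff)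
      also have "\<dots> \<le> (t - s) * norm (\<psi> u) + (t - s) * norm (\<psi> (v + u))"
        using r by (intro add_mono mult_right_mono) auto
      finally show ?thesis by (simp add: q algebra_simps)
    qed
    have nz2: "norm z \<le> l * q" using nz mult_right_mono[OF st(3) q0] by simp
    have "norm (exp z * G - G) = norm (exp z - 1) * norm G" by (simp add: norm_mult[symmetric] algebra_simps)
    also have "\<dots> \<le> (exp (l * q) * ((t - s) * q)) * C"
      using nz nz2 G C(2) q0 st
      by (intro mult_mono order_trans[OF exp_minus_1_bound[of z] mult_mono]) auto
    finally show ?thesis unfolding e by (simp add: mult_ac)
  qed
  have "norm ((LINT r:{s..t}|lborel. expectation (\<lambda>\<omega>. Z \<omega> * wave u t \<omega> * wave v r \<omega>)) - (t - s) *\<^sub>R G)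
      \<le> C * exp (l * q) * q * (t - s) * (t - s)"
    by (rule set_integral_near_const[OF st(2) set_integrable_expectation[OF st(1) ZW ZWC] n])
  then show ?thesis unfolding e1 G_def by (simp add: power2_eq_square mult_ac)
qed

text \<open>L itself moves by at most D (t - s), and with L frozen at s the wave moves by
  \<open>wave_step1\<close>. This supplies the continuity of the derivative required by the
  forward-expansion criterion.\<close>

lemma expectation_wave_continuous:
  assumes ab: "0 \<le> a"
    and L: "\<And>t. t \<in> {a..b} \<Longrightarrow> L t \<in> borel_measurable (past t)"
    and C: "\<And>t \<omega>. t \<in> {a..b} \<Longrightarrow> \<omega> \<in> space M \<Longrightarrow> norm (L t \<omega>) \<le> C"
    and D: "\<And>s t \<omega>. a \<le> s \<Longrightarrow> s \<le> t \<Longrightarrow> t \<le> b \<Longrightarrow> \<omega> \<in> space M \<Longrightarrow> norm (L t \<omega> - L s \<omega>) \<le> D * (t - s)"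
  shows "continuous_on {a..b} (\<lambda>t. expectation (\<lambda>\<omega>. L t \<omega> * wave w t \<omega>))"
proof (cases "a < b")
  case True
  obtain \<omega>0 where w0: "\<omega>0 \<in> space M" using not_empty by blast
  have C0: "C \<ge> 0" using C[of a \<omega>0] w0 True norm_ge_zero order_trans by (metis atLeastAtMost_iff less_imp_le order_refl)
  have D0: "D \<ge> 0"
  proof -
    have "0 \<le> D * (b - a)" using D[of a b \<omega>0] w0 True by (meson less_imp_le norm_ge_zero order_refl order_trans)
    then show ?thesis using True by (simp add: zero_le_mult_iff)
  qed
  let ?f = "\<lambda>t. expectation (\<lambda>\<omega>. L t \<omega> * wave w t \<omega>)"
  define Q where "Q = D + C * exp ((b - a) * norm (\<psi> w)) * norm (\<psi> w)"
  have Q0: "Q \<ge> 0" using C0 D0 by (simp add: Q_def)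
  have step: "norm (?f t - ?f s) \<le> Q * (t - s)" if st: "a \<le> s" "s \<le> t" "t \<le> b" for s t
  proof -
    have Lt: "L t \<in> borel_measurable M" "L s \<in> borel_measurable M"
      using L[of t] L[of s] st by (auto intro: past_M)
    have mw: "wave w t \<in> borel_measurable M" using st ab by (intro wave_measurable) auto
    have "norm (expectation (\<lambda>\<omega>. L t \<omega> * wave w t \<omega>) - expectation (\<lambda>\<omega>. L s \<omega> * wave w t \<omega>)) \<le> D * (t - s)"
    proof (rule expectation_mono_bound[where ?C1.0=C and ?C2.0=C])
      show "norm (L t \<omega> * wave w t \<omega> - L s \<omega> * wave w t \<omega>) \<le> D * (t - s)" if "\<omega> \<in> space M" for \<omega>
        using D[OF st that] by (simp add: left_diff_distrib[symmetric] norm_mult)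
    qed (use Lt mw C st D0 in \<open>auto simp: norm_mult intro!: borel_measurable_times\<close>)
    moreover have "norm (expectation (\<lambda>\<omega>. L s \<omega> * wave w t \<omega>) - ?f s) \<le> C * exp ((b - a) * norm (\<psi> w)) * norm (\<psi> w) * (t - s)"
      using st ab C0 by (intro wave_step1 L C) auto
    ultimately have "norm (?f t - ?f s) \<le> D * (t - s) + C * exp ((b - a) * norm (\<psi> w)) * norm (\<psi> w) * (t - s)"
      by (rule norm_diff_triangle_le)
    then show ?thesis by (simp add: Q_def algebra_simps)
  qed
  have "Q-lipschitz_on {a..b} ?f"
  proof (rule lipschitz_onI[OF _ Q0])
    fix x y assume xy: "x \<in> {a..b}" "y \<in> {a..b}"
    show "dist (?f x) (?f y) \<le> Q * dist x y"
      using step[of x y] step[of y x] xy by (cases "x \<le> y") (auto simp: dist_norm norm_minus_commute)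
  qed
  then show ?thesis by (rule lipschitz_on_continuous_on)
next
  case False
  then have "{a..b} = {} \<or> {a..b} = {a}" by auto
  then show ?thesis by auto
qed

text \<open>The increment of K times the wave is split into the change of K against the wave at t,
  and K frozen at s against the change of the wave. The first is expanded in occupation integrals
  and evaluated by \<open>occ_step\<close>, the second by \<open>wave_step2\<close>; all remainders
  are quadratic in t - s.\<close>

theorem expectation_wave_derivative:
  fixes K :: "real \<Rightarrow> 'a \<Rightarrow> complex" and L :: "'j \<Rightarrow> real \<Rightarrow> 'a \<Rightarrow> complex" and v :: "'j \<Rightarrow> real"
  assumes ab: "0 \<le> a" and J: "finite J"
    and K: "\<And>t. t \<in> {a..b} \<Longrightarrow> K t \<in> borel_measurable (past t)"
    and KC: "\<And>t \<omega>. t \<in> {a..b} \<Longrightarrow> \<omega> \<in> space M \<Longrightarrow> norm (K t \<omega>) \<le> C"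
    and L: "\<And>j t. j \<in> J \<Longrightarrow> t \<in> {a..b} \<Longrightarrow> L j t \<in> borel_measurable (past t)"
    and LC: "\<And>j t \<omega>. j \<in> J \<Longrightarrow> t \<in> {a..b} \<Longrightarrow> \<omega> \<in> space M \<Longrightarrow> norm (L j t \<omega>) \<le> C"
    and LD: "\<And>j s t \<omega>. j \<in> J \<Longrightarrow> a \<le> s \<Longrightarrow> s \<le> t \<Longrightarrow> t \<le> b \<Longrightarrow> \<omega> \<in> space M \<Longrightarrow> norm (L j t \<omega> - L j s \<omega>) \<le> D * (t - s)"
    and KL: "\<And>s t \<omega>. a \<le> s \<Longrightarrow> s \<le> t \<Longrightarrow> t \<le> b \<Longrightarrow> \<omega> \<in> space M \<Longrightarrow>
        norm (K t \<omega> - K s \<omega> - (\<Sum>j\<in>J. L j s \<omega> * occ (v j) s t \<omega>)) \<le> D * (t - s)\<^sup>2"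
    and t: "t \<in> {a..b}"
  shows "((\<lambda>t. expectation (\<lambda>\<omega>. K t \<omega> * wave u t \<omega>)) has_vector_derivative
      (\<Sum>j\<in>J. expectation (\<lambda>\<omega>. L j t \<omega> * wave (v j + u) t \<omega>)) - \<psi> u * expectation (\<lambda>\<omega>. K t \<omega> * wave u t \<omega>)) (at t within {a..b})"
proof (cases "a < b")
  case False
  then have "{a..b} = {t}" using t by auto
  then show ?thesis by (simp add: has_vector_derivative_def has_derivative_within_singleton_iff bounded_linear_scaleR_left)
next
  case True
  obtain \<omega>0 where w0: "\<omega>0 \<in> space M" using not_empty by blast
  have C0: "C \<ge> 0" using KC[of a \<omega>0] w0 True norm_ge_zero order_trans by (metis atLeastAtMost_iff less_imp_le order_refl)
  have D0: "D \<ge> 0"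
  proof -
    have "0 \<le> D * (b - a)\<^sup>2" using KL[of a b \<omega>0] w0 True by (meson less_imp_le norm_ge_zero order_refl order_trans)
    then show ?thesis using True by (simp add: zero_le_mult_iff)
  qed
  define G where "G t = expectation (\<lambda>\<omega>. K t \<omega> * wave u t \<omega>)" for t
  define g where "g t = (\<Sum>j\<in>J. expectation (\<lambda>\<omega>. L j t \<omega> * wave (v j + u) t \<omega>)) - \<psi> u * G t" for t
  define q where "q j = norm (\<psi> u) + norm (\<psi> (v j + u))" for j
  define Q where "Q = D + (\<Sum>j\<in>J. C * exp ((b - a) * q j) * q j) + C * exp ((b - a) * norm (\<psi> u)) * (norm (\<psi> u))\<^sup>2"
  have KLip: "norm (K t \<omega> - K s \<omega>) \<le> (D * (b - a) + card J * C) * (t - s)"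
    if st: "a \<le> s" "s \<le> t" "t \<le> b" and w: "\<omega> \<in> space M" for s t \<omega>
  proof -
    have "norm (\<Sum>j\<in>J. L j s \<omega> * occ (v j) s t \<omega>) \<le> (\<Sum>j\<in>J. C * (t - s))"
      using st w ab norm_occ_le[of s t \<omega>] C0 by (intro sum_norm_le) (auto simp: norm_mult intro!: mult_mono LC)
    moreover have "D * (t - s)\<^sup>2 \<le> D * (b - a) * (t - s)"
      using st D0 by (auto simp: power2_eq_square mult.assoc intro!: mult_left_mono mult_right_mono)
    moreover have "norm (K t \<omega> - K s \<omega>) \<le> norm (K t \<omega> - K s \<omega> - (\<Sum>j\<in>J. L j s \<omega> * occ (v j) s t \<omega>)) + norm (\<Sum>j\<in>J. L j s \<omega> * occ (v j) s t \<omega>)"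
      using norm_triangle_ineq[of "K t \<omega> - K s \<omega> - (\<Sum>j\<in>J. L j s \<omega> * occ (v j) s t \<omega>)" "\<Sum>j\<in>J. L j s \<omega> * occ (v j) s t \<omega>"] by simp
    ultimately show ?thesis using KL[OF st w] by (simp add: algebra_simps)
  qed
  have "(G has_vector_derivative g t) (at t within {a..b})"
  proof (rule has_vector_derivative_of_quadratic_expansion[OF _ _ t, where C=Q])
    show "continuous_on {a..b} g"
      unfolding g_def G_def
      by (intro continuous_intros expectation_wave_continuous[OF ab K KC KLip]
          expectation_wave_continuous[OF ab L LC LD])
    fix s t assume st: "a \<le> s" "s \<le> t" "t \<le> b"
    have s0: "0 \<le> s" "0 \<le> t" "t - s \<le> b - a" "s \<in> {a..b}" "t \<in> {a..b}" using st ab by auto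
    \<comment> \<open>\<open>T1\<close> is the linear part of the change of K, and \<open>T2\<close>
      keeps K frozen while the wave advances; the three bounds below treat the remainder,
      \<open>T1\<close> and \<open>T2\<close> in turn.\<close>
    define T1 where "T1 = expectation (\<lambda>\<omega>. (\<Sum>j\<in>J. L j s \<omega> * occ (v j) s t \<omega> * wave u t \<omega>))"
    define T2 where "T2 = expectation (\<lambda>\<omega>. K s \<omega> * wave u t \<omega>)"
    have mw: "wave u t \<in> borel_measurable M" using s0 by (intro wave_measurable)
    have mL: "L j s \<in> borel_measurable M" if "j \<in> J" for j using L[OF that s0(4)] by (rule past_M)
    have mK: "K s \<in> borel_measurable M" "K t \<in> borel_measurable M" using K s0 by (auto intro: past_M)
    have mo: "occ (v j) s t \<in> borel_measurable M" for j using occ_past[of s t t] s0 by (auto intro: past_M)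
    have iL: "integrable M (\<lambda>\<omega>. L j s \<omega> * occ (v j) s t \<omega> * wave u t \<omega>)" if j: "j \<in> J" for j
      using mL[OF j] mo mw LC[OF j s0(4)] norm_occ_le[OF s0(1) st(2)] C0 st
      by (intro integrable_bounded[of _ "C * (t - s)"]) (auto simp: norm_mult intro!: mult_mono)
    have iK: "integrable M (\<lambda>\<omega>. K s \<omega> * wave u t \<omega>)" "integrable M (\<lambda>\<omega>. K t \<omega> * wave u t \<omega>)"
      using mK mw KC s0 by (auto intro!: integrable_bounded[of _ C] simp: norm_mult)
    have T1: "T1 = (\<Sum>j\<in>J. expectation (\<lambda>\<omega>. L j s \<omega> * occ (v j) s t \<omega> * wave u t \<omega>))"
      unfolding T1_def using iL by (rule Bochner_Integration.integral_sum)
    have "G t - T2 - T1 = expectation (\<lambda>\<omega>. K t \<omega> * wave u t \<omega> - K s \<omega> * wave u t \<omega> - (\<Sum>j\<in>J. L j s \<omega> * occ (v j) s t \<omega> * wave u t \<omega>))"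
      unfolding G_def T2_def T1_def using iK iL by (simp add: Bochner_Integration.integral_diff)
    also have "\<dots> = expectation (\<lambda>\<omega>. (K t \<omega> - K s \<omega> - (\<Sum>j\<in>J. L j s \<omega> * occ (v j) s t \<omega>)) * wave u t \<omega>)"
      by (simp add: algebra_simps sum_distrib_left sum_distrib_right)
    also have "norm \<dots> \<le> D * (t - s)\<^sup>2"
      using KL[OF st] D0 by (intro expectation_norm_le) (auto simp: norm_mult)
    finally have b1: "norm (G t - T2 - T1) \<le> D * (t - s)\<^sup>2" .
    have b2: "norm (T1 - (t - s) *\<^sub>R (\<Sum>j\<in>J. expectation (\<lambda>\<omega>. L j s \<omega> * wave (v j + u) s \<omega>)))
       \<le> (\<Sum>j\<in>J. C * exp ((b - a) * q j) * q j * (t - s)\<^sup>2)"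
      unfolding T1 scaleR_sum_right sum_subtractf[symmetric]
      using s0 st C0 L LC by (intro sum_norm_le occ_step) (auto simp: q_def)
    have b3: "norm (T2 - G s - (t - s) *\<^sub>R (- \<psi> u * G s)) \<le> C * exp ((b - a) * norm (\<psi> u)) * (norm (\<psi> u))\<^sup>2 * (t - s)\<^sup>2"
      unfolding T2_def G_def using s0 st C0 K KC by (intro wave_step2) auto
    have "G t - G s - (t - s) *\<^sub>R g s = (G t - T2 - T1) + (T1 - (t - s) *\<^sub>R (\<Sum>j\<in>J. expectation (\<lambda>\<omega>. L j s \<omega> * wave (v j + u) s \<omega>)))
       + (T2 - G s - (t - s) *\<^sub>R (- \<psi> u * G s))"
      unfolding g_def by (simp add: algebra_simps)
    also have "norm \<dots> \<le> D * (t - s)\<^sup>2 + (\<Sum>j\<in>J. C * exp ((b - a) * q j) * q j * (t - s)\<^sup>2)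
       + C * exp ((b - a) * norm (\<psi> u)) * (norm (\<psi> u))\<^sup>2 * (t - s)\<^sup>2"
      by (intro norm_triangle_mono b1 b2 b3)
    also have "\<dots> = Q * (t - s)\<^sup>2" by (simp add: Q_def distrib_right sum_distrib_right)
    finally show "norm (G t - G s - (t - s) *\<^sub>R g s) \<le> Q * (t - s)\<^sup>2" .
  qed
  then show ?thesis unfolding G_def g_def .
qed

end

text \<open>Differentiation at time 0 reads off the rate without a logarithm; the derivative is
  one-sided because the equality is given only for nonnegative times.\<close>

lemma exp_rate_unique:
  fixes a b :: complex
  assumes "\<And>t::real. t \<ge> 0 \<Longrightarrow> exp (- (of_real t * a)) = exp (- (of_real t * b))"
  shows "a = b"
proof -
  have d: "((\<lambda>t. exp (- (of_real t * c))) has_vector_derivative - c) (at (0::real) within {0..1})" for c :: complex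
  proof -
    have "((\<lambda>z. exp (- (z * c))) has_field_derivative - c) (at (of_real 0))"
      by (auto intro!: derivative_eq_intros)
    then show ?thesis by (rule has_vector_derivative_real_field)
  qed
  have "((\<lambda>t. exp (- (of_real t * a))) has_vector_derivative - b) (at (0::real) within {0..1})"
    by (rule has_vector_derivative_transform[OF _ _ d[of b]]) (auto simp: assms)
  from vector_derivative_unique_within_closed_interval[of 0 1 0, unfolded box_real, OF _ _ this d[of a]]
  show ?thesis by simp
qed

section \<open>Symmetry of the exponent and a product calculus for adapted functionals\<close>

context pinned_levy_process
begin

lemma wave_0 [simp]: "wave 0 t = (\<lambda>_. 1)"
  by (simp add: wave_def fun_eq_iff)

lemma exponent_0: "\<psi> 0 = 0"
proof (rule exp_rate_unique)
  fix t :: real assume t: "t \<ge> 0"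
  have "expectation (wave 0 t) = 1" unfolding wave_def by (simp add: prob_space)
  then show "exp (- (of_real t * \<psi> 0)) = exp (- (of_real t * 0))" using expectation_wave[OF t, of 0] by simp
qed

lemma exponent_minus: "\<psi> (- u) = cnj (\<psi> u)"
proof (rule exp_rate_unique)
  fix t :: real assume t: "t \<ge> 0"
  have "expectation (wave (- u) t) = cnj (expectation (wave u t))"
    unfolding cnj_wave[symmetric] by simp
  then show "exp (- (of_real t * \<psi> (- u))) = exp (- (of_real t * cnj (\<psi> u)))"
    using expectation_wave[OF t] by (simp add: exp_cnj)
qed

text \<open>One constant serves both the bound and the Lipschitz estimate, uniformly over sample
  points. The class is closed under products, hence contains the powers that occur in the moment
  computation.\<close>

definition adapted_lip :: "real \<Rightarrow> real \<Rightarrow> (real \<Rightarrow> 'a \<Rightarrow> complex) \<Rightarrow> bool" where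
  "adapted_lip a b f \<longleftrightarrow> (\<forall>t\<in>{a..b}. f t \<in> borel_measurable (past t)) \<and>
     (\<exists>C\<ge>0. (\<forall>t\<in>{a..b}. \<forall>\<omega>\<in>space M. norm (f t \<omega>) \<le> C) \<and>
          (\<forall>s t. \<forall>\<omega>\<in>space M. a \<le> s \<longrightarrow> s \<le> t \<longrightarrow> t \<le> b \<longrightarrow> norm (f t \<omega> - f s \<omega>) \<le> C * (t - s)))"

lemma adapted_lip_bound:
  assumes "adapted_lip a b f"
  obtains C where "C \<ge> 0" "\<And>t \<omega>. t \<in> {a..b} \<Longrightarrow> \<omega> \<in> space M \<Longrightarrow> norm (f t \<omega>) \<le> C"
    "\<And>s t \<omega>. a \<le> s \<Longrightarrow> s \<le> t \<Longrightarrow> t \<le> b \<Longrightarrow> \<omega> \<in> space M \<Longrightarrow> norm (f t \<omega> - f s \<omega>) \<le> C * (t - s)"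
  using assms unfolding adapted_lip_def by blast

lemma adapted_lip_past: "adapted_lip a b f \<Longrightarrow> t \<in> {a..b} \<Longrightarrow> f t \<in> borel_measurable (past t)"
  unfolding adapted_lip_def by blast

lemma adapted_lip_const: "adapted_lip a b (\<lambda>_ _. c)"
  unfolding adapted_lip_def by (auto intro!: exI[of _ "norm c"])

lemma adapted_lip_add:
  assumes f: "adapted_lip a b f" and g: "adapted_lip a b g"
  shows "adapted_lip a b (\<lambda>t \<omega>. f t \<omega> + g t \<omega>)"
proof -
  from adapted_lip_bound[OF f] obtain C where C: "C \<ge> 0" "\<And>t \<omega>. t \<in> {a..b} \<Longrightarrow> \<omega> \<in> space M \<Longrightarrow> norm (f t \<omega>) \<le> C"
    "\<And>s t \<omega>. a \<le> s \<Longrightarrow> s \<le> t \<Longrightarrow> t \<le> b \<Longrightarrow> \<omega> \<in> space M \<Longrightarrow> norm (f t \<omega> - f s \<omega>) \<le> C * (t - s)" by metis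
  from adapted_lip_bound[OF g] obtain D where D: "D \<ge> 0" "\<And>t \<omega>. t \<in> {a..b} \<Longrightarrow> \<omega> \<in> space M \<Longrightarrow> norm (g t \<omega>) \<le> D"
    "\<And>s t \<omega>. a \<le> s \<Longrightarrow> s \<le> t \<Longrightarrow> t \<le> b \<Longrightarrow> \<omega> \<in> space M \<Longrightarrow> norm (g t \<omega> - g s \<omega>) \<le> D * (t - s)" by metis
  show ?thesis unfolding adapted_lip_def
  proof (intro conjI ballI exI[of _ "C + D"] allI impI)
    show "(\<lambda>\<omega>. f t \<omega> + g t \<omega>) \<in> borel_measurable (past t)" if "t \<in> {a..b}" for t
      using adapted_lip_past[OF f that] adapted_lip_past[OF g that] by measurable
    show "0 \<le> C + D" using C D by simp
    show "norm (f t \<omega> + g t \<omega>) \<le> C + D" if "t \<in> {a..b}" "\<omega> \<in> space M" for t \<omega>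
      using C(2)[OF that] D(2)[OF that] by (rule norm_triangle_mono)
    show "norm (f t \<omega> + g t \<omega> - (f s \<omega> + g s \<omega>)) \<le> (C + D) * (t - s)"
      if "\<omega> \<in> space M" "a \<le> s" "s \<le> t" "t \<le> b" for s t \<omega>
      using norm_triangle_mono[OF C(3)[OF that(2,3,4,1)] D(3)[OF that(2,3,4,1)]] by (simp add: algebra_simps)
  qed
qed

lemma adapted_lip_mult:
  assumes f: "adapted_lip a b f" and g: "adapted_lip a b g"
  shows "adapted_lip a b (\<lambda>t \<omega>. f t \<omega> * g t \<omega>)"
proof -
  from adapted_lip_bound[OF f] obtain C where C: "C \<ge> 0" "\<And>t \<omega>. t \<in> {a..b} \<Longrightarrow> \<omega> \<in> space M \<Longrightarrow> norm (f t \<omega>) \<le> C"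
    "\<And>s t \<omega>. a \<le> s \<Longrightarrow> s \<le> t \<Longrightarrow> t \<le> b \<Longrightarrow> \<omega> \<in> space M \<Longrightarrow> norm (f t \<omega> - f s \<omega>) \<le> C * (t - s)" by metis
  from adapted_lip_bound[OF g] obtain D where D: "D \<ge> 0" "\<And>t \<omega>. t \<in> {a..b} \<Longrightarrow> \<omega> \<in> space M \<Longrightarrow> norm (g t \<omega>) \<le> D"
    "\<And>s t \<omega>. a \<le> s \<Longrightarrow> s \<le> t \<Longrightarrow> t \<le> b \<Longrightarrow> \<omega> \<in> space M \<Longrightarrow> norm (g t \<omega> - g s \<omega>) \<le> D * (t - s)" by metis
  have CD: "0 \<le> C * D" using C(1) D(1) by simp
  show ?thesis unfolding adapted_lip_def
  proof (intro conjI ballI exI[of _ "C * D + C * D"] allI impI)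
    show "(\<lambda>\<omega>. f t \<omega> * g t \<omega>) \<in> borel_measurable (past t)" if "t \<in> {a..b}" for t
      using adapted_lip_past[OF f that] adapted_lip_past[OF g that] by measurable
    show "0 \<le> C * D + C * D" using CD by simp
    show "norm (f t \<omega> * g t \<omega>) \<le> C * D + C * D" if "t \<in> {a..b}" "\<omega> \<in> space M" for t \<omega>
      using mult_mono[OF C(2)[OF that] D(2)[OF that]] C(1) CD unfolding norm_mult by simp
    show "norm (f t \<omega> * g t \<omega> - f s \<omega> * g s \<omega>) \<le> (C * D + C * D) * (t - s)"
      if "\<omega> \<in> space M" "a \<le> s" "s \<le> t" "t \<le> b" for s t \<omega>
    proof -
      have st: "s \<in> {a..b}" "t \<in> {a..b}" using that by auto
      have "norm ((f t \<omega> - f s \<omega>) * g t \<omega> + f s \<omega> * (g t \<omega> - g s \<omega>)) \<le> C * (t - s) * D + C * (D * (t - s))"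
        using C(1) D(1) that
        by (intro norm_triangle_mono) (auto simp: norm_mult intro!: mult_mono C D that st)
      then show ?thesis by (simp add: algebra_simps)
    qed
  qed
qed

text \<open>The integrated form of dK = (sum over j of L_j exp(i v_j X)) dt with a quadratic error:
  \<open>L\<close> plays the role of the derivative of \<open>K\<close> along the waves of frequency
  \<open>v\<close>.\<close>

definition expands :: "real \<Rightarrow> real \<Rightarrow> 'j set \<Rightarrow> ('j \<Rightarrow> real) \<Rightarrow> (real \<Rightarrow> 'a \<Rightarrow> complex) \<Rightarrow> ('j \<Rightarrow> real \<Rightarrow> 'a \<Rightarrow> complex) \<Rightarrow> bool" where
  "expands a b J v K L \<longleftrightarrow> adapted_lip a b K \<and> (\<forall>j\<in>J. adapted_lip a b (L j)) \<and>
     (\<exists>D\<ge>0. \<forall>s t. \<forall>\<omega>\<in>space M. a \<le> s \<longrightarrow> s \<le> t \<longrightarrow> t \<le> b \<longrightarrow>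
        norm (K t \<omega> - K s \<omega> - (\<Sum>j\<in>J. L j s \<omega> * occ (v j) s t \<omega>)) \<le> D * (t - s)\<^sup>2)"

lemma adapted_lip_uniform:
  assumes J: "finite J" and L: "\<And>j. j \<in> J \<Longrightarrow> adapted_lip a b (L j)"
  obtains C where "C \<ge> 0" "\<And>j t \<omega>. j \<in> J \<Longrightarrow> t \<in> {a..b} \<Longrightarrow> \<omega> \<in> space M \<Longrightarrow> norm (L j t \<omega>) \<le> C"
    "\<And>j s t \<omega>. j \<in> J \<Longrightarrow> a \<le> s \<Longrightarrow> s \<le> t \<Longrightarrow> t \<le> b \<Longrightarrow> \<omega> \<in> space M \<Longrightarrow> norm (L j t \<omega> - L j s \<omega>) \<le> C * (t - s)"
proof -
  have "\<forall>j\<in>J. \<exists>C. C \<ge> 0 \<and> (\<forall>t\<in>{a..b}. \<forall>\<omega>\<in>space M. norm (L j t \<omega>) \<le> C) \<and>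
          (\<forall>s t. \<forall>\<omega>\<in>space M. a \<le> s \<longrightarrow> s \<le> t \<longrightarrow> t \<le> b \<longrightarrow> norm (L j t \<omega> - L j s \<omega>) \<le> C * (t - s))"
    using L unfolding adapted_lip_def by blast
  then obtain c where c: "\<And>j. j \<in> J \<Longrightarrow> c j \<ge> 0" "\<And>j t \<omega>. j \<in> J \<Longrightarrow> t \<in> {a..b} \<Longrightarrow> \<omega> \<in> space M \<Longrightarrow> norm (L j t \<omega>) \<le> c j"
    "\<And>j s t \<omega>. j \<in> J \<Longrightarrow> a \<le> s \<Longrightarrow> s \<le> t \<Longrightarrow> t \<le> b \<Longrightarrow> \<omega> \<in> space M \<Longrightarrow> norm (L j t \<omega> - L j s \<omega>) \<le> c j * (t - s)"
    by metis
  have le: "c j \<le> sum c J" if "j \<in> J" for j using that J c(1) by (intro member_le_sum) auto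
  show ?thesis
  proof (rule that[of "sum c J"])
    show "sum c J \<ge> 0" using c(1) by (rule sum_nonneg)
    show "norm (L j t \<omega>) \<le> sum c J" if "j \<in> J" "t \<in> {a..b}" "\<omega> \<in> space M" for j t \<omega>
      using c(2)[OF that] le[OF that(1)] by simp
    show "norm (L j t \<omega> - L j s \<omega>) \<le> sum c J * (t - s)" if "j \<in> J" "a \<le> s" "s \<le> t" "t \<le> b" "\<omega> \<in> space M" for j s t \<omega>
      using c(3)[OF that] mult_right_mono[OF le[OF that(1)], of "t - s"] that by simp
  qed
qed

lemma expands_derivative:
  assumes ab: "0 \<le> a" and J: "finite J" and e: "expands a b J v K L" and t: "t \<in> {a..b}"
  shows "((\<lambda>t. expectation (\<lambda>\<omega>. K t \<omega> * wave u t \<omega>)) has_vector_derivative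
      (\<Sum>j\<in>J. expectation (\<lambda>\<omega>. L j t \<omega> * wave (v j + u) t \<omega>)) - \<psi> u * expectation (\<lambda>\<omega>. K t \<omega> * wave u t \<omega>)) (at t within {a..b})"
proof -
  from e have K: "adapted_lip a b K" and L: "\<And>j. j \<in> J \<Longrightarrow> adapted_lip a b (L j)"
    unfolding expands_def by auto
  from adapted_lip_bound[OF K] obtain C where C: "C \<ge> 0" "\<And>t \<omega>. t \<in> {a..b} \<Longrightarrow> \<omega> \<in> space M \<Longrightarrow> norm (K t \<omega>) \<le> C" by metis
  from adapted_lip_uniform[of J a b L, OF J L] obtain C' where C': "C' \<ge> 0" "\<And>j t \<omega>. j \<in> J \<Longrightarrow> t \<in> {a..b} \<Longrightarrow> \<omega> \<in> space M \<Longrightarrow> norm (L j t \<omega>) \<le> C'"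
    "\<And>j s t \<omega>. j \<in> J \<Longrightarrow> a \<le> s \<Longrightarrow> s \<le> t \<Longrightarrow> t \<le> b \<Longrightarrow> \<omega> \<in> space M \<Longrightarrow> norm (L j t \<omega> - L j s \<omega>) \<le> C' * (t - s)" by metis
  from e obtain D where D: "D \<ge> 0" "\<And>s t \<omega>. \<omega>\<in>space M \<Longrightarrow> a \<le> s \<Longrightarrow> s \<le> t \<Longrightarrow> t \<le> b \<Longrightarrow>
        norm (K t \<omega> - K s \<omega> - (\<Sum>j\<in>J. L j s \<omega> * occ (v j) s t \<omega>)) \<le> D * (t - s)\<^sup>2"
    unfolding expands_def by blast
  show ?thesis
  proof (rule expectation_wave_derivative[where C="C + C'" and D="C' + D", OF ab J _ _ _ _ _ _ t])
    show "norm (L j t \<omega> - L j s \<omega>) \<le> (C' + D) * (t - s)" if "j \<in> J" "a \<le> s" "s \<le> t" "t \<le> b" "\<omega> \<in> space M" for j s t \<omega>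
      using C'(3)[OF that] mult_right_mono[of C' "C' + D" "t - s"] D(1) that by simp
    show "norm (K t \<omega> - K s \<omega> - (\<Sum>j\<in>J. L j s \<omega> * occ (v j) s t \<omega>)) \<le> (C' + D) * (t - s)\<^sup>2"
      if "a \<le> s" "s \<le> t" "t \<le> b" "\<omega> \<in> space M" for s t \<omega>
      using D(2)[OF that(4,1,2,3)] mult_right_mono[of D "C' + D" "(t - s)\<^sup>2"] C'(1) by simp
    show "norm (K t \<omega>) \<le> C + C'" if "t \<in> {a..b}" "\<omega> \<in> space M" for t \<omega> using C(2)[OF that] C'(1) by simp
    show "norm (L j t \<omega>) \<le> C + C'" if "j \<in> J" "t \<in> {a..b}" "\<omega> \<in> space M" for j t \<omega> using C'(2)[OF that] C(1) by simp
  qed (auto intro: adapted_lip_past[OF K] adapted_lip_past[OF L])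
qed

text \<open>The Leibniz rule. The cross term is the linear part of the first increment times the
  second increment; each factor is of order t - s, so the product goes into the error.\<close>

lemma expands_mult:
  assumes ab: "0 \<le> a" and J: "finite J" and e1: "expands a b J v K1 L1" and e2: "expands a b J v K2 L2"
  shows "expands a b J v (\<lambda>t \<omega>. K1 t \<omega> * K2 t \<omega>) (\<lambda>j t \<omega>. L1 j t \<omega> * K2 t \<omega> + K1 t \<omega> * L2 j t \<omega>)"
proof -
  from e1 have K1: "adapted_lip a b K1" and L1: "\<And>j. j \<in> J \<Longrightarrow> adapted_lip a b (L1 j)" unfolding expands_def by auto
  from e2 have K2: "adapted_lip a b K2" and L2: "\<And>j. j \<in> J \<Longrightarrow> adapted_lip a b (L2 j)" unfolding expands_def by auto
  from adapted_lip_bound[OF K1] obtain C1 where C1: "C1 \<ge> 0" "\<And>t \<omega>. t \<in> {a..b} \<Longrightarrow> \<omega> \<in> space M \<Longrightarrow> norm (K1 t \<omega>) \<le> C1" by metis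
  from adapted_lip_bound[OF K2] obtain C2 where C2: "C2 \<ge> 0" "\<And>t \<omega>. t \<in> {a..b} \<Longrightarrow> \<omega> \<in> space M \<Longrightarrow> norm (K2 t \<omega>) \<le> C2"
    "\<And>s t \<omega>. a \<le> s \<Longrightarrow> s \<le> t \<Longrightarrow> t \<le> b \<Longrightarrow> \<omega> \<in> space M \<Longrightarrow> norm (K2 t \<omega> - K2 s \<omega>) \<le> C2 * (t - s)" by metis
  from adapted_lip_uniform[of J a b L1, OF J L1] obtain C3 where C3: "C3 \<ge> 0" "\<And>j t \<omega>. j \<in> J \<Longrightarrow> t \<in> {a..b} \<Longrightarrow> \<omega> \<in> space M \<Longrightarrow> norm (L1 j t \<omega>) \<le> C3" by metis
  from e1 obtain D1 where D1: "D1 \<ge> 0" "\<And>s t \<omega>. \<omega>\<in>space M \<Longrightarrow> a \<le> s \<Longrightarrow> s \<le> t \<Longrightarrow> t \<le> b \<Longrightarrow>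
        norm (K1 t \<omega> - K1 s \<omega> - (\<Sum>j\<in>J. L1 j s \<omega> * occ (v j) s t \<omega>)) \<le> D1 * (t - s)\<^sup>2"
    unfolding expands_def by blast
  from e2 obtain D2 where D2: "D2 \<ge> 0" "\<And>s t \<omega>. \<omega>\<in>space M \<Longrightarrow> a \<le> s \<Longrightarrow> s \<le> t \<Longrightarrow> t \<le> b \<Longrightarrow>
        norm (K2 t \<omega> - K2 s \<omega> - (\<Sum>j\<in>J. L2 j s \<omega> * occ (v j) s t \<omega>)) \<le> D2 * (t - s)\<^sup>2"
    unfolding expands_def by blast
  define D where "D = D1 * C2 + real (card J) * C3 * C2 + C1 * D2"
  show ?thesis unfolding expands_def
  proof (intro conjI ballI adapted_lip_mult adapted_lip_add K1 K2 L1 L2 exI[of _ D] allI impI)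
    show "0 \<le> D" unfolding D_def using C1 C2 C3 D1 D2 by simp
    fix s t \<omega> assume w: "\<omega> \<in> space M" and st: "a \<le> s" "s \<le> t" "t \<le> b"
    define l1 where "l1 = (\<Sum>j\<in>J. L1 j s \<omega> * occ (v j) s t \<omega>)"
    define l2 where "l2 = (\<Sum>j\<in>J. L2 j s \<omega> * occ (v j) s t \<omega>)"
    have l1: "norm l1 \<le> real (card J) * C3 * (t - s)"
    proof -
      have "norm l1 \<le> (\<Sum>j\<in>J. C3 * (t - s))" unfolding l1_def
        using st w ab C3 norm_occ_le[of s t \<omega>] by (intro sum_norm_le) (auto simp: norm_mult intro!: mult_mono)
      then show ?thesis by (simp add: mult.assoc)
    qed
    have "(\<Sum>j\<in>J. (L1 j s \<omega> * K2 s \<omega> + K1 s \<omega> * L2 j s \<omega>) * occ (v j) s t \<omega>) = l1 * K2 s \<omega> + K1 s \<omega> * l2"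
      unfolding l1_def l2_def by (simp add: sum.distrib sum_distrib_left sum_distrib_right algebra_simps)
    then have "K1 t \<omega> * K2 t \<omega> - K1 s \<omega> * K2 s \<omega> - (\<Sum>j\<in>J. (L1 j s \<omega> * K2 s \<omega> + K1 s \<omega> * L2 j s \<omega>) * occ (v j) s t \<omega>)
       = (K1 t \<omega> - K1 s \<omega> - l1) * K2 t \<omega> + l1 * (K2 t \<omega> - K2 s \<omega>) + K1 s \<omega> * (K2 t \<omega> - K2 s \<omega> - l2)"
      by (simp add: algebra_simps)
    also have "norm \<dots> \<le> D1 * (t - s)\<^sup>2 * C2 + real (card J) * C3 * (t - s) * (C2 * (t - s)) + C1 * (D2 * (t - s)\<^sup>2)"
      using D1(2)[OF w st] D2(2)[OF w st] l1 C1(1) C1(2)[of s \<omega>] C2(1) C2(2)[of t \<omega>] C2(3)[OF st w] C3(1) D1(1) w st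
      unfolding l1_def[symmetric] l2_def[symmetric]
      by (intro norm_triangle_mono) (auto simp: norm_mult intro!: mult_mono)
    also have "\<dots> = D * (t - s)\<^sup>2" by (simp add: D_def algebra_simps power2_eq_square)
    finally show "norm (K1 t \<omega> * K2 t \<omega> - K1 s \<omega> * K2 s \<omega> - (\<Sum>j\<in>J. (L1 j s \<omega> * K2 s \<omega> + K1 s \<omega> * L2 j s \<omega>) * occ (v j) s t \<omega>)) \<le> D * (t - s)\<^sup>2" .
  qed
qed

lemma adapted_lip_occ:
  assumes ab: "0 \<le> a"
  shows "adapted_lip a b (occ v a)"
  unfolding adapted_lip_def
proof (intro conjI ballI exI[of _ "1 + \<bar>b - a\<bar>"] allI impI)
  show "occ v a t \<in> borel_measurable (past t)" for t by (rule occ_past[OF ab order_refl])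
  show "norm (occ v a t \<omega>) \<le> 1 + \<bar>b - a\<bar>" if "t \<in> {a..b}" "\<omega> \<in> space M" for t \<omega>
    using norm_occ_le[OF ab _ that(2), of t v] that(1) by auto
  show "norm (occ v a t \<omega> - occ v a s \<omega>) \<le> (1 + \<bar>b - a\<bar>) * (t - s)"
    if "\<omega> \<in> space M" "a \<le> s" "s \<le> t" "t \<le> b" for s t \<omega>
  proof -
    have "norm (occ v a t \<omega> - occ v a s \<omega>) = norm (occ v s t \<omega>)"
      using occ_split[OF ab that(2,3,1), of v] by simp
    also have "\<dots> \<le> 1 * (t - s)" using norm_occ_le[of s t \<omega>] that ab by simp
    also have "\<dots> \<le> (1 + \<bar>b - a\<bar>) * (t - s)" using that by (intro mult_right_mono) auto
    finally show ?thesis .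
  qed
qed simp

text \<open>An occupation integral is additive over adjacent intervals, so its expansion is exact
  and the error constant is 0.\<close>

lemma expands_occ:
  assumes ab: "0 \<le> a" and J: "finite J" "k \<in> J"
  shows "expands a b J v (occ (v k) a) (\<lambda>j _ _. if j = k then 1 else 0)"
  unfolding expands_def
proof (intro conjI ballI adapted_lip_occ[OF ab] adapted_lip_const exI[of _ 0] allI impI)
  fix s t \<omega> assume "\<omega> \<in> space M" "a \<le> s" "s \<le> t" "t \<le> b"
  then show "norm (occ (v k) a t \<omega> - occ (v k) a s \<omega> - (\<Sum>j\<in>J. (if j = k then 1 else 0) * occ (v j) s t \<omega>)) \<le> 0 * (t - s)\<^sup>2"
    using occ_split[OF ab, of s t \<omega> "v k"] J by (simp add: if_distrib[of "\<lambda>x. x * _"] cong: if_cong)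
qed simp

section \<open>Moments of occupation integrals\<close>

text \<open>With Z the occupation integral and Y its conjugate, each moment forces the next: E(Y
  e_\<theta>), E(Z Y), E(Z Y Y e_\<theta>), E(Z Y Z Y). At frequency \<theta> the equation is damped
  and costs a factor 1/\<rho> but no time; at frequency zero each integration costs one factor of
  time. Two of each kind give (b - a)^2 / \<rho>^2, and the constants multiply to 24.\<close>

lemma occ_fourth_moment:
  assumes ab: "0 \<le> a" "a \<le> b" and r: "\<rho> = Re (\<psi> \<theta>)" "\<rho> > 0"
  shows "expectation (\<lambda>\<omega>. (norm (occ \<theta> a b \<omega>)) ^ 4) \<le> 24 * (b - a)\<^sup>2 / \<rho>\<^sup>2"
proof -
  \<comment> \<open>Two frequencies suffice: \<open>True\<close> stands for \<theta>, carried by Z,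
    and \<open>False\<close> for -\<theta>, carried by Y.\<close>
  define v where "v j = (if j then \<theta> else - \<theta>)" for j
  let ?J = "UNIV :: bool set"
  define Z where "Z = occ \<theta> a"
  define Y where "Y = occ (- \<theta>) a"
  have YZ: "Y t \<omega> = cnj (Z t \<omega>)" for t \<omega> unfolding Y_def Z_def cnj_occ ..
  have Z0: "Z a \<omega> = 0" "Y a \<omega> = 0" for \<omega> unfolding Z_def Y_def by simp_all
  have eZ: "expands a b' ?J v Z (\<lambda>j _ _. if j then 1 else 0)" for b'
    using expands_occ[OF ab(1), of ?J True b' v] unfolding Z_def by (simp add: v_def cong: if_cong)
  have eY: "expands a b' ?J v Y (\<lambda>j _ _. if j = False then 1 else 0)" for b'
    using expands_occ[OF ab(1), of ?J False b' v] unfolding Y_def by (simp add: v_def cong: if_cong)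
  note der = expands_derivative[OF ab(1) finite[of "UNIV :: bool set"]]
  have lip: "adapted_lip a b' Z" "adapted_lip a b' Y" for b'
    using eZ eY unfolding expands_def by blast+
  have sum_bool: "(\<Sum>j\<in>?J. f j) = f True + f False" for f :: "bool \<Rightarrow> complex" by (simp add: UNIV_bool)
  \<comment> \<open>Differentiating Y produces the wave of frequency -\<theta>, which cancels
    against the wave of frequency \<theta> and leaves the constant forcing 1.\<close>
  have s1: "norm (expectation (\<lambda>\<omega>. Y t \<omega> * wave \<theta> t \<omega>)) \<le> 1 / \<rho>" if t: "a \<le> t" for t
  proof -
    have "((\<lambda>t. expectation (\<lambda>\<omega>. Y t \<omega> * wave \<theta> t \<omega>)) has_vector_derivative
        (\<lambda>_. 1) x - \<psi> \<theta> * expectation (\<lambda>\<omega>. Y x \<omega> * wave \<theta> x \<omega>)) (at x within {a..t})" if "x \<in> {a..t}" for x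
      using der[OF eY that, of \<theta>] by (simp add: sum_bool v_def prob_space)
    from linear_ode_bound_rate[OF t this, of 1] show ?thesis using r by (simp add: Z0)
  qed
  have s1': "norm (expectation (\<lambda>\<omega>. Z t \<omega> * wave (- \<theta>) t \<omega>)) \<le> 1 / \<rho>" if t: "a \<le> t" for t
  proof -
    have "expectation (\<lambda>\<omega>. Z t \<omega> * wave (- \<theta>) t \<omega>) = cnj (expectation (\<lambda>\<omega>. Y t \<omega> * wave \<theta> t \<omega>))"
      by (subst Bochner_Integration.integral_cnj[symmetric]) (simp add: YZ cnj_wave)
    then show ?thesis using s1[OF t] by simp
  qed
  have e2: "expands a b' ?J v (\<lambda>t \<omega>. Z t \<omega> * Y t \<omega>) (\<lambda>j t \<omega>. (if j then 1 else 0) * Y t \<omega> + Z t \<omega> * (if j = False then 1 else 0))" for b'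
    by (rule expands_mult[OF ab(1) finite[of "UNIV :: bool set"] eZ eY])
  define m2 where "m2 t = expectation (\<lambda>\<omega>. (norm (Z t \<omega>))\<^sup>2)" for t
  have ZY: "Z t \<omega> * Y t \<omega> = of_real ((norm (Z t \<omega>))\<^sup>2)" for t \<omega>
    unfolding YZ by (rule complex_norm_square[symmetric])
  have m2c: "expectation (\<lambda>\<omega>. Z t \<omega> * Y t \<omega>) = of_real (m2 t)" for t
    unfolding m2_def ZY by (rule integral_complex_of_real)
  have m2nn: "m2 t \<ge> 0" for t unfolding m2_def by (intro integral_nonneg_AE) auto
  \<comment> \<open>Z Y has two derivative terms, conjugate to each other and each bounded by
    1/\<rho>; frequency zero offers no damping, so the bound grows linearly.\<close>
  have s2: "m2 t \<le> 2 * (t - a) / \<rho>" if t: "a \<le> t" for t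
  proof -
    have "norm (expectation (\<lambda>\<omega>. Z t \<omega> * Y t \<omega> * wave 0 t \<omega>) - exp (- (of_real (t - a) * \<psi> 0)) * expectation (\<lambda>\<omega>. Z a \<omega> * Y a \<omega> * wave 0 a \<omega>))
        \<le> (2 / \<rho>) * (t - a)"
    proof (rule linear_ode_bound_length[OF t])
      fix x assume x: "x \<in> {a..t}"
      show "((\<lambda>t. expectation (\<lambda>\<omega>. Z t \<omega> * Y t \<omega> * wave 0 t \<omega>)) has_vector_derivative
        (expectation (\<lambda>\<omega>. Y x \<omega> * wave \<theta> x \<omega>) + expectation (\<lambda>\<omega>. Z x \<omega> * wave (- \<theta>) x \<omega>)) - \<psi> 0 * expectation (\<lambda>\<omega>. Z x \<omega> * Y x \<omega> * wave 0 x \<omega>)) (at x within {a..t})"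
        using der[OF e2 x, of 0] by (simp add: sum_bool v_def)
      show "norm (expectation (\<lambda>\<omega>. Y x \<omega> * wave \<theta> x \<omega>) + expectation (\<lambda>\<omega>. Z x \<omega> * wave (- \<theta>) x \<omega>)) \<le> 2 / \<rho>"
        using norm_triangle_mono[OF s1[of x] s1'[of x]] x by simp
    qed (simp add: exponent_0)
    then show ?thesis using m2nn[of t] by (simp add: Z0 m2c)
  qed
  have m2int: "norm (expectation f) \<le> c * m2 t" if "\<And>\<omega>. norm (f \<omega>) = c * (norm (Z t \<omega>))\<^sup>2" for f :: "'a \<Rightarrow> complex" and t c
    using integral_norm_bound[of M f] unfolding that m2_def by simp
  define L3 where "L3 j t \<omega> = (if j then Y t \<omega> * Y t \<omega> else 2 * (Z t \<omega> * Y t \<omega>))" for j t \<omega>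
  define L4 where "L4 j t \<omega> = (if j then 2 * (Z t \<omega> * Y t \<omega> * Y t \<omega>) else 2 * (Z t \<omega> * Y t \<omega> * Z t \<omega>))" for j t \<omega>
  have e3: "expands a b' ?J v (\<lambda>t \<omega>. Z t \<omega> * Y t \<omega> * Y t \<omega>) L3" for b'
  proof -
    have "L3 = (\<lambda>j t \<omega>. ((if j then 1 else 0) * Y t \<omega> + Z t \<omega> * (if j = False then 1 else 0)) * Y t \<omega> + Z t \<omega> * Y t \<omega> * (if j = False then 1 else 0))"
      by (auto simp: fun_eq_iff L3_def)
    then show ?thesis using expands_mult[OF ab(1) finite[of "UNIV :: bool set"] e2 eY] by simp
  qed
  have e4: "expands a b' ?J v (\<lambda>t \<omega>. Z t \<omega> * Y t \<omega> * (Z t \<omega> * Y t \<omega>)) L4" for b'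
  proof -
    have "L4 = (\<lambda>j t \<omega>. ((if j then 1 else 0) * Y t \<omega> + Z t \<omega> * (if j = False then 1 else 0)) * (Z t \<omega> * Y t \<omega>) + Z t \<omega> * Y t \<omega> * ((if j then 1 else 0) * Y t \<omega> + Z t \<omega> * (if j = False then 1 else 0)))"
      by (auto simp: fun_eq_iff L4_def)
    then show ?thesis using expands_mult[OF ab(1) finite[of "UNIV :: bool set"] e2 e2] by simp
  qed
  have nY: "norm (Y t \<omega>) = norm (Z t \<omega>)" for t \<omega> by (simp add: YZ)
  \<comment> \<open>Both forcing terms, of frequencies 2 \<theta> and 0, are bounded by the second
    moment alone: once and twice, hence 3 times 2 (t - a) / \<rho>, before damping divides by \<rho>
    again.\<close>
  have s3: "norm (expectation (\<lambda>\<omega>. Z t \<omega> * Y t \<omega> * Y t \<omega> * wave \<theta> t \<omega>)) \<le> 6 * (t - a) / \<rho>\<^sup>2" if t: "a \<le> t" for t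
  proof -
    define g where "g x = expectation (\<lambda>\<omega>. Y x \<omega> * Y x \<omega> * wave (\<theta> + \<theta>) x \<omega>) + expectation (\<lambda>\<omega>. 2 * (Z x \<omega> * Y x \<omega>) * wave (- \<theta> + \<theta>) x \<omega>)" for x
    have "norm (expectation (\<lambda>\<omega>. Z t \<omega> * Y t \<omega> * Y t \<omega> * wave \<theta> t \<omega>) - exp (- (of_real (t - a) * \<psi> \<theta>)) * expectation (\<lambda>\<omega>. Z a \<omega> * Y a \<omega> * Y a \<omega> * wave \<theta> a \<omega>))
        \<le> (6 * (t - a) / \<rho>) / Re (\<psi> \<theta>)"
    proof (rule linear_ode_bound_rate[OF t, where f="\<lambda>t. expectation (\<lambda>\<omega>. Z t \<omega> * Y t \<omega> * Y t \<omega> * wave \<theta> t \<omega>)" and g=g])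
      fix x assume x: "x \<in> {a..t}"
      show "((\<lambda>t. expectation (\<lambda>\<omega>. Z t \<omega> * Y t \<omega> * Y t \<omega> * wave \<theta> t \<omega>)) has_vector_derivative
        g x - \<psi> \<theta> * expectation (\<lambda>\<omega>. Z x \<omega> * Y x \<omega> * Y x \<omega> * wave \<theta> x \<omega>)) (at x within {a..t})"
        using der[OF e3 x, of \<theta>] unfolding sum_bool v_def g_def L3_def if_True if_False .
      have "norm (g x) \<le> 1 * m2 x + 2 * m2 x" unfolding g_def
        by (intro norm_triangle_mono m2int) (auto simp: norm_mult nY power2_eq_square)
      also have "\<dots> \<le> 3 * (2 * (t - a) / \<rho>)"
      proof -
        have "m2 x \<le> 2 * (x - a) / \<rho>" using s2[of x] x by simp
        also have "\<dots> \<le> 2 * (t - a) / \<rho>" using x r(2) by (intro divide_right_mono) auto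
        finally have "3 * m2 x \<le> 3 * (2 * (t - a) / \<rho>)" by (rule mult_left_mono) simp
        then show ?thesis by simp
      qed
      finally show "norm (g x) \<le> 6 * (t - a) / \<rho>" by simp
    qed (use r in auto)
    then show ?thesis using r by (simp add: Z0 power2_eq_square)
  qed
  have s3': "norm (expectation (\<lambda>\<omega>. Z t \<omega> * Y t \<omega> * Z t \<omega> * wave (- \<theta>) t \<omega>)) \<le> 6 * (t - a) / \<rho>\<^sup>2" if t: "a \<le> t" for t
  proof -
    have "expectation (\<lambda>\<omega>. Z t \<omega> * Y t \<omega> * Z t \<omega> * wave (- \<theta>) t \<omega>) = cnj (expectation (\<lambda>\<omega>. Z t \<omega> * Y t \<omega> * Y t \<omega> * wave \<theta> t \<omega>))"
      by (subst Bochner_Integration.integral_cnj[symmetric]) (simp add: YZ cnj_wave mult_ac)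
    then show ?thesis using s3[OF t] by simp
  qed
  have "norm (expectation (\<lambda>\<omega>. Z b \<omega> * Y b \<omega> * (Z b \<omega> * Y b \<omega>) * wave 0 b \<omega>) - exp (- (of_real (b - a) * \<psi> 0)) * expectation (\<lambda>\<omega>. Z a \<omega> * Y a \<omega> * (Z a \<omega> * Y a \<omega>) * wave 0 a \<omega>))
        \<le> (24 * (b - a) / \<rho>\<^sup>2) * (b - a)"
  proof (rule linear_ode_bound_length[OF ab(2), where f="\<lambda>t. expectation (\<lambda>\<omega>. Z t \<omega> * Y t \<omega> * (Z t \<omega> * Y t \<omega>) * wave 0 t \<omega>)"])
    fix x assume x: "x \<in> {a..b}"
    let ?g = "2 * expectation (\<lambda>\<omega>. Z x \<omega> * Y x \<omega> * Y x \<omega> * wave \<theta> x \<omega>) + 2 * expectation (\<lambda>\<omega>. Z x \<omega> * Y x \<omega> * Z x \<omega> * wave (- \<theta>) x \<omega>)"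
    have 1: "expectation (\<lambda>\<omega>. L4 True x \<omega> * wave (v True + 0) x \<omega>) = 2 * expectation (\<lambda>\<omega>. Z x \<omega> * Y x \<omega> * Y x \<omega> * wave \<theta> x \<omega>)"
      unfolding L4_def v_def if_True add_0_right mult.assoc[of 2] by (rule integral_mult_right_zero)
    have 2: "expectation (\<lambda>\<omega>. L4 False x \<omega> * wave (v False + 0) x \<omega>) = 2 * expectation (\<lambda>\<omega>. Z x \<omega> * Y x \<omega> * Z x \<omega> * wave (- \<theta>) x \<omega>)"
      unfolding L4_def v_def if_False add_0_right mult.assoc[of 2] by (rule integral_mult_right_zero)
    show "((\<lambda>t. expectation (\<lambda>\<omega>. Z t \<omega> * Y t \<omega> * (Z t \<omega> * Y t \<omega>) * wave 0 t \<omega>)) has_vector_derivative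
       ?g - \<psi> 0 * expectation (\<lambda>\<omega>. Z x \<omega> * Y x \<omega> * (Z x \<omega> * Y x \<omega>) * wave 0 x \<omega>)) (at x within {a..b})"
      using der[OF e4 x, of 0] unfolding sum_bool 1 2 .
    have "norm ?g \<le> 2 * (6 * (x - a) / \<rho>\<^sup>2) + 2 * (6 * (x - a) / \<rho>\<^sup>2)"
      using mult_left_mono[OF s3[of x], of 2] mult_left_mono[OF s3'[of x], of 2] x
      unfolding norm_mult[of 2] norm_numeral by (intro norm_triangle_mono) (auto simp: norm_mult)
    also have "\<dots> = 24 * (x - a) / \<rho>\<^sup>2" by simp
    also have "\<dots> \<le> 24 * (b - a) / \<rho>\<^sup>2" using x by (intro divide_right_mono) auto
    finally show "norm ?g \<le> 24 * (b - a) / \<rho>\<^sup>2" .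
  qed (simp add: exponent_0)
  moreover have "24 * (b - a) / \<rho>\<^sup>2 * (b - a) = 24 * (b - a)\<^sup>2 / \<rho>\<^sup>2"
    by (simp only: power2_eq_square mult.assoc times_divide_eq_left)
  ultimately have "norm (expectation (\<lambda>\<omega>. Z b \<omega> * Y b \<omega> * (Z b \<omega> * Y b \<omega>))) \<le> 24 * (b - a)\<^sup>2 / \<rho>\<^sup>2"
    unfolding Z0 by (simp only: wave_0 mult_zero_left mult_zero_right mult_1_right Bochner_Integration.integral_zero diff_zero)
  also have "(\<lambda>\<omega>. Z b \<omega> * Y b \<omega> * (Z b \<omega> * Y b \<omega>)) = (\<lambda>\<omega>. of_real ((norm (occ \<theta> a b \<omega>)) ^ 4))"
    unfolding ZY by (simp add: Z_def power4_eq_xxxx power2_eq_square mult.assoc)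
  finally show "expectation (\<lambda>\<omega>. (norm (occ \<theta> a b \<omega>)) ^ 4) \<le> 24 * (b - a)\<^sup>2 / \<rho>\<^sup>2"
    unfolding integral_complex_of_real by simp
qed

section \<open>Characteristic functions over one interval\<close>

text \<open>By hypothesis \<open>real\<close> the exponent is purely imaginary, so K is bounded by 1
  whatever e and the length of the interval. Additivity of the occupation integrals makes K
  multiplicative in time, and Taylor expansion of the last factor gives the derivative.\<close>

lemma expands_exp:
  fixes e :: real
  assumes ab: "0 \<le> a" "a \<le> b" and J: "finite J"
    and real: "\<And>s t \<omega>. 0 \<le> s \<Longrightarrow> s \<le> t \<Longrightarrow> \<omega> \<in> space M \<Longrightarrow> (\<Sum>j\<in>J. \<alpha> j * occ (v j) s t \<omega>) \<in> \<real>"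
    and H: "H \<in> borel_measurable (past a)" and H1: "\<And>\<omega>. \<omega> \<in> space M \<Longrightarrow> norm (H \<omega>) \<le> 1"
  defines "K \<equiv> \<lambda>t \<omega>. H \<omega> * exp (\<i> * of_real e * (\<Sum>j\<in>J. \<alpha> j * occ (v j) a t \<omega>))"
  shows "expands a b J v K (\<lambda>j t \<omega>. \<i> * of_real e * \<alpha> j * K t \<omega>)"
    and "\<And>t \<omega>. a \<le> t \<Longrightarrow> \<omega> \<in> space M \<Longrightarrow> norm (K t \<omega>) \<le> 1"
proof -
  define A where "A s t \<omega> = (\<Sum>j\<in>J. \<alpha> j * occ (v j) s t \<omega>)" for s t \<omega>
  define S where "S = \<bar>e\<bar> * (\<Sum>j\<in>J. norm (\<alpha> j))"
  have S0: "S \<ge> 0" unfolding S_def by (intro mult_nonneg_nonneg sum_nonneg) auto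
  have Abd: "norm (\<i> * of_real e * A s t \<omega>) \<le> S * (t - s)" if "a \<le> s" "s \<le> t" "\<omega> \<in> space M" for s t \<omega>
  proof -
    have "norm (A s t \<omega>) \<le> (\<Sum>j\<in>J. norm (\<alpha> j) * (t - s))"
      unfolding A_def using norm_occ_le[of s t \<omega>] that ab
      by (intro sum_norm_le) (auto simp: norm_mult intro!: mult_left_mono)
    then have "\<bar>e\<bar> * norm (A s t \<omega>) \<le> \<bar>e\<bar> * (\<Sum>j\<in>J. norm (\<alpha> j) * (t - s))" by (rule mult_left_mono) simp
    then show ?thesis by (simp add: norm_mult S_def sum_distrib_right mult.assoc)
  qed
  have expA: "norm (exp (\<i> * of_real e * A s t \<omega>)) = 1" if "a \<le> s" "s \<le> t" "\<omega> \<in> space M" for s t \<omega>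
  proof -
    have "A s t \<omega> \<in> \<real>" unfolding A_def using real that ab by auto
    then obtain r where "A s t \<omega> = of_real r" by (auto elim: Reals_cases)
    then show ?thesis by simp
  qed
  have Asplit: "A a t \<omega> = A a s \<omega> + A s t \<omega>" if "a \<le> s" "s \<le> t" "\<omega> \<in> space M" for s t \<omega>
    unfolding A_def sum.distrib[symmetric] using occ_split[OF ab(1) that] by (simp add: distrib_left)
  have K: "K t \<omega> = H \<omega> * exp (\<i> * of_real e * A a t \<omega>)" for t \<omega> unfolding K_def A_def ..
  show K1: "norm (K t \<omega>) \<le> 1" if "a \<le> t" "\<omega> \<in> space M" for t \<omega>
    unfolding K norm_mult expA[OF order_refl that] mult_1_right by (rule H1[OF that(2)])
  have Kstep: "K t \<omega> = K s \<omega> * exp (\<i> * of_real e * A s t \<omega>)" if "a \<le> s" "s \<le> t" "\<omega> \<in> space M" for s t \<omega>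
    unfolding K Asplit[OF that] by (simp add: exp_add distrib_left)
  define l where "l = b - a"
  define Q where "Q = exp (S * l) * S"
  have Q0: "Q \<ge> 0" unfolding Q_def using S0 by simp
  have ebd: "exp (norm (\<i> * of_real e * A s t \<omega>)) \<le> exp (S * l)" if "a \<le> s" "s \<le> t" "t \<le> b" "\<omega> \<in> space M" for s t \<omega>
  proof -
    have "S * (t - s) \<le> S * l" using S0 that by (intro mult_left_mono) (auto simp: l_def)
    then show ?thesis using Abd[OF that(1,2,4)] by simp
  qed
  have lip: "adapted_lip a b K"
    unfolding adapted_lip_def
  proof (intro conjI ballI exI[of _ "1 + Q"] allI impI)
    show "K t \<in> borel_measurable (past t)" if "t \<in> {a..b}" for t
      unfolding K_def using past_mono[OF H, of t] occ_past[OF ab(1), of t t] that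
      by (intro borel_measurable_times borel_measurable_exp borel_measurable_const borel_measurable_sum) auto
    show "0 \<le> 1 + Q" using Q0 by simp
    show "norm (K t \<omega>) \<le> 1 + Q" if "t \<in> {a..b}" "\<omega> \<in> space M" for t \<omega>
      using K1[of t \<omega>] that Q0 by auto
    show "norm (K t \<omega> - K s \<omega>) \<le> (1 + Q) * (t - s)" if "\<omega> \<in> space M" "a \<le> s" "s \<le> t" "t \<le> b" for s t \<omega>
    proof -
      have "norm (K t \<omega> - K s \<omega>) = norm (K s \<omega>) * norm (exp (\<i> * of_real e * A s t \<omega>) - 1)"
        unfolding Kstep[OF that(2,3,1)] norm_mult[symmetric] by (simp add: algebra_simps)
      also have "\<dots> \<le> 1 * (exp (S * l) * (S * (t - s)))"
        using K1[of s \<omega>] that S0 ebd[OF that(2,3,4,1)] Abd[OF that(2,3,1)]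
        by (intro mult_mono order_trans[OF exp_minus_1_bound mult_mono]) auto
      also have "\<dots> \<le> (1 + Q) * (t - s)" using that by (simp add: Q_def algebra_simps)
      finally show ?thesis .
    qed
  qed
  show "expands a b J v K (\<lambda>j t \<omega>. \<i> * of_real e * \<alpha> j * K t \<omega>)"
    unfolding expands_def
  proof (intro conjI ballI lip adapted_lip_mult adapted_lip_const exI[of _ "exp (S * l) * S\<^sup>2"] allI impI)
    fix s t \<omega> assume w: "\<omega> \<in> space M" and st: "a \<le> s" "s \<le> t" "t \<le> b"
    have "(\<Sum>j\<in>J. \<i> * of_real e * \<alpha> j * K s \<omega> * occ (v j) s t \<omega>) = K s \<omega> * (\<i> * of_real e * A s t \<omega>)"
      unfolding A_def sum_distrib_left by (intro sum.cong) auto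
    then have "norm (K t \<omega> - K s \<omega> - (\<Sum>j\<in>J. \<i> * of_real e * \<alpha> j * K s \<omega> * occ (v j) s t \<omega>))
       = norm (K s \<omega>) * norm (exp (\<i> * of_real e * A s t \<omega>) - 1 - \<i> * of_real e * A s t \<omega>)"
      unfolding Kstep[OF st(1,2) w] norm_mult[symmetric] by (simp add: algebra_simps)
    also have "\<dots> \<le> 1 * (exp (S * l) * (S * (t - s))\<^sup>2)"
      using K1[of s \<omega>] w st S0 ebd[OF st w] Abd[OF st(1,2) w]
      by (intro mult_mono order_trans[OF exp_minus_1_minus_bound mult_mono] power_mono) auto
    finally show "norm (K t \<omega> - K s \<omega> - (\<Sum>j\<in>J. \<i> * of_real e * \<alpha> j * K s \<omega> * occ (v j) s t \<omega>)) \<le> exp (S * l) * S\<^sup>2 * (t - s)\<^sup>2"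
      by (simp add: power_mult_distrib)
  qed simp
qed

text \<open>The constant depends on the coefficients and frequencies only, not on e, the interval or
  H. Correctors contribute boundary errors of order e, and the equation an error of order e^3 per
  unit of time; over a time of order e^(-2) both are of order e.\<close>

theorem occupation_char_one_interval:
  fixes \<alpha> :: "'j \<Rightarrow> complex" and v :: "'j \<Rightarrow> real"
  assumes J: "finite J"
    and real: "\<And>s t \<omega>. 0 \<le> s \<Longrightarrow> s \<le> t \<Longrightarrow> \<omega> \<in> space M \<Longrightarrow> (\<Sum>j\<in>J. \<alpha> j * occ (v j) s t \<omega>) \<in> \<real>"
    and nz1: "\<And>j. j \<in> J \<Longrightarrow> \<psi> (v j) \<noteq> 0"
    and nz2: "\<And>j k. j \<in> J \<Longrightarrow> k \<in> J \<Longrightarrow> v k + v j \<noteq> 0 \<Longrightarrow> \<psi> (v k + v j) \<noteq> 0"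
    and \<kappa>: "\<kappa> = (\<Sum>(j, k)\<in>{p \<in> J \<times> J. v (snd p) + v (fst p) = 0}. \<alpha> j * \<alpha> k / \<psi> (v j))" "Re \<kappa> \<ge> 0"
  obtains C where "C \<ge> 0"
    "\<And>e a b (H :: 'a \<Rightarrow> complex). 0 \<le> e \<Longrightarrow> e \<le> 1 \<Longrightarrow> 0 \<le> a \<Longrightarrow> a \<le> b \<Longrightarrow> H \<in> borel_measurable (past a) \<Longrightarrow>
       (\<And>\<omega>. \<omega> \<in> space M \<Longrightarrow> norm (H \<omega>) \<le> 1) \<Longrightarrow>
       norm (expectation (\<lambda>\<omega>. H \<omega> * exp (\<i> * of_real e * (\<Sum>j\<in>J. \<alpha> j * occ (v j) a b \<omega>)))
          - exp (- (of_real (e\<^sup>2 * (b - a)) * \<kappa>)) * expectation H) \<le> C * (e + e ^ 3 * (b - a))"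
proof -
  define P where "P = {p \<in> J \<times> J. v (snd p) + v (fst p) \<noteq> 0}"
  define w where "w p = v (snd p) + v (fst p)" for p
  define c where "c p = \<alpha> (fst p) * \<alpha> (snd p) / \<psi> (v (fst p))" for p
  have finP: "finite P" unfolding P_def using J by simp
  have wP: "\<psi> (w p) \<noteq> 0" if "p \<in> P" for p using that nz2 unfolding P_def w_def by auto
  \<comment> \<open>Splits the double sum into the resonant pairs, where G is taken at frequency
    zero and cannot be corrected, and the set \<open>P\<close> of pairs that the second corrector
    removes.\<close>
  have \<kappa>P: "(\<Sum>p\<in>J \<times> J. c p * G (w p)) = \<kappa> * G 0 + (\<Sum>p\<in>P. c p * G (w p))" for G :: "real \<Rightarrow> complex"
  proof -
    define P' where "P' = {p \<in> J \<times> J. v (snd p) + v (fst p) = 0}"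
    have "(\<Sum>p\<in>J \<times> J. c p * G (w p)) = (\<Sum>p\<in>P' \<union> P. c p * G (w p))"
      by (rule sum.cong) (auto simp: P_def P'_def)
    also have "\<dots> = (\<Sum>p\<in>P'. c p * G (w p)) + (\<Sum>p\<in>P. c p * G (w p))"
      using J by (intro sum.union_disjoint) (auto simp: P_def P'_def)
    also have "(\<Sum>p\<in>P'. c p * G (w p)) = (\<Sum>p\<in>P'. c p * G 0)"
      by (rule sum.cong) (auto simp: P'_def w_def)
    also have "\<dots> = \<kappa> * G 0"
      unfolding \<kappa>(1) P'_def[symmetric] sum_distrib_right by (rule sum.cong) (auto simp: c_def case_prod_beta)
    finally show ?thesis .
  qed
  define S1 where "S1 = (\<Sum>j\<in>J. norm (\<alpha> j / \<psi> (v j)))"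
  define S2 where "S2 = (\<Sum>p\<in>P. norm (c p / \<psi> (w p)))"
  define S3 where "S3 = (\<Sum>j\<in>J. norm (\<alpha> j))"
  have S0: "S1 \<ge> 0" "S2 \<ge> 0" "S3 \<ge> 0" unfolding S1_def S2_def S3_def by (intro sum_nonneg; simp)+
  \<comment> \<open>The three summands come from replacing \<open>G 0\<close> by F in the drift,
    from the third-order remainder \<open>R\<close>, and from the correctors at the two ends of the
    interval.\<close>
  define C where "C = norm \<kappa> * (S1 + S2) + S2 * S3 + 2 * (S1 + S2)"
  show ?thesis
  proof (rule that[of C])
    show "C \<ge> 0" unfolding C_def using S0 by simp
    fix e a b :: real and H :: "'a \<Rightarrow> complex"
    assume e: "0 \<le> e" "e \<le> 1" and ab: "0 \<le> a" "a \<le> b" and H: "H \<in> borel_measurable (past a)"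
      and H1: "\<And>\<omega>. \<omega> \<in> space M \<Longrightarrow> norm (H \<omega>) \<le> 1"
    define K where "K = (\<lambda>t \<omega>. H \<omega> * exp (\<i> * of_real e * (\<Sum>j\<in>J. \<alpha> j * occ (v j) a t \<omega>)))"
    have E1: "expands a b J v K (\<lambda>j t \<omega>. \<i> * of_real e * \<alpha> j * K t \<omega>)"
      unfolding K_def by (rule expands_exp(1)[OF ab J real H H1])
    have E2: "norm (K t \<omega>) \<le> 1" if "a \<le> t" "\<omega> \<in> space M" for t \<omega>
      unfolding K_def by (rule expands_exp(2)[OF ab J real H H1 that])
    define G where "G u t = expectation (\<lambda>\<omega>. K t \<omega> * wave u t \<omega>)" for u t
    have Gd: "(G u has_vector_derivative (\<i> * of_real e * (\<Sum>j\<in>J. \<alpha> j * G (v j + u) t)) - \<psi> u * G u t) (at t within {a..b})"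
      if t: "t \<in> {a..b}" for u t
    proof -
      have "expectation (\<lambda>\<omega>. \<i> * of_real e * \<alpha> j * K t \<omega> * wave (v j + u) t \<omega>) = \<i> * of_real e * (\<alpha> j * G (v j + u) t)" for j
        unfolding G_def mult.assoc integral_mult_right_zero ..
      then show ?thesis
        using expands_derivative[OF ab(1) J E1 t, of u] unfolding G_def sum_distrib_left by simp
    qed
    have Gb: "norm (G u t) \<le> 1" if "a \<le> t" for u t
      unfolding G_def using E2[OF that] by (intro expectation_norm_le) (auto simp: norm_mult)
    have mg: "norm (z * G u t) \<le> norm z" if "a \<le> t" for z u t
      unfolding norm_mult by (rule mult_left_le[OF Gb[OF that] norm_ge_zero])
    \<comment> \<open>Division by \<psi> inverts the decay term of each G: the first sum cancels the
      term of order e in the derivative of \<open>G 0\<close> and creates a double sum of order e^2,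
      whose nonresonant part the second sum cancels.\<close>
    define F where "F t = G 0 t + \<i> * of_real e * (\<Sum>j\<in>J. \<alpha> j / \<psi> (v j) * G (v j) t)
        - of_real (e\<^sup>2) * (\<Sum>p\<in>P. c p / \<psi> (w p) * G (w p) t)" for t
    define R where "R t = (\<Sum>p\<in>P. c p / \<psi> (w p) * (\<Sum>l\<in>J. \<alpha> l * G (v l + w p) t))" for t
    define c0 where "c0 = of_real (e\<^sup>2) * \<kappa>"
    have Fd: "(F has_vector_derivative - (c0 * G 0 t) - \<i> * of_real (e ^ 3) * R t) (at t within {a..b})"
      if t: "t \<in> {a..b}" for t
    proof -
      have 1: "((\<lambda>t. \<Sum>j\<in>J. \<alpha> j / \<psi> (v j) * G (v j) t) has_vector_derivative
         \<i> * of_real e * (\<Sum>p\<in>J \<times> J. c p * G (w p) t) - (\<Sum>j\<in>J. \<alpha> j * G (v j) t)) (at t within {a..b})"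
      proof -
        have "((\<lambda>t. \<Sum>j\<in>J. \<alpha> j / \<psi> (v j) * G (v j) t) has_vector_derivative
          (\<Sum>j\<in>J. \<alpha> j / \<psi> (v j) * ((\<i> * of_real e * (\<Sum>k\<in>J. \<alpha> k * G (v k + v j) t)) - \<psi> (v j) * G (v j) t))) (at t within {a..b})"
          by (intro has_vector_derivative_sum has_vector_derivative_mult_right Gd t)
        also have "(\<Sum>j\<in>J. \<alpha> j / \<psi> (v j) * ((\<i> * of_real e * (\<Sum>k\<in>J. \<alpha> k * G (v k + v j) t)) - \<psi> (v j) * G (v j) t))
          = (\<Sum>j\<in>J. \<i> * of_real e * (\<Sum>k\<in>J. c (j, k) * G (w (j, k)) t) - \<alpha> j * G (v j) t)"
          using nz1 by (intro sum.cong) (simp_all add: right_diff_distrib sum_distrib_left c_def w_def mult_ac)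
        also have "\<dots> = \<i> * of_real e * (\<Sum>p\<in>J \<times> J. c p * G (w p) t) - (\<Sum>j\<in>J. \<alpha> j * G (v j) t)"
          unfolding sum_subtractf sum_distrib_left[symmetric] sum.cartesian_product by (simp add: case_prod_beta)
        finally show ?thesis .
      qed
      have 2: "((\<lambda>t. \<Sum>p\<in>P. c p / \<psi> (w p) * G (w p) t) has_vector_derivative
         \<i> * of_real e * R t - (\<Sum>p\<in>P. c p * G (w p) t)) (at t within {a..b})"
      proof -
        have "((\<lambda>t. \<Sum>p\<in>P. c p / \<psi> (w p) * G (w p) t) has_vector_derivative
          (\<Sum>p\<in>P. c p / \<psi> (w p) * ((\<i> * of_real e * (\<Sum>l\<in>J. \<alpha> l * G (v l + w p) t)) - \<psi> (w p) * G (w p) t))) (at t within {a..b})"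
          by (intro has_vector_derivative_sum has_vector_derivative_mult_right Gd t)
        also have "(\<Sum>p\<in>P. c p / \<psi> (w p) * ((\<i> * of_real e * (\<Sum>l\<in>J. \<alpha> l * G (v l + w p) t)) - \<psi> (w p) * G (w p) t))
          = (\<Sum>p\<in>P. \<i> * of_real e * (c p / \<psi> (w p) * (\<Sum>l\<in>J. \<alpha> l * G (v l + w p) t)) - c p * G (w p) t)"
          using wP by (intro sum.cong) (simp_all add: right_diff_distrib mult_ac)
        also have "\<dots> = \<i> * of_real e * R t - (\<Sum>p\<in>P. c p * G (w p) t)"
          unfolding sum_subtractf R_def sum_distrib_left[symmetric] ..
        finally show ?thesis .
      qed
      have "(F has_vector_derivative (\<i> * of_real e * (\<Sum>j\<in>J. \<alpha> j * G (v j + 0) t) - \<psi> 0 * G 0 t)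
         + \<i> * of_real e * (\<i> * of_real e * (\<Sum>p\<in>J \<times> J. c p * G (w p) t) - (\<Sum>j\<in>J. \<alpha> j * G (v j) t))
         - of_real (e\<^sup>2) * (\<i> * of_real e * R t - (\<Sum>p\<in>P. c p * G (w p) t))) (at t within {a..b})"
        unfolding F_def by (intro has_vector_derivative_add has_vector_derivative_diff has_vector_derivative_mult_right Gd t 1 2)
      also have "(\<i> * of_real e * (\<Sum>j\<in>J. \<alpha> j * G (v j + 0) t) - \<psi> 0 * G 0 t)
         + \<i> * of_real e * (\<i> * of_real e * (\<Sum>p\<in>J \<times> J. c p * G (w p) t) - (\<Sum>j\<in>J. \<alpha> j * G (v j) t))
         - of_real (e\<^sup>2) * (\<i> * of_real e * R t - (\<Sum>p\<in>P. c p * G (w p) t))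
         = - (c0 * G 0 t) - \<i> * of_real (e ^ 3) * R t"
        unfolding \<kappa>P[of "\<lambda>u. G u t"] exponent_0 c0_def
        by (simp add: algebra_simps power2_eq_square power3_eq_cube)
      finally show ?thesis .
    qed
    have FG: "norm (F t - G 0 t) \<le> e * (S1 + S2)" if t: "a \<le> t" for t
    proof -
      have "norm (\<Sum>j\<in>J. \<alpha> j / \<psi> (v j) * G (v j) t) \<le> S1" unfolding S1_def
        by (intro sum_norm_le mg t)
      then have 1: "norm (\<i> * of_real e * (\<Sum>j\<in>J. \<alpha> j / \<psi> (v j) * G (v j) t)) \<le> e * S1"
        using e by (simp add: norm_mult mult_left_mono)
      have "norm (\<Sum>p\<in>P. c p / \<psi> (w p) * G (w p) t) \<le> S2" unfolding S2_def
        by (intro sum_norm_le mg t)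
      moreover have "e\<^sup>2 \<le> e" using e by (simp add: power2_eq_square mult_left_le)
      ultimately have 2: "norm (of_real (e\<^sup>2) * (\<Sum>p\<in>P. c p / \<psi> (w p) * G (w p) t)) \<le> e * S2"
        unfolding norm_mult using e by (intro mult_mono) (auto simp: norm_power)
      have "F t - G 0 t = \<i> * of_real e * (\<Sum>j\<in>J. \<alpha> j / \<psi> (v j) * G (v j) t)
        - of_real (e\<^sup>2) * (\<Sum>p\<in>P. c p / \<psi> (w p) * G (w p) t)" unfolding F_def by simp
      then show ?thesis using norm_triangle_le_diff[OF add_mono[OF 1 2]] by (simp add: distrib_left)
    qed
    have Rb: "norm (R t) \<le> S2 * S3" if t: "a \<le> t" for t
      unfolding R_def S2_def sum_distrib_right
    proof (rule sum_norm_le)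
      fix p
      have "norm (\<Sum>l\<in>J. \<alpha> l * G (v l + w p) t) \<le> S3" unfolding S3_def
        by (intro sum_norm_le mg t)
      then show "norm (c p / \<psi> (w p) * (\<Sum>l\<in>J. \<alpha> l * G (v l + w p) t)) \<le> norm (c p / \<psi> (w p)) * S3"
        unfolding norm_mult by (rule mult_left_mono) simp
    qed
    have c0: "norm c0 = e\<^sup>2 * norm \<kappa>" "Re c0 \<ge> 0"
      unfolding c0_def using e \<kappa>(2) by (auto simp: norm_mult norm_power)
    \<comment> \<open>The drift acts on \<open>G 0\<close>. Writing it with F instead closes the
      equation, at the cost of c0 times the corrector, which is of order e^3.\<close>
    define g where "g t = c0 * (F t - G 0 t) - \<i> * of_real (e ^ 3) * R t" for t
    have gb: "norm (g t) \<le> e ^ 3 * (norm \<kappa> * (S1 + S2) + S2 * S3)" if t: "a \<le> t" for t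
    proof -
      have "norm (g t) \<le> norm (c0 * (F t - G 0 t)) + norm (\<i> * of_real (e ^ 3) * R t)"
        unfolding g_def by (rule norm_triangle_ineq4)
      also have "\<dots> \<le> e\<^sup>2 * norm \<kappa> * (e * (S1 + S2)) + e ^ 3 * (S2 * S3)"
        unfolding norm_mult c0(1) using FG[OF t] Rb[OF t] e
        by (intro add_mono mult_mono) (auto simp: norm_power norm_mult)
      also have "\<dots> = e ^ 3 * (norm \<kappa> * (S1 + S2) + S2 * S3)"
        by (simp add: algebra_simps power2_eq_square power3_eq_cube)
      finally show ?thesis .
    qed
    have tri: "norm (x - y + z) \<le> p + q + r" if "norm x \<le> p" "norm y \<le> q" "norm z \<le> r" for x y z :: complex and p q r
      using norm_triangle_ineq[of "x - y" z] norm_triangle_ineq4[of x y] that by linarith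
    have "norm (F b - exp (- (of_real (b - a) * c0)) * F a) \<le> e ^ 3 * (norm \<kappa> * (S1 + S2) + S2 * S3) * (b - a)"
    proof (rule linear_ode_bound_length[OF ab(2), where f=F and g=g])
      fix t assume t: "t \<in> {a..b}"
      show "(F has_vector_derivative g t - c0 * F t) (at t within {a..b})"
        using Fd[OF t] by (simp add: g_def algebra_simps)
      show "norm (g t) \<le> e ^ 3 * (norm \<kappa> * (S1 + S2) + S2 * S3)" using gb t by simp
    qed (rule c0(2))
    \<comment> \<open>Returning from F to \<open>G 0\<close> at the left end costs no more than the
      corrector itself, because the propagator has modulus at most 1 by
      \<open>Re c0 \<ge> 0\<close>.\<close>
    moreover have "norm (exp (- (of_real (b - a) * c0)) * (G 0 a - F a)) \<le> 1 * (e * (S1 + S2))"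
      unfolding norm_mult
    proof (rule mult_mono)
      show "norm (exp (- (of_real (b - a) * c0))) \<le> 1" using c0(2) ab by simp
      show "norm (G 0 a - F a) \<le> e * (S1 + S2)" using FG[of a] by (simp add: norm_minus_commute)
    qed auto
    moreover have "norm (G 0 b - F b) \<le> e * (S1 + S2)" using FG[OF ab(2)] by (simp add: norm_minus_commute)
    ultimately have "norm ((F b - exp (- (of_real (b - a) * c0)) * F a) - exp (- (of_real (b - a) * c0)) * (G 0 a - F a) + (G 0 b - F b))
        \<le> e ^ 3 * (norm \<kappa> * (S1 + S2) + S2 * S3) * (b - a) + 1 * (e * (S1 + S2)) + e * (S1 + S2)"
      by (rule tri)
    also have "(F b - exp (- (of_real (b - a) * c0)) * F a) - exp (- (of_real (b - a) * c0)) * (G 0 a - F a) + (G 0 b - F b)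
        = G 0 b - exp (- (of_real (b - a) * c0)) * G 0 a"
      by (simp add: algebra_simps)
    also have "G 0 b = expectation (\<lambda>\<omega>. H \<omega> * exp (\<i> * of_real e * (\<Sum>j\<in>J. \<alpha> j * occ (v j) a b \<omega>)))"
      unfolding G_def K_def by simp
    also have "G 0 a = expectation H" unfolding G_def K_def by simp
    also have "of_real (b - a) * c0 = of_real (e\<^sup>2 * (b - a)) * \<kappa>" unfolding c0_def by simp
    also have "e ^ 3 * (norm \<kappa> * (S1 + S2) + S2 * S3) * (b - a) + 1 * (e * (S1 + S2)) + e * (S1 + S2) \<le> C * (e + e ^ 3 * (b - a))"
    proof -
      have "0 \<le> e * (norm \<kappa> * (S1 + S2) + S2 * S3) + 2 * (S1 + S2) * (e ^ 3 * (b - a))"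
        using e S0 ab by simp
      also have "\<dots> = C * (e + e ^ 3 * (b - a)) - (e ^ 3 * (norm \<kappa> * (S1 + S2) + S2 * S3) * (b - a) + 1 * (e * (S1 + S2)) + e * (S1 + S2))"
        unfolding C_def by (simp add: algebra_simps)
      finally show ?thesis by simp
    qed
    finally show "norm (expectation (\<lambda>\<omega>. H \<omega> * exp (\<i> * of_real e * (\<Sum>j\<in>J. \<alpha> j * occ (v j) a b \<omega>)))
          - exp (- (of_real (e\<^sup>2 * (b - a)) * \<kappa>)) * expectation H) \<le> C * (e + e ^ 3 * (b - a))" .
  qed
qed

end

section \<open>The approximating processes\<close>

lemma of_real_inner_complex: "complex_of_real (z \<bullet> w) = (cnj z * w + z * cnj w) / 2"
  by (simp add: complex_eq_iff inner_complex_def)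

lemma norm_vec_fourth: "norm (x :: complex ^ 'm) ^ 4 \<le> real CARD('m) * (\<Sum>j\<in>UNIV. norm (x $ j) ^ 4)"
proof -
  have "norm x ^ 4 = ((norm x)\<^sup>2)\<^sup>2" by simp
  also have "(norm x)\<^sup>2 = (\<Sum>j\<in>UNIV. (norm (x $ j))\<^sup>2)" by (simp add: norm_vec_def L2_set_def sum_nonneg)
  also have "\<dots>\<^sup>2 \<le> (\<Sum>j\<in>UNIV. ((norm (x $ j))\<^sup>2)\<^sup>2) * real CARD('m)"
    by (rule sum_squared_le_sum_of_squares)
  finally show ?thesis by (simp add: mult.commute)
qed

lemma borel_measurable_vecI:
  fixes f :: "'a \<Rightarrow> complex ^ 'm"
  assumes "\<And>j. (\<lambda>\<omega>. f \<omega> $ j) \<in> borel_measurable N"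
  shows "f \<in> borel_measurable N"
  unfolding borel_measurable_euclidean_space[of f] inner_vec_def
  by (intro ballI borel_measurable_sum borel_measurable_inner assms borel_measurable_const)

section \<open>Increments of the approximating process as sums of waves\<close>

context pinned_levy_process
begin

abbreviation approx_incr :: "real ^ 'm \<Rightarrow> real \<Rightarrow> real \<Rightarrow> real \<Rightarrow> 'a \<Rightarrow> complex ^ 'm" where
  "approx_incr \<theta> e s t \<omega> \<equiv> approx_process X \<psi> \<theta> e t \<omega> - approx_process X \<psi> \<theta> e s \<omega>"

lemma approx_component:
  "approx_process X \<psi> \<theta> e t \<omega> $ j = of_real (e * levy_c \<psi> (\<theta> $ j)) * occ (\<theta> $ j) 0 (2 * t / e\<^sup>2) \<omega>"
  by (simp add: approx_process_def occ_def wave_def)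

lemma approx_increment:
  assumes "0 \<le> s" "s \<le> t" "\<omega> \<in> space M"
  shows "(approx_incr \<theta> e s t \<omega>) $ j
    = of_real (e * levy_c \<psi> (\<theta> $ j)) * occ (\<theta> $ j) (2 * s / e\<^sup>2) (2 * t / e\<^sup>2) \<omega>"
proof -
  have "occ (\<theta> $ j) 0 (2 * t / e\<^sup>2) \<omega> = occ (\<theta> $ j) 0 (2 * s / e\<^sup>2) \<omega> + occ (\<theta> $ j) (2 * s / e\<^sup>2) (2 * t / e\<^sup>2) \<omega>"
    using assms by (intro occ_split) (auto intro!: divide_right_mono)
  then show ?thesis by (simp add: approx_component algebra_simps)
qed

definition freq :: "real ^ 'm \<Rightarrow> 'm \<times> bool \<Rightarrow> real" where
  "freq \<theta> p = (if snd p then \<theta> $ fst p else - \<theta> $ fst p)"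

text \<open>From Re (cnj l z) = (cnj l z + l cnj z) / 2: the real inner product with l splits into
  waves of frequency \<theta>_j with coefficient cnj l_j and of frequency -\<theta>_j with
  coefficient l_j.\<close>

definition coef :: "real ^ 'm \<Rightarrow> complex ^ 'm \<Rightarrow> 'm \<times> bool \<Rightarrow> complex" where
  "coef \<theta> l p = of_real (levy_c \<psi> (\<theta> $ fst p)) / 2 * (if snd p then cnj (l $ fst p) else l $ fst p)"

lemma sum_coef_occ:
  "(\<Sum>p\<in>UNIV. coef \<theta> l p * occ (freq \<theta> p) s t \<omega>)
    = of_real (\<Sum>j\<in>UNIV. (l $ j) \<bullet> (of_real (levy_c \<psi> (\<theta> $ j)) * occ (\<theta> $ j) s t \<omega>))"
proof -
  have "(\<Sum>p\<in>UNIV. coef \<theta> l p * occ (freq \<theta> p) s t \<omega>) = (\<Sum>j\<in>UNIV. \<Sum>b\<in>UNIV. coef \<theta> l (j, b) * occ (freq \<theta> (j, b)) s t \<omega>)"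
    unfolding UNIV_Times_UNIV[symmetric] by (subst sum.cartesian_product) simp
  also have "\<dots> = (\<Sum>j\<in>UNIV. of_real ((l $ j) \<bullet> (of_real (levy_c \<psi> (\<theta> $ j)) * occ (\<theta> $ j) s t \<omega>)))"
  proof (rule sum.cong[OF refl])
    fix j
    show "(\<Sum>b\<in>UNIV. coef \<theta> l (j, b) * occ (freq \<theta> (j, b)) s t \<omega>) = of_real ((l $ j) \<bullet> (of_real (levy_c \<psi> (\<theta> $ j)) * occ (\<theta> $ j) s t \<omega>))"
      unfolding of_real_inner_complex by (simp add: UNIV_bool coef_def freq_def cnj_occ[symmetric] add_divide_distrib mult_ac)
  qed
  finally show ?thesis by simp
qed

lemma inner_approx_increment:
  assumes "0 \<le> s" "s \<le> t" "\<omega> \<in> space M"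
  shows "complex_of_real (l \<bullet> (approx_incr \<theta> e s t \<omega>))
    = of_real e * (\<Sum>p\<in>UNIV. coef \<theta> l p * occ (freq \<theta> p) (2 * s / e\<^sup>2) (2 * t / e\<^sup>2) \<omega>)"
proof -
  have "l \<bullet> (approx_incr \<theta> e s t \<omega>)
     = e * (\<Sum>j\<in>UNIV. (l $ j) \<bullet> (of_real (levy_c \<psi> (\<theta> $ j)) * occ (\<theta> $ j) (2 * s / e\<^sup>2) (2 * t / e\<^sup>2) \<omega>))"
    unfolding inner_vec_def approx_increment[OF assms] sum_distrib_left
    by (intro sum.cong) (auto simp: mult.assoc scaleR_conv_of_real[symmetric])
  then show ?thesis unfolding sum_coef_occ by simp
qed

section \<open>Nonresonant frequencies, limiting variance and uniform moments\<close>

context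
  fixes \<theta> :: "real ^ 'm"
  assumes nz: "\<And>j. Re (\<psi> (\<theta> $ j)) * Re (\<psi> (2 * \<theta> $ j)) \<noteq> 0"
    and nz2: "\<And>j h c1. j \<noteq> h \<Longrightarrow> c1 \<in> {-1, 1} \<Longrightarrow> Re (\<psi> (\<theta> $ j + c1 * \<theta> $ h)) \<noteq> 0"
begin

lemma Re_exponent_theta: "Re (\<psi> (\<theta> $ j)) > 0"
  using nz[of j] Re_exponent_nonneg[of "\<theta> $ j"] by (auto simp: less_le)

lemma exponent_freq: "\<psi> (freq \<theta> p) \<noteq> 0"
  using Re_exponent_theta[of "fst p"] by (auto simp: freq_def exponent_minus complex_eq_iff)

text \<open>Re \<psi> is even. Up to sign, a pair that is not conjugate adds up to 2 \<theta>_j if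
  the indices agree and to \<theta>_h +- \<theta>_j if they differ, which are the points covered by
  the hypotheses on \<theta>.\<close>

lemma exponent_freq_sum:
  assumes "\<not> (fst q = fst p \<and> snd q = (\<not> snd p))"
  shows "Re (\<psi> (freq \<theta> q + freq \<theta> p)) \<noteq> 0"
proof -
  have m: "Re (\<psi> (- u)) = Re (\<psi> u)" for u by (simp add: exponent_minus)
  obtain j b h d where pq: "p = (j, b)" "q = (h, d)" by force
  show ?thesis
  proof (cases "h = j")
    case True
    then have "d = b" using assms pq by auto
    then show ?thesis using nz[of j] m[of "2 * \<theta> $ j"] True pq by (auto simp: freq_def)
  next
    case False
    then have "Re (\<psi> (\<theta> $ h + \<theta> $ j)) \<noteq> 0" "Re (\<psi> (\<theta> $ h - \<theta> $ j)) \<noteq> 0"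
      using nz2[OF False, of 1] nz2[OF False, of "-1"] by auto
    moreover have "freq \<theta> q + freq \<theta> p \<in> {\<theta> $ h + \<theta> $ j, - (\<theta> $ h + \<theta> $ j), \<theta> $ h - \<theta> $ j, - (\<theta> $ h - \<theta> $ j)}"
      by (auto simp: freq_def pq)
    ultimately show ?thesis by (auto simp only: insert_iff empty_iff m)
  qed
qed

text \<open>An accidental resonance such as \<theta>_h = -\<theta>_j would produce the value \<psi>
  0 = 0 at a sum where Re \<psi> is nonzero.\<close>

lemma freq_sum_zero_iff: "freq \<theta> q + freq \<theta> p = 0 \<longleftrightarrow> fst q = fst p \<and> snd q = (\<not> snd p)"
proof
  assume "freq \<theta> q + freq \<theta> p = 0"
  then have "Re (\<psi> (freq \<theta> q + freq \<theta> p)) = 0" by (simp add: exponent_0)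
  then show "fst q = fst p \<and> snd q = (\<not> snd p)" using exponent_freq_sum[of q p] by blast
qed (auto simp: freq_def)

text \<open>The only resonant partner of (j, b) is (j, not b), so component j contributes |l_j|^2 /
  4 times c^2 (1/\<psi> + 1/cnj \<psi>). That last product is c^2 * 2 Re \<psi> / |\<psi>|^2 = 1 by
  the choice of \<open>levy_c\<close>.\<close>

lemma coef_variance:
  "(\<Sum>(p, q)\<in>{r \<in> UNIV \<times> UNIV. freq \<theta> (snd r) + freq \<theta> (fst r) = 0}. coef \<theta> l p * coef \<theta> l q / \<psi> (freq \<theta> p))
    = of_real ((norm l)\<^sup>2 / 4)"
proof -
  let ?f = "\<lambda>p::'m \<times> bool. (p, (fst p, \<not> snd p))"
  have eq: "{r \<in> UNIV \<times> UNIV. freq \<theta> (snd r) + freq \<theta> (fst r) = 0} = ?f ` UNIV"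
    unfolding freq_sum_zero_iff by (auto simp: image_iff prod_eq_iff)
  have "inj ?f" by (rule injI) auto
  then have "(\<Sum>(p, q)\<in>?f ` UNIV. coef \<theta> l p * coef \<theta> l q / \<psi> (freq \<theta> p))
      = (\<Sum>p\<in>UNIV. coef \<theta> l p * coef \<theta> l (fst p, \<not> snd p) / \<psi> (freq \<theta> p))"
    by (subst sum.reindex) auto
  also have "\<dots> = (\<Sum>j\<in>UNIV. \<Sum>b\<in>UNIV. coef \<theta> l (j, b) * coef \<theta> l (j, \<not> b) / \<psi> (freq \<theta> (j, b)))"
    unfolding UNIV_Times_UNIV[symmetric] by (subst sum.cartesian_product) (simp add: case_prod_beta)
  also have "\<dots> = (\<Sum>j\<in>UNIV. of_real ((norm (l $ j))\<^sup>2 / 4))"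
  proof (rule sum.cong[OF refl])
    fix j
    define z where "z = \<psi> (\<theta> $ j)"
    define c where "c = levy_c \<psi> (\<theta> $ j)"
    have z: "Re z > 0" unfolding z_def by (rule Re_exponent_theta)
    then have z0: "z \<noteq> 0" by auto
    have c2: "c\<^sup>2 = (norm z)\<^sup>2 / (2 * Re z)" unfolding c_def levy_c_def z_def[symmetric] using z by simp
    have "1 / z + 1 / cnj z = (z + cnj z) / (z * cnj z)" using z0 by (simp add: add_frac_eq)
    also have "\<dots> = of_real (2 * Re z / (norm z)\<^sup>2)"
      unfolding complex_add_cnj complex_norm_square[symmetric] by simp
    finally have inv: "1 / z + 1 / cnj z = of_real (2 * Re z / (norm z)\<^sup>2)" .
    have cc: "c\<^sup>2 * (2 * Re z / (norm z)\<^sup>2) = 1" unfolding c2 using z z0 by simp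
    have "(\<Sum>b\<in>UNIV. coef \<theta> l (j, b) * coef \<theta> l (j, \<not> b) / \<psi> (freq \<theta> (j, b)))
       = (l $ j * cnj (l $ j)) / 4 * (of_real (c\<^sup>2) * (1 / z + 1 / cnj z))"
      by (simp add: UNIV_bool coef_def freq_def exponent_minus z_def[symmetric] c_def[symmetric] power2_eq_square algebra_simps)
    also have "\<dots> = (l $ j * cnj (l $ j)) / 4 * of_real (c\<^sup>2 * (2 * Re z / (norm z)\<^sup>2))"
      unfolding inv by simp
    also have "\<dots> = of_real ((norm (l $ j))\<^sup>2 / 4)"
      unfolding cc complex_norm_square[symmetric] by simp
    finally show "(\<Sum>b\<in>UNIV. coef \<theta> l (j, b) * coef \<theta> l (j, \<not> b) / \<psi> (freq \<theta> (j, b))) = of_real ((norm (l $ j))\<^sup>2 / 4)" .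
  qed
  also have "\<dots> = of_real ((norm l)\<^sup>2 / 4)"
    unfolding of_real_sum[symmetric] sum_divide_distrib[symmetric] by (simp add: norm_vec_def L2_set_def sum_nonneg)
  finally show ?thesis unfolding eq .
qed

text \<open>On the clock 2t/e^2 one has e^2 (b - a) = 2 (t - s). With \<kappa> = |l|^2 / 4 the decay
  factor becomes the Gaussian one for time t - s, and the error e + e^3 (b - a) becomes (1 + 2 (t -
  s)) e.\<close>

lemma approx_char_step:
  fixes l :: "complex ^ 'm"
  shows "\<exists>C\<ge>0. \<forall>e s t. \<forall>H :: 'a \<Rightarrow> complex. 0 < e \<longrightarrow> e \<le> 1 \<longrightarrow> 0 \<le> s \<longrightarrow> s \<le> t \<longrightarrow> H \<in> borel_measurable (past (2 * s / e\<^sup>2)) \<longrightarrow>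
       (\<forall>\<omega>\<in>space M. norm (H \<omega>) \<le> 1) \<longrightarrow>
       norm (expectation (\<lambda>\<omega>. H \<omega> * exp (\<i> * of_real (l \<bullet> (approx_incr \<theta> e s t \<omega>))))
          - of_real (exp (- ((t - s) * (norm l)\<^sup>2 / 2))) * expectation H) \<le> C * (1 + 2 * (t - s)) * e"
proof -
  obtain C where C: "C \<ge> 0"
    "\<And>e a b (H :: 'a \<Rightarrow> complex). 0 \<le> e \<Longrightarrow> e \<le> 1 \<Longrightarrow> 0 \<le> a \<Longrightarrow> a \<le> b \<Longrightarrow> H \<in> borel_measurable (past a) \<Longrightarrow>
       (\<And>\<omega>. \<omega> \<in> space M \<Longrightarrow> norm (H \<omega>) \<le> 1) \<Longrightarrow>
       norm (expectation (\<lambda>\<omega>. H \<omega> * exp (\<i> * of_real e * (\<Sum>p\<in>UNIV. coef \<theta> l p * occ (freq \<theta> p) a b \<omega>)))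
          - exp (- (of_real (e\<^sup>2 * (b - a)) * of_real ((norm l)\<^sup>2 / 4))) * expectation H) \<le> C * (e + e ^ 3 * (b - a))"
  proof (rule occupation_char_one_interval[where J="UNIV :: ('m \<times> bool) set" and \<alpha>="coef \<theta> l" and v="freq \<theta>", OF _ _ _ _ coef_variance[symmetric]])
    show "(\<Sum>p\<in>UNIV. coef \<theta> l p * occ (freq \<theta> p) s t \<omega>) \<in> \<real>" for s t \<omega>
      unfolding sum_coef_occ by simp
    show "\<psi> (freq \<theta> k + freq \<theta> j) \<noteq> 0" if "freq \<theta> k + freq \<theta> j \<noteq> 0" for j k
      using exponent_freq_sum[of k j] that unfolding freq_sum_zero_iff by auto
  qed (auto simp: exponent_freq)
  show ?thesis
  proof (intro exI[of _ C] conjI allI impI C(1))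
    fix e s t :: real and H :: "'a \<Rightarrow> complex"
    assume e: "0 < e" "e \<le> 1" and st: "0 \<le> s" "s \<le> t" and H: "H \<in> borel_measurable (past (2 * s / e\<^sup>2))"
       and H1: "\<forall>\<omega>\<in>space M. norm (H \<omega>) \<le> 1"
    define a where "a = 2 * s / e\<^sup>2"
    define b where "b = 2 * t / e\<^sup>2"
    have ab: "0 \<le> a" "a \<le> b" unfolding a_def b_def using st by (auto intro!: divide_right_mono)
    have ba: "e\<^sup>2 * (b - a) = 2 * (t - s)" unfolding a_def b_def using e by (simp add: field_simps)
    have 1: "expectation (\<lambda>\<omega>. H \<omega> * exp (\<i> * of_real (l \<bullet> (approx_incr \<theta> e s t \<omega>))))
      = expectation (\<lambda>\<omega>. H \<omega> * exp (\<i> * of_real e * (\<Sum>p\<in>UNIV. coef \<theta> l p * occ (freq \<theta> p) a b \<omega>)))"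
      by (rule Bochner_Integration.integral_cong[OF refl])
         (simp only: inner_approx_increment[OF st] a_def b_def mult.assoc)
    have 2: "exp (- (of_real (e\<^sup>2 * (b - a)) * of_real ((norm l)\<^sup>2 / 4))) = complex_of_real (exp (- ((t - s) * (norm l)\<^sup>2 / 2)))"
    proof -
      have "- (complex_of_real (e\<^sup>2 * (b - a)) * of_real ((norm l)\<^sup>2 / 4)) = of_real (- ((t - s) * (norm l)\<^sup>2 / 2))"
        unfolding ba of_real_mult[symmetric] of_real_minus[symmetric] by (rule arg_cong[where f=of_real]) simp
      then show ?thesis unfolding exp_of_real[symmetric] by (rule arg_cong)
    qed
    have 3: "C * (e + e ^ 3 * (b - a)) = C * (1 + 2 * (t - s)) * e"
    proof -
      have "e ^ 3 * (b - a) = e * (e\<^sup>2 * (b - a))" by (simp add: power2_eq_square power3_eq_cube)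
      then have "e + e ^ 3 * (b - a) = (1 + 2 * (t - s)) * e" unfolding ba by (simp add: algebra_simps)
      then show ?thesis by (simp only: mult.assoc)
    qed
    have "norm (expectation (\<lambda>\<omega>. H \<omega> * exp (\<i> * of_real e * (\<Sum>p\<in>UNIV. coef \<theta> l p * occ (freq \<theta> p) a b \<omega>)))
          - exp (- (of_real (e\<^sup>2 * (b - a)) * of_real ((norm l)\<^sup>2 / 4))) * expectation H) \<le> C * (e + e ^ 3 * (b - a))"
      using e H unfolding a_def[symmetric] by (intro C(2) ab H1[rule_format]) auto
    then show "norm (expectation (\<lambda>\<omega>. H \<omega> * exp (\<i> * of_real (l \<bullet> (approx_incr \<theta> e s t \<omega>))))
          - of_real (exp (- ((t - s) * (norm l)\<^sup>2 / 2))) * expectation H) \<le> C * (1 + 2 * (t - s)) * e"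
      unfolding 1 2 3 .
  qed
qed

lemma approx_past:
  assumes "0 \<le> s" "s \<le> t"
  shows "approx_process X \<psi> \<theta> e s \<in> borel_measurable (past (2 * t / e\<^sup>2))"
proof (rule borel_measurable_vecI)
  fix j
  have "occ (\<theta> $ j) 0 (2 * s / e\<^sup>2) \<in> borel_measurable (past (2 * t / e\<^sup>2))"
    using assms by (intro occ_past) (auto intro!: divide_right_mono)
  then show "(\<lambda>\<omega>. approx_process X \<psi> \<theta> e s \<omega> $ j) \<in> borel_measurable (past (2 * t / e\<^sup>2))"
    unfolding approx_component by measurable
qed

text \<open>Induction on the number of increments: the product of the earlier exponentials is in the
  past of the last interval and serves as H. The Gaussian factor is at most 1, so errors simply
  add.\<close>

lemma approx_char_increments_bound:
  fixes l :: "nat \<Rightarrow> complex ^ 'm" and \<tau> :: "nat \<Rightarrow> real"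
  assumes \<tau>: "0 \<le> \<tau> 0" "\<And>k. \<tau> k \<le> \<tau> (Suc k)"
  shows "\<exists>C\<ge>0. \<forall>e. 0 < e \<longrightarrow> e \<le> 1 \<longrightarrow>
     norm (expectation (\<lambda>\<omega>. exp (\<i> * of_real (\<Sum>k<n. l k \<bullet> (approx_incr \<theta> e (\<tau> k) (\<tau> (Suc k)) \<omega>))))
       - of_real (exp (- (\<Sum>k<n. (\<tau> (Suc k) - \<tau> k) * (norm (l k))\<^sup>2 / 2)))) \<le> C * e"
proof (induction n)
  case 0
  show ?case by (intro exI[of _ 0]) (auto simp: prob_space)
next
  case (Suc n)
  define H where "H e \<omega> = exp (\<i> * complex_of_real (\<Sum>k<n. l k \<bullet> (approx_incr \<theta> e (\<tau> k) (\<tau> (Suc k)) \<omega>)))" for e \<omega>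
  define q where "q m = exp (- (\<Sum>k<m. (\<tau> (Suc k) - \<tau> k) * (norm (l k))\<^sup>2 / 2))" for m
  define r where "r = exp (- ((\<tau> (Suc n) - \<tau> n) * (norm (l n))\<^sup>2 / 2))"
  have \<tau>m: "mono \<tau>" using \<tau>(2) by (rule mono_iff_le_Suc[THEN iffD2, rule_format])
  have \<tau>0: "0 \<le> \<tau> k" for k using monoD[OF \<tau>m, of 0 k] \<tau>(1) by simp
  from Suc obtain C1 where C1: "C1 \<ge> 0" "\<And>e. 0 < e \<Longrightarrow> e \<le> 1 \<Longrightarrow> norm (expectation (H e) - of_real (q n)) \<le> C1 * e"
    unfolding H_def q_def by blast
  from approx_char_step[of "l n"] obtain C2 where C2: "C2 \<ge> 0" "\<forall>e s t. \<forall>H :: 'a \<Rightarrow> complex. 0 < e \<longrightarrow> e \<le> 1 \<longrightarrow> 0 \<le> s \<longrightarrow> s \<le> t \<longrightarrow> H \<in> borel_measurable (past (2 * s / e\<^sup>2)) \<longrightarrow>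
       (\<forall>\<omega>\<in>space M. norm (H \<omega>) \<le> 1) \<longrightarrow>
       norm (expectation (\<lambda>\<omega>. H \<omega> * exp (\<i> * of_real (l n \<bullet> (approx_incr \<theta> e s t \<omega>))))
          - of_real (exp (- ((t - s) * (norm (l n))\<^sup>2 / 2))) * expectation H) \<le> C2 * (1 + 2 * (t - s)) * e"
    by (elim exE conjE)
  have HS: "exp (\<i> * complex_of_real (\<Sum>k<Suc n. l k \<bullet> (approx_incr \<theta> e (\<tau> k) (\<tau> (Suc k)) \<omega>)))
     = H e \<omega> * exp (\<i> * of_real (l n \<bullet> (approx_incr \<theta> e (\<tau> n) (\<tau> (Suc n)) \<omega>)))" for e \<omega>
    unfolding H_def exp_add[symmetric] distrib_left[symmetric] of_real_add[symmetric] sum.lessThan_Suc ..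
  have qS: "q (Suc n) = r * q n" unfolding q_def r_def exp_add[symmetric] by simp
  define D where "D = C2 * (1 + 2 * (\<tau> (Suc n) - \<tau> n)) + C1"
  show ?case
  proof (intro exI[of _ D] conjI allI impI)
    show "0 \<le> D" unfolding D_def using C1 C2 \<tau>(2)[of n] by simp
    fix e :: real assume e: "0 < e" "e \<le> 1"
    have "(\<lambda>\<omega>. \<Sum>k<n. l k \<bullet> (approx_incr \<theta> e (\<tau> k) (\<tau> (Suc k)) \<omega>)) \<in> borel_measurable (past (2 * \<tau> n / e\<^sup>2))"
      using \<tau>0 by (intro borel_measurable_sum borel_measurable_inner borel_measurable_diff borel_measurable_const approx_past)
        (auto intro: monoD[OF \<tau>m])
    then have "H e \<in> borel_measurable (past (2 * \<tau> n / e\<^sup>2))"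
      unfolding H_def[abs_def] by measurable
    from C2(2)[rule_format, OF e \<tau>0 \<tau>(2) this] have
      1: "norm (expectation (\<lambda>\<omega>. H e \<omega> * exp (\<i> * of_real (l n \<bullet> (approx_incr \<theta> e (\<tau> n) (\<tau> (Suc n)) \<omega>))))
          - of_real r * expectation (H e)) \<le> C2 * (1 + 2 * (\<tau> (Suc n) - \<tau> n)) * e"
      unfolding r_def by (simp add: H_def)
    have "norm (of_real r * (expectation (H e) - of_real (q n))) \<le> 1 * (C1 * e)"
      unfolding norm_mult using C1(2)[OF e] \<tau>(2)[of n] by (intro mult_mono) (auto simp: r_def)
    from norm_triangle_mono[OF 1 this]
    show "norm (expectation (\<lambda>\<omega>. exp (\<i> * of_real (\<Sum>k<Suc n. l k \<bullet> (approx_incr \<theta> e (\<tau> k) (\<tau> (Suc k)) \<omega>))))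
       - of_real (exp (- (\<Sum>k<Suc n. (\<tau> (Suc k) - \<tau> k) * (norm (l k))\<^sup>2 / 2)))) \<le> D * e"
      unfolding HS q_def[symmetric] qS by (simp add: D_def algebra_simps)
  qed
qed

theorem approx_char_increments:
  fixes l :: "nat \<Rightarrow> complex ^ 'm" and \<tau> :: "nat \<Rightarrow> real"
  assumes \<tau>: "0 \<le> \<tau> 0" "\<And>k. \<tau> k \<le> \<tau> (Suc k)"
  shows "((\<lambda>e. expectation (\<lambda>\<omega>. exp (\<i> * of_real (\<Sum>k<n. l k \<bullet> (approx_incr \<theta> e (\<tau> k) (\<tau> (Suc k)) \<omega>)))))
     \<longlongrightarrow> of_real (exp (- (\<Sum>k<n. (\<tau> (Suc k) - \<tau> k) * (norm (l k))\<^sup>2 / 2)))) (at_right 0)"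
proof -
  obtain C where C: "C \<ge> 0" "\<And>e. 0 < e \<Longrightarrow> e \<le> 1 \<Longrightarrow>
     norm (expectation (\<lambda>\<omega>. exp (\<i> * of_real (\<Sum>k<n. l k \<bullet> (approx_incr \<theta> e (\<tau> k) (\<tau> (Suc k)) \<omega>))))
       - of_real (exp (- (\<Sum>k<n. (\<tau> (Suc k) - \<tau> k) * (norm (l k))\<^sup>2 / 2)))) \<le> C * e"
    using approx_char_increments_bound[where n=n and l=l and \<tau>=\<tau>, OF \<tau>] by blast
  have "eventually (\<lambda>e::real. e \<in> {0<..<1}) (at_right 0)"
    by (rule eventually_at_right_real) simp
  then have ev: "eventually (\<lambda>e. norm (expectation (\<lambda>\<omega>. exp (\<i> * of_real (\<Sum>k<n. l k \<bullet> (approx_incr \<theta> e (\<tau> k) (\<tau> (Suc k)) \<omega>))))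
       - of_real (exp (- (\<Sum>k<n. (\<tau> (Suc k) - \<tau> k) * (norm (l k))\<^sup>2 / 2)))) \<le> C * e) (at_right 0)"
    by (rule eventually_mono) (use C(2) in auto)
  have "((\<lambda>e. C * e) \<longlongrightarrow> C * 0) (at_right 0)"
    by (intro tendsto_intros)
  then have "((\<lambda>e. expectation (\<lambda>\<omega>. exp (\<i> * of_real (\<Sum>k<n. l k \<bullet> (approx_incr \<theta> e (\<tau> k) (\<tau> (Suc k)) \<omega>))))
       - of_real (exp (- (\<Sum>k<n. (\<tau> (Suc k) - \<tau> k) * (norm (l k))\<^sup>2 / 2)))) \<longlongrightarrow> 0) (at_right 0)"
    by (intro Lim_null_comparison[OF ev]) simp
  then show ?thesis by (subst LIM_zero_iff[symmetric])
qed

text \<open>Brownian scaling: e^4 from the prefactor cancels the square of the time 2 (t - s) / e^2,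
  so the bound does not depend on e.\<close>

theorem approx_fourth_moment:
  obtains C where "C \<ge> 0" "\<And>e s t. 0 < e \<Longrightarrow> 0 \<le> s \<Longrightarrow> s \<le> t \<Longrightarrow>
     expectation (\<lambda>\<omega>. norm (approx_incr \<theta> e s t \<omega>) ^ 4) \<le> C * (t - s)\<^sup>2"
proof -
  \<comment> \<open>96 is 24 from the occupation integral times 2^2 from the clock.\<close>
  define c where "c j = 96 * levy_c \<psi> (\<theta> $ j) ^ 4 / (Re (\<psi> (\<theta> $ j)))\<^sup>2" for j
  define C where "C = real CARD('m) * (\<Sum>j\<in>UNIV. c j)"
  show ?thesis
  proof (rule that[of C])
    have "c j \<ge> 0" for j unfolding c_def by simp
    then show "C \<ge> 0" unfolding C_def by (intro mult_nonneg_nonneg sum_nonneg) auto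
    fix e s t :: real assume e: "0 < e" and st: "0 \<le> s" "s \<le> t"
    define a where "a = 2 * s / e\<^sup>2"
    define b where "b = 2 * t / e\<^sup>2"
    have ab: "0 \<le> a" "a \<le> b" unfolding a_def b_def using st by (auto intro!: divide_right_mono)
    have ba: "b - a = 2 * (t - s) / e\<^sup>2" unfolding a_def b_def by (simp add: diff_divide_distrib)
    have om: "occ (\<theta> $ j) a b \<in> borel_measurable M" for j
      by (rule past_M[OF occ_past[OF ab(1) order_refl]])
    have oi: "integrable M (\<lambda>\<omega>. norm (occ (\<theta> $ j) a b \<omega>) ^ 4)" for j
      using om norm_occ_le[OF ab] ab
      by (intro integrable_const_bound[of _ "(b - a) ^ 4"]) (auto intro!: AE_I2 power_mono)
    have comp: "norm ((approx_incr \<theta> e s t \<omega>) $ j) ^ 4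
        = (e * levy_c \<psi> (\<theta> $ j)) ^ 4 * norm (occ (\<theta> $ j) a b \<omega>) ^ 4" if "\<omega> \<in> space M" for \<omega> j
      unfolding approx_increment[OF st that] a_def[symmetric] b_def[symmetric]
      by (simp add: norm_mult power_mult_distrib)
    have "expectation (\<lambda>\<omega>. norm (approx_incr \<theta> e s t \<omega>) ^ 4)
       \<le> expectation (\<lambda>\<omega>. real CARD('m) * (\<Sum>j\<in>UNIV. (e * levy_c \<psi> (\<theta> $ j)) ^ 4 * norm (occ (\<theta> $ j) a b \<omega>) ^ 4))"
    proof (rule integral_mono')
      show "integrable M (\<lambda>\<omega>. real CARD('m) * (\<Sum>j\<in>UNIV. (e * levy_c \<psi> (\<theta> $ j)) ^ 4 * norm (occ (\<theta> $ j) a b \<omega>) ^ 4))"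
        by (rule integrable_mult_right, rule Bochner_Integration.integrable_sum, rule integrable_mult_right, rule oi)
      show "norm (approx_incr \<theta> e s t \<omega>) ^ 4
          \<le> real CARD('m) * (\<Sum>j\<in>UNIV. (e * levy_c \<psi> (\<theta> $ j)) ^ 4 * norm (occ (\<theta> $ j) a b \<omega>) ^ 4)" if "\<omega> \<in> space M" for \<omega>
        using norm_vec_fourth[of "approx_incr \<theta> e s t \<omega>"] unfolding comp[OF that] .
      show "0 \<le> real CARD('m) * (\<Sum>j\<in>UNIV. (e * levy_c \<psi> (\<theta> $ j)) ^ 4 * norm (occ (\<theta> $ j) a b \<omega>) ^ 4)" for \<omega>
        by (intro mult_nonneg_nonneg sum_nonneg) auto
    qed
    also have "\<dots> = real CARD('m) * (\<Sum>j\<in>UNIV. (e * levy_c \<psi> (\<theta> $ j)) ^ 4 * expectation (\<lambda>\<omega>. norm (occ (\<theta> $ j) a b \<omega>) ^ 4))"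
      using oi by (simp add: Bochner_Integration.integral_sum)
    also have "\<dots> \<le> real CARD('m) * (\<Sum>j\<in>UNIV. (e * levy_c \<psi> (\<theta> $ j)) ^ 4 * (24 * (b - a)\<^sup>2 / (Re (\<psi> (\<theta> $ j)))\<^sup>2))"
      using occ_fourth_moment[OF ab refl Re_exponent_theta]
      by (intro mult_left_mono sum_mono) auto
    also have "\<dots> = C * (t - s)\<^sup>2"
    proof -
      have alg: "(e * k) ^ 4 * (24 * (2 * x / e\<^sup>2)\<^sup>2 / r\<^sup>2) = 96 * k ^ 4 / r\<^sup>2 * x\<^sup>2" for k x r
        using e by (simp add: power_mult_distrib power_divide power_mult[symmetric])
      show ?thesis unfolding C_def c_def ba alg by (simp only: mult.assoc sum_distrib_right)
    qed
    finally show "expectation (\<lambda>\<omega>. norm (approx_incr \<theta> e s t \<omega>) ^ 4) \<le> C * (t - s)\<^sup>2" .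
  qed
qed

end

end

section \<open>Dyadic interpolation in the path space\<close>

abbreviation paths :: "real \<Rightarrow> (real \<Rightarrow> complex ^ 'm) metric" where
  "paths T \<equiv> cfunspace (top_of_set {0..T}) euclidean_metric"

definition grid :: "real \<Rightarrow> nat \<Rightarrow> nat \<Rightarrow> real" where
  "grid T n k = real k * (T / 2 ^ n)"

text \<open>Zero before cell k, linear across it and one afterwards. With these profiles a polygon
  is linear in its increments, and changing them moves it by at most the sum of the changes.\<close>

definition ramp :: "real \<Rightarrow> nat \<Rightarrow> nat \<Rightarrow> real \<Rightarrow> real" where
  "ramp T n k t = max 0 (min 1 (t * 2 ^ n / T - real k))"

text \<open>The coefficient with index \<open>2 ^ n\<close> is the initial value of the path.\<close>

definition polygon :: "real \<Rightarrow> nat \<Rightarrow> (nat \<Rightarrow> complex ^ 'm) \<Rightarrow> real \<Rightarrow> complex ^ 'm" where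
  "polygon T n d t = d (2 ^ n) + (\<Sum>k<2 ^ n. ramp T n k t *\<^sub>R d k)"

definition increments :: "real \<Rightarrow> nat \<Rightarrow> (real \<Rightarrow> complex ^ 'm) \<Rightarrow> nat \<Rightarrow> complex ^ 'm" where
  "increments T n y k = (if k < 2 ^ n then y (grid T n (Suc k)) - y (grid T n k) else y 0)"

lemma mspace_paths: "mspace (paths T) = {f. f \<in> extensional {0..T} \<and> continuous_on {0..T} f}"
  by (subst compactin_mspace_cfunspace) (auto simp: compactin_subtopology)

lemma restrict_in_paths:
  assumes "continuous_on {0..T} y"
  shows "(\<lambda>t\<in>{0..T}. y t) \<in> mspace (paths T)"
proof -
  have "continuous_on {0..T} (\<lambda>t\<in>{0..T}. y t)" by (rule continuous_on_eq[OF assms]) simp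
  then show ?thesis unfolding mspace_paths by (intro CollectI conjI restrict_extensional)
qed

lemma paths_dist_le:
  assumes "0 \<le> B" "\<And>t. t \<in> {0..T} \<Longrightarrow> norm (y t - z t) \<le> B"
  shows "mdist (paths T) (\<lambda>t\<in>{0..T}. y t) (\<lambda>t\<in>{0..T}. z t) \<le> B"
  using assms by (intro mdist_cfunspace_le) (auto simp: dist_norm)

lemma continuous_polygon: "continuous_on S (polygon T n d)"
  unfolding polygon_def[abs_def] ramp_def divide_inverse by (intro continuous_intros)

lemma grid_bounds: "T > 0 \<Longrightarrow> k \<le> 2 ^ n \<Longrightarrow> grid T n k \<in> {0..T}"
proof -
  assume T: "T > 0" and k: "k \<le> 2 ^ n"
  have "real k \<le> 2 ^ n" using k by (metis of_nat_le_iff of_nat_numeral of_nat_power)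
  then have "real k * T \<le> 2 ^ n * T" using T by (intro mult_right_mono) auto
  then show ?thesis using T by (simp add: grid_def field_simps)
qed

text \<open>Inside cell k the earlier ramps equal 1, the k-th equals s and the later ones 0, so the
  sum telescopes.\<close>

lemma polygon_increments_eq:
  assumes T: "T > 0" and k: "k < 2 ^ n" and s: "0 \<le> s" "s \<le> 1"
  shows "polygon T n (increments T n y) ((real k + s) * (T / 2 ^ n)) = y (grid T n k) + s *\<^sub>R (y (grid T n (Suc k)) - y (grid T n k))"
proof -
  define t where "t = (real k + s) * (T / 2 ^ n)"
  have tt: "t * 2 ^ n / T = real k + s" using T by (simp add: t_def)
  have r: "ramp T n j t = (if j < k then 1 else if j = k then s else 0)" for j
  proof -
    consider "j < k" | "j = k" | "k < j" by linarith
    then show ?thesis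
    proof cases
      case 1
      then have "real j + 1 \<le> real k" by linarith
      then show ?thesis unfolding ramp_def tt using 1 s by simp
    next
      case 2
      then show ?thesis unfolding ramp_def tt using s by simp
    next
      case 3
      then have "real k + 1 \<le> real j" by linarith
      then show ?thesis unfolding ramp_def tt using 3 s by simp
    qed
  qed
  let ?d = "\<lambda>j. y (grid T n (Suc j)) - y (grid T n j)"
  have "(\<Sum>j<2 ^ n. ramp T n j t *\<^sub>R increments T n y j) = (\<Sum>j<Suc k. ramp T n j t *\<^sub>R increments T n y j)"
    using k by (intro sum.mono_neutral_right) (auto simp: r)
  also have "\<dots> = (\<Sum>j<k. ?d j) + s *\<^sub>R ?d k"
    using k by (auto simp: r increments_def intro!: sum.cong)
  also have "(\<Sum>j<k. ?d j) = y (grid T n k) - y (grid T n 0)" by (rule sum_lessThan_telescope)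
  finally show ?thesis unfolding t_def[symmetric] by (simp add: polygon_def increments_def grid_def)
qed

lemma grid_cell:
  assumes T: "T > 0" and t: "t \<in> {0..T}"
  obtains k s where "k < 2 ^ n" "0 \<le> s" "s \<le> 1" "t = (real k + s) * (T / 2 ^ n)"
proof (cases "t = T")
  case True
  have "real (2 ^ n - 1 :: nat) + 1 = 2 ^ n" by (simp add: of_nat_diff)
  then show ?thesis using T by (intro that[of "2 ^ n - 1" 1]) (auto simp: True)
next
  case False
  define r where "r = t * 2 ^ n / T"
  have r: "0 \<le> r" "r < 2 ^ n" using t T False by (auto simp: r_def field_simps)
  define k where "k = nat \<lfloor>r\<rfloor>"
  have k: "real k \<le> r" "r < real k + 1" using r unfolding k_def by linarith+
  have "real k < 2 ^ n" using k r by linarith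
  then have "k < 2 ^ n" by (metis of_nat_less_iff of_nat_numeral of_nat_power)
  moreover have "t = (real k + (r - real k)) * (T / 2 ^ n)" using T by (simp add: r_def)
  ultimately show ?thesis using k by (intro that[of k "r - real k"]) auto
qed

text \<open>Both polygons agree at the ends of a coarse cell. On its two halves they differ by s (d0
  - d1) and (1 - s) (d0 - d1), with a factor at most 1/2, so one fine increment bounds the
  difference.\<close>

lemma polygon_refine:
  assumes T: "T > 0" and t: "t \<in> {0..T}" and b: "\<And>k. k < 2 ^ Suc n \<Longrightarrow> norm (increments T (Suc n) y k) \<le> b"
  shows "norm (polygon T (Suc n) (increments T (Suc n) y) t - polygon T n (increments T n y) t) \<le> b"
proof -
  obtain k s where k: "k < 2 ^ n" and s: "0 \<le> s" "s \<le> 1" and tt: "t = (real k + s) * (T / 2 ^ n)"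
    using grid_cell[OF T t] by metis
  define d0 where "d0 = increments T (Suc n) y (2 * k)"
  define d1 where "d1 = increments T (Suc n) y (2 * k + 1)"
  have k2: "2 * k < 2 ^ Suc n" "2 * k + 1 < 2 ^ Suc n" using k by auto
  have g: "grid T (Suc n) (2 * j) = grid T n j" for j by (simp add: grid_def)
  have g0: "grid T (Suc n) (2 * k) = grid T n k" "grid T (Suc n) (Suc (Suc (2 * k))) = grid T n (Suc k)"
    using g[of k] g[of "Suc k"] by simp_all
  have d: "d0 = y (grid T (Suc n) (Suc (2 * k))) - y (grid T n k)" "d1 = y (grid T n (Suc k)) - y (grid T (Suc n) (Suc (2 * k)))"
    unfolding d0_def d1_def increments_def using k2 g0 by simp_all
  have bd: "norm d0 \<le> b" "norm d1 \<le> b" unfolding d0_def d1_def using b k2 by auto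
  have b0: "0 \<le> b" using bd(1) norm_ge_zero order_trans by blast
  have P: "polygon T n (increments T n y) t = y (grid T n k) + s *\<^sub>R (d0 + d1)"
    unfolding tt polygon_increments_eq[OF T k s] d by simp
  show ?thesis
  proof (cases "s \<le> 1/2")
    case True
    have t2: "t = (real (2 * k) + 2 * s) * (T / 2 ^ Suc n)" unfolding tt by (simp add: field_simps)
    have "polygon T (Suc n) (increments T (Suc n) y) t = y (grid T n k) + (2 * s) *\<^sub>R d0"
      unfolding t2 using polygon_increments_eq[OF T k2(1), of "2 * s" y] True s unfolding g0 d by simp
    then have "polygon T (Suc n) (increments T (Suc n) y) t - polygon T n (increments T n y) t = s *\<^sub>R d0 - s *\<^sub>R d1"
      unfolding P by (simp add: algebra_simps scaleR_2[symmetric])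
    also have "norm \<dots> \<le> s * b + s * b"
      using bd s by (intro norm_triangle_le_diff add_mono) (auto intro: mult_left_mono)
    also have "\<dots> \<le> b" using True b0 mult_right_mono[of "2 * s" 1 b] by (auto simp: algebra_simps)
    finally show ?thesis .
  next
    case False
    have t2: "t = (real (2 * k + 1) + (2 * s - 1)) * (T / 2 ^ Suc n)" unfolding tt by (simp add: field_simps)
    have "polygon T (Suc n) (increments T (Suc n) y) t = y (grid T (Suc n) (Suc (2 * k))) + (2 * s - 1) *\<^sub>R d1"
      unfolding t2 using polygon_increments_eq[OF T k2(2), of "2 * s - 1" y] False s unfolding d by (simp add: g0)
    then have "polygon T (Suc n) (increments T (Suc n) y) t - polygon T n (increments T n y) t
       = (y (grid T n k) + d0 + (2 * s - 1) *\<^sub>R d1) - (y (grid T n k) + s *\<^sub>R (d0 + d1))"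
      unfolding P d by simp
    also have "\<dots> = (1 - s) *\<^sub>R d0 - (1 - s) *\<^sub>R d1"
      by (simp add: algebra_simps scaleR_2[symmetric])
    also have "norm \<dots> \<le> (1 - s) * b + (1 - s) * b"
      using bd s by (intro norm_triangle_le_diff add_mono) (auto intro: mult_left_mono)
    also have "\<dots> \<le> b" using False b0 mult_right_mono[of "2 * (1 - s)" 1 b] by (auto simp: algebra_simps)
    finally show ?thesis .
  qed
qed

lemma polygon_converges:
  assumes T: "T > 0" and y: "continuous_on {0..T} y" and e: "e > 0"
  shows "\<exists>n0. \<forall>n\<ge>n0. \<forall>t\<in>{0..T}. norm (polygon T n (increments T n y) t - y t) \<le> e"
proof -
  have "uniformly_continuous_on {0..T} y" by (rule compact_uniformly_continuous[OF y]) simp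
  then obtain d where d: "d > 0" "\<And>s t. s \<in> {0..T} \<Longrightarrow> t \<in> {0..T} \<Longrightarrow> dist s t < d \<Longrightarrow> dist (y s) (y t) < e / 2"
    unfolding uniformly_continuous_on_def using e by (metis half_gt_zero)
  obtain n0 where n0: "T / d < 2 ^ n0" using real_arch_pow[of 2 "T / d"] by auto
  show ?thesis
  proof (intro exI[of _ n0] allI impI ballI)
    fix n t assume n: "n0 \<le> n" and t: "t \<in> {0..T}"
    have "(2::real) ^ n0 \<le> 2 ^ n" using n by (rule power_increasing) simp
    then have "T / d < 2 ^ n" using n0 by linarith
    then have h: "T / 2 ^ n < d" using d T by (simp add: field_simps)
    obtain k s where k: "k < 2 ^ n" and s: "0 \<le> s" "s \<le> 1" and tt: "t = (real k + s) * (T / 2 ^ n)"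
      using grid_cell[OF T t] by metis
    have gk: "grid T n k \<in> {0..T}" "grid T n (Suc k) \<in> {0..T}" using k grid_bounds[OF T, of k n] grid_bounds[OF T, of "Suc k" n] by auto
    have h0: "T / 2 ^ n > 0" using T by simp
    have "dist (grid T n k) t = s * (T / 2 ^ n)" "dist (grid T n (Suc k)) (grid T n k) = T / 2 ^ n"
      unfolding tt grid_def dist_real_def using s h0 T by (simp_all add: algebra_simps add_divide_distrib)
    moreover have "s * (T / 2 ^ n) \<le> 1 * (T / 2 ^ n)" using s h0 by (intro mult_right_mono) auto
    ultimately have dd: "dist (grid T n k) t < d" "dist (grid T n (Suc k)) (grid T n k) < d" using h by auto
    have "polygon T n (increments T n y) t - y t = (y (grid T n k) - y t) + s *\<^sub>R (y (grid T n (Suc k)) - y (grid T n k))"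
      unfolding tt polygon_increments_eq[OF T k s] by simp
    also have "norm \<dots> \<le> e / 2 + e / 2"
    proof (rule norm_triangle_mono)
      show "norm (y (grid T n k) - y t) \<le> e / 2" using d(2)[OF gk(1) t dd(1)] by (simp add: dist_norm)
      have "s * norm (y (grid T n (Suc k)) - y (grid T n k)) \<le> 1 * (e / 2)"
        using d(2)[OF gk(2,1) dd(2)] s by (intro mult_mono) (auto simp: dist_norm)
      then show "norm (s *\<^sub>R (y (grid T n (Suc k)) - y (grid T n k))) \<le> e / 2" using s by simp
    qed
    finally show "norm (polygon T n (increments T n y) t - y t) \<le> e" by simp
  qed
qed

text \<open>An open set is where the distance to its complement is positive, and that distance is
  1-Lipschitz. Measurability of continuous functionals thus suffices; an empty complement is set
  apart because the infimum needs a nonempty range.\<close>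

lemma measurable_borel_of_metric:
  assumes Z: "\<And>\<omega>. \<omega> \<in> space M \<Longrightarrow> Z \<omega> \<in> mspace m"
    and meas: "\<And>f. continuous_map (mtopology_of m) euclideanreal f \<Longrightarrow> (\<lambda>\<omega>. f (Z \<omega>)) \<in> borel_measurable M"
  shows "Z \<in> measurable M (borel_of (mtopology_of m))"
  unfolding borel_of_def
proof (rule measurable_measure_of)
  interpret Metric_space "mspace m" "mdist m" by (rule Metric_space_mspace_mdist)
  show "{U. openin (mtopology_of m) U} \<subseteq> Pow (topspace (mtopology_of m))"
    using openin_subset by blast
  show "Z \<in> space M \<rightarrow> topspace (mtopology_of m)" using Z by (simp add: mtopology_of_def)
  fix U assume "U \<in> {U. openin (mtopology_of m) U}"
  then have U: "openin mtopology U" by (simp add: mtopology_of_def)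
  define C where "C = mspace m - U"
  show "Z -` U \<inter> space M \<in> sets M"
  proof (cases "C = {}")
    case True
    then have "Z -` U \<inter> space M = space M" using Z by (auto simp: C_def)
    then show ?thesis by simp
  next
    case False
    define g where "g x = (INF y\<in>C. mdist m x y)" for x
    have bdd: "bdd_below ((\<lambda>y. mdist m x y) ` C)" for x by (rule bdd_belowI2[of _ 0]) simp
    have gle: "g x \<le> mdist m x y" if "y \<in> C" for x y unfolding g_def by (rule cINF_lower[OF bdd that])
    have g1: "g x \<le> g x' + mdist m x x'" if x: "x \<in> mspace m" "x' \<in> mspace m" for x x'
    proof -
      have "g x - mdist m x x' \<le> g x'" unfolding g_def[of x']
      proof (rule cINF_greatest[OF False])
        fix y assume y: "y \<in> C"
        then show "g x - mdist m x x' \<le> mdist m x' y"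
          using gle[OF y, of x] triangle[of x x' y] x by (simp add: C_def)
      qed
      then show ?thesis by simp
    qed
    have lip: "\<bar>g x - g x'\<bar> \<le> 1 * mdist m x x'" if x: "x \<in> mspace m" "x' \<in> mspace m" for x x'
      using g1[OF x] g1[OF x(2,1)] unfolding commute[of x' x] by linarith
    have pos: "x \<in> U \<longleftrightarrow> g x > 0" if x: "x \<in> mspace m" for x
    proof
      assume "x \<in> U"
      then obtain r where r: "r > 0" "mball x r \<subseteq> U" using U unfolding openin_mtopology by blast
      have "r \<le> g x" unfolding g_def
      proof (rule cINF_greatest[OF False])
        fix y assume "y \<in> C"
        then show "r \<le> mdist m x y" using r(2) x by (auto simp: C_def in_mball subset_iff not_less[symmetric])
      qed
      then show "g x > 0" using r by simp
    next
      assume "g x > 0"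
      then show "x \<in> U" using gle[of x x] x by (auto simp: C_def)
    qed
    have "(\<lambda>\<omega>. g (Z \<omega>)) \<in> borel_measurable M"
      by (rule meas[OF lipschitz_continuous_map[OF lip]])
    then have "{\<omega> \<in> space M. g (Z \<omega>) > 0} \<in> sets M" by measurable
    also have "{\<omega> \<in> space M. g (Z \<omega>) > 0} = Z -` U \<inter> space M" using pos[OF Z] by auto
    finally show ?thesis .
  qed
qed

text \<open>Only the coordinates up to 2^n enter, so the neighbourhood needed in the product
  topology is cut out by a finite sum of coordinate distances.\<close>

lemma continuous_polygon_functional:
  fixes f :: "(real \<Rightarrow> complex ^ 'm) \<Rightarrow> real"
  assumes f: "continuous_map (mtopology_of (paths T)) euclideanreal f"
  shows "continuous_on UNIV (\<lambda>d. f (\<lambda>t\<in>{0..T}. polygon T n d t))"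
proof -
  interpret Metric_space "mspace (paths T :: (real \<Rightarrow> complex ^ 'm) metric)" "mdist (paths T)" by (rule Metric_space_mspace_mdist)
  define p where "p d = (\<lambda>t\<in>{0..T}. polygon T n d t)" for d :: "nat \<Rightarrow> complex ^ 'm"
  have pm: "p d \<in> mspace (paths T)" for d
    unfolding p_def by (rule restrict_in_paths[OF continuous_polygon])
  have "continuous_map euclidean mtopology p"
  proof (subst continuous_map_to_metric, intro ballI allI impI)
    fix d0 :: "nat \<Rightarrow> complex ^ 'm" and r :: real assume r: "r > 0"
    define U where "U = {d :: nat \<Rightarrow> complex ^ 'm. (\<Sum>k\<le>2 ^ n. norm (d k - d0 k)) < r}"
    have cc: "continuous_on UNIV (\<lambda>d :: nat \<Rightarrow> complex ^ 'm. d k)" for k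
      by (rule continuous_on_product_coordinates)
    have U: "open U" unfolding U_def by (intro open_Collect_less continuous_intros cc)
    have "p d \<in> mball (p d0) r" if "d \<in> U" for d
    proof -
      have "mdist (paths T) (p d0) (p d) \<le> (\<Sum>k\<le>2 ^ n. norm (d k - d0 k))"
        unfolding p_def
      proof (rule paths_dist_le)
        fix t
        have "polygon T n d0 t - polygon T n d t = (d0 (2 ^ n) - d (2 ^ n)) + (\<Sum>k<2 ^ n. ramp T n k t *\<^sub>R (d0 k - d k))"
          unfolding polygon_def by (simp add: algebra_simps sum_subtractf)
        also have "norm \<dots> \<le> norm (d (2 ^ n) - d0 (2 ^ n)) + (\<Sum>k<2 ^ n. norm (d k - d0 k))"
        proof (intro norm_triangle_mono sum_norm_le)
          show "norm (d0 (2 ^ n) - d (2 ^ n)) \<le> norm (d (2 ^ n) - d0 (2 ^ n))" by (simp add: norm_minus_commute)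
          fix k
          have "\<bar>ramp T n k t\<bar> * norm (d0 k - d k) \<le> 1 * norm (d0 k - d k)"
            by (intro mult_right_mono) (auto simp: ramp_def)
          then show "norm (ramp T n k t *\<^sub>R (d0 k - d k)) \<le> norm (d k - d0 k)" by (simp add: norm_minus_commute)
        qed
        also have "\<dots> = (\<Sum>k\<le>2 ^ n. norm (d k - d0 k))" by (simp add: lessThan_Suc_atMost[symmetric])
        finally show "norm (polygon T n d0 t - polygon T n d t) \<le> (\<Sum>k\<le>2 ^ n. norm (d k - d0 k))" .
      qed (auto intro: sum_nonneg)
      then show ?thesis unfolding in_mball using that pm unfolding U_def by (auto simp del: mspace_cfunspace)
    qed
    moreover have "d0 \<in> U" using r by (simp add: U_def)
    ultimately show "\<exists>U. openin euclidean U \<and> d0 \<in> U \<and> (\<forall>d\<in>U. p d \<in> mball (p d0) r)"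
      using U by (intro exI[of _ U]) auto
  qed
  then have "continuous_map euclidean euclideanreal (f \<circ> p)"
    using f unfolding mtopology_of_def by (rule continuous_map_compose)
  then show ?thesis unfolding p_def by (simp add: comp_def)
qed

lemma polygon_functional_tendsto:
  fixes y :: "real \<Rightarrow> complex ^ 'm"
  assumes T: "T > 0" and y: "continuous_on {0..T} y"
    and f: "continuous_map (mtopology_of (paths T)) euclideanreal f"
  shows "(\<lambda>n. f (\<lambda>t\<in>{0..T}. polygon T n (increments T n y) t)) \<longlonglongrightarrow> f (\<lambda>t\<in>{0..T}. y t)"
proof -
  interpret Metric_space "mspace (paths T :: (real \<Rightarrow> complex ^ 'm) metric)" "mdist (paths T)" by (rule Metric_space_mspace_mdist)
  have "limitin mtopology (\<lambda>n. \<lambda>t\<in>{0..T}. polygon T n (increments T n y) t) (\<lambda>t\<in>{0..T}. y t) sequentially"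
    unfolding limit_metric_sequentially
  proof (intro conjI allI impI)
    show "(\<lambda>t\<in>{0..T}. y t) \<in> mspace (paths T)" by (rule restrict_in_paths[OF y])
    fix e :: real assume e: "e > 0"
    from polygon_converges[OF T y half_gt_zero[OF e]]
    obtain n0 where n0: "\<And>n t. n \<ge> n0 \<Longrightarrow> t \<in> {0..T} \<Longrightarrow> norm (polygon T n (increments T n y) t - y t) \<le> e / 2"
      by blast
    show "\<exists>N. \<forall>n\<ge>N. (\<lambda>t\<in>{0..T}. polygon T n (increments T n y) t) \<in> mspace (paths T) \<and>
       mdist (paths T) (\<lambda>t\<in>{0..T}. polygon T n (increments T n y) t) (\<lambda>t\<in>{0..T}. y t) < e"
    proof (intro exI[of _ n0] allI impI conjI)
      fix n assume n: "n0 \<le> n"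
      show "(\<lambda>t\<in>{0..T}. polygon T n (increments T n y) t) \<in> mspace (paths T)"
        by (rule restrict_in_paths[OF continuous_polygon])
      have "mdist (paths T) (\<lambda>t\<in>{0..T}. polygon T n (increments T n y) t) (\<lambda>t\<in>{0..T}. y t) \<le> e / 2"
        using n0[OF n] e by (intro paths_dist_le) auto
      then show "mdist (paths T) (\<lambda>t\<in>{0..T}. polygon T n (increments T n y) t) (\<lambda>t\<in>{0..T}. y t) < e" using e by simp
    qed
  qed
  from continuous_map_limit[OF f[unfolded mtopology_of_def] this] show ?thesis
    by (simp add: comp_def)
qed

lemma increments_measurable:
  assumes T: "T > 0" and Y: "\<And>t. t \<in> {0..T} \<Longrightarrow> Y t \<in> borel_measurable M"
  shows "(\<lambda>\<omega>. increments T n (\<lambda>t. Y t \<omega>) k) \<in> borel_measurable M"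
proof (cases "k < 2 ^ n")
  case True
  then have "Y (grid T n (Suc k)) \<in> borel_measurable M" "Y (grid T n k) \<in> borel_measurable M"
    using T by (auto intro!: Y grid_bounds)
  then show ?thesis using True by (simp add: increments_def)
next
  case False
  then show ?thesis using Y[of 0] T by (simp add: increments_def)
qed

lemma polygon_functional_measurable:
  assumes T: "T > 0" and Y: "\<And>t. t \<in> {0..T} \<Longrightarrow> Y t \<in> borel_measurable M"
    and f: "continuous_map (mtopology_of (paths T)) euclideanreal f"
  shows "(\<lambda>\<omega>. f (\<lambda>t\<in>{0..T}. polygon T n (increments T n (\<lambda>t. Y t \<omega>)) t)) \<in> borel_measurable M"
proof -
  have "(\<lambda>\<omega>. increments T n (\<lambda>t. Y t \<omega>)) \<in> borel_measurable M"
    by (rule measurable_coordinatewise_then_product) (rule increments_measurable[OF T Y])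
  from measurable_compose[OF this borel_measurable_continuous_onI[OF continuous_polygon_functional[OF f]]]
  show ?thesis .
qed

text \<open>The functional of the path is the limit of its values at polygons, each a continuous
  function of finitely many measurable coordinates.\<close>

lemma path_functional_measurable:
  assumes T: "T > 0" and Y: "\<And>t. t \<in> {0..T} \<Longrightarrow> Y t \<in> borel_measurable M"
    and cont: "\<And>\<omega>. \<omega> \<in> space M \<Longrightarrow> continuous_on {0..T} (\<lambda>t. Y t \<omega>)"
    and f: "continuous_map (mtopology_of (paths T)) euclideanreal f"
  shows "(\<lambda>\<omega>. f (\<lambda>t\<in>{0..T}. Y t \<omega>)) \<in> borel_measurable M"
proof (rule borel_measurable_LIMSEQ_real)
  show "(\<lambda>\<omega>. f (\<lambda>t\<in>{0..T}. polygon T n (increments T n (\<lambda>t. Y t \<omega>)) t)) \<in> borel_measurable M" for n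
    by (rule polygon_functional_measurable[OF T Y f])
  show "(\<lambda>n. f (\<lambda>t\<in>{0..T}. polygon T n (increments T n (\<lambda>t. Y t \<omega>)) t)) \<longlonglongrightarrow> f (\<lambda>t\<in>{0..T}. Y t \<omega>)"
    if "\<omega> \<in> space M" for \<omega>
    by (rule polygon_functional_tendsto[OF T cont[OF that] f])
qed

lemma path_measurable:
  assumes T: "T > 0" and Y: "\<And>t. t \<in> {0..T} \<Longrightarrow> Y t \<in> borel_measurable M"
    and cont: "\<And>\<omega>. \<omega> \<in> space M \<Longrightarrow> continuous_on {0..T} (\<lambda>t. Y t \<omega>)"
  shows "(\<lambda>\<omega>. \<lambda>t\<in>{0..T}. Y t \<omega>) \<in> measurable M (borel_of (path_space T))"
  unfolding path_space_def
  by (intro measurable_borel_of_metric restrict_in_paths cont path_functional_measurable[OF T Y cont])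

lemma integral_path_law:
  assumes T: "T > 0" and Y: "\<And>t. t \<in> {0..T} \<Longrightarrow> Y t \<in> borel_measurable M"
    and cont: "\<And>\<omega>. \<omega> \<in> space M \<Longrightarrow> continuous_on {0..T} (\<lambda>t. Y t \<omega>)"
    and f: "continuous_map (path_space T) euclideanreal f"
  shows "(LINT x|path_law M T Y. f x) = (LINT \<omega>|M. f (\<lambda>t\<in>{0..T}. Y t \<omega>) :: real)"
  unfolding path_law_def
proof (rule integral_distr[OF path_measurable[OF T Y cont]])
  show "f \<in> borel_measurable (borel_of (path_space T))"
  proof (rule borel_measurableI)
    fix S :: "real set" assume "open S"
    then have o: "openin (path_space T) {x \<in> topspace (path_space T). f x \<in> S}"
      using f by (intro openin_continuous_map_preimage) auto
    have "space (borel_of (path_space T)) = topspace (path_space T)"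
      unfolding borel_of_def by (rule space_measure_of) (use openin_subset in blast)
    then have "f -` S \<inter> space (borel_of (path_space T)) = {x \<in> topspace (path_space T). f x \<in> S}" by auto
    also have "\<dots> \<in> sets (borel_of (path_space T))"
      unfolding borel_of_def by (subst sets_measure_of) (use o openin_subset in \<open>auto intro: sigma_sets.Basic\<close>)
    finally show "f -` S \<inter> space (borel_of (path_space T)) \<in> sets (borel_of (path_space T))" .
  qed
qed

section \<open>A criterion for weak convergence of path laws\<close>

text \<open>Linearises a maximum: m plus the sum of the fourth powers over m^3 dominates every
  member of a family at once, and its expectation only involves fourth moments.\<close>

lemma le_add_fourth_power:
  fixes x m :: real
  assumes "0 \<le> x" "0 < m"
  shows "x \<le> m + x ^ 4 / m ^ 3"
proof (cases "x \<le> m")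
  case True
  have "0 \<le> x ^ 4 / m ^ 3" using assms by simp
  then show ?thesis using True by simp
next
  case False
  then have "x * m ^ 3 \<le> x * x ^ 3" using assms by (intro mult_left_mono power_mono) auto
  then have "x \<le> x ^ 4 / m ^ 3" using assms by (simp add: field_simps power_Suc[symmetric] del: power_Suc)
  then show ?thesis using assms by simp
qed

section \<open>Interpolation error and tails of one process with a fourth moment bound\<close>

context
  fixes M :: "'a measure" and Y :: "real \<Rightarrow> 'a \<Rightarrow> complex ^ 'm" and T C :: real
  assumes M: "prob_space M" and T: "T > 0"
    and Y: "\<And>t. t \<in> {0..T} \<Longrightarrow> Y t \<in> borel_measurable M"
    and cont: "\<And>\<omega>. \<omega> \<in> space M \<Longrightarrow> continuous_on {0..T} (\<lambda>t. Y t \<omega>)"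
    and moment: "\<And>s t. 0 \<le> s \<Longrightarrow> s \<le> t \<Longrightarrow> t \<le> T \<Longrightarrow> integrable M (\<lambda>\<omega>. norm (Y t \<omega> - Y s \<omega>) ^ 4) \<and>
       (LINT \<omega>|M. norm (Y t \<omega> - Y s \<omega>) ^ 4) \<le> C * (t - s)\<^sup>2"
begin

lemma increments_moment:
  assumes "k < 2 ^ n"
  shows "integrable M (\<lambda>\<omega>. norm (increments T n (\<lambda>t. Y t \<omega>) k) ^ 4)"
    and "(LINT \<omega>|M. norm (increments T n (\<lambda>t. Y t \<omega>) k) ^ 4) \<le> C * (T / 2 ^ n)\<^sup>2"
proof -
  have g: "0 \<le> grid T n k" "grid T n k \<le> grid T n (Suc k)" "grid T n (Suc k) \<le> T"
    using grid_bounds[OF T, of k n] grid_bounds[OF T, of "Suc k" n] assms T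
    by (auto simp: grid_def intro!: divide_right_mono mult_right_mono)
  have d: "grid T n (Suc k) - grid T n k = T / 2 ^ n" by (simp add: grid_def field_simps)
  show "integrable M (\<lambda>\<omega>. norm (increments T n (\<lambda>t. Y t \<omega>) k) ^ 4)"
    "(LINT \<omega>|M. norm (increments T n (\<lambda>t. Y t \<omega>) k) ^ 4) \<le> C * (T / 2 ^ n)\<^sup>2"
    using moment[OF g] assms unfolding d by (simp_all add: increments_def)
qed

text \<open>Any ratio $q < 1$ with $q^4 \ge 1/2$ would do in place of $9/10$.\<close>

lemma polygon_functional_close:
  fixes f :: "(real \<Rightarrow> complex ^ 'm) \<Rightarrow> real"
  assumes lip: "\<And>x y. x \<in> mspace (paths T) \<Longrightarrow> y \<in> mspace (paths T) \<Longrightarrow> \<bar>f x - f y\<bar> \<le> L * mdist (paths T) x y"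
    and bnd: "\<And>x. x \<in> mspace (paths T) \<Longrightarrow> \<bar>f x\<bar> \<le> B" and L: "L \<ge> 0" and C: "C \<ge> 0"
  shows "\<bar>(LINT \<omega>|M. f (\<lambda>t\<in>{0..T}. Y t \<omega>)) - (LINT \<omega>|M. f (\<lambda>t\<in>{0..T}. polygon T n (increments T n (\<lambda>t. Y t \<omega>)) t))\<bar>
    \<le> 10 * (L * (1 + C * T\<^sup>2)) * (9 / 10) ^ n"
proof -
  interpret prob_space M by (rule M)
  have fc: "continuous_map (mtopology_of (paths T)) euclideanreal f" by (rule lipschitz_continuous_map[OF lip])
  define Z where "Z p \<omega> = (\<lambda>t\<in>{0..T}. polygon T p (increments T p (\<lambda>t. Y t \<omega>)) t)" for p \<omega>
  define D where "D = L * (1 + C * T\<^sup>2)"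
  have D0: "D \<ge> 0" unfolding D_def using L C by simp
  have Zm: "Z p \<omega> \<in> mspace (paths T)" for p \<omega> unfolding Z_def by (rule restrict_in_paths[OF continuous_polygon])
  have Zmeas: "(\<lambda>\<omega>. f (Z p \<omega>)) \<in> borel_measurable M" for p
    unfolding Z_def by (rule polygon_functional_measurable[OF T Y fc])
  have Zint: "integrable M (\<lambda>\<omega>. f (Z p \<omega>))" for p
    using Zmeas bnd[OF Zm] by (intro integrable_const_bound[of _ B]) auto
  define \<Phi> where "\<Phi> p = expectation (\<lambda>\<omega>. f (Z p \<omega>))" for p
  have step: "\<bar>\<Phi> (Suc p) - \<Phi> p\<bar> \<le> D * (9 / 10) ^ p" for p
  proof -
    \<comment> \<open>The threshold for increments of level p + 1. Increments above it are paid for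
      by S / q^3.\<close>
    define q :: real where "q = (9 / 10) ^ Suc p"
    define S where "S \<omega> = (\<Sum>k<2 ^ Suc p. norm (increments T (Suc p) (\<lambda>t. Y t \<omega>) k) ^ 4)" for \<omega>
    have q0: "q > 0" "q \<le> (9 / 10) ^ p" unfolding q_def by (simp_all add: power_le_one mult_left_le_one_le)
    have Sint: "integrable M S" unfolding S_def by (intro Bochner_Integration.integrable_sum increments_moment) auto
    have S0: "S \<omega> \<ge> 0" for \<omega> unfolding S_def by (intro sum_nonneg) auto
    have "expectation S = (\<Sum>k<2 ^ Suc p. expectation (\<lambda>\<omega>. norm (increments T (Suc p) (\<lambda>t. Y t \<omega>) k) ^ 4))"
      unfolding S_def by (intro Bochner_Integration.integral_sum increments_moment(1)) auto
    \<comment> \<open>Here the fourth power matters: 2^(p+1) terms, each of order 4^(-(p+1)), leave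
      a geometrically decaying sum.\<close>
    also have "\<dots> \<le> (\<Sum>k<(2::nat) ^ Suc p. C * (T / 2 ^ Suc p)\<^sup>2)"
      by (intro sum_mono increments_moment(2)) auto
    also have "\<dots> = C * T\<^sup>2 * (1 / 2) ^ Suc p" by (simp add: power2_eq_square field_simps)
    finally have ES: "expectation S \<le> C * T\<^sup>2 * (1 / 2) ^ Suc p" .
    have mono: "\<bar>f (Z (Suc p) \<omega>) - f (Z p \<omega>)\<bar> \<le> L * (q + S \<omega> / q ^ 3)" for \<omega>
    proof -
      have "mdist (paths T) (Z (Suc p) \<omega>) (Z p \<omega>) \<le> q + S \<omega> / q ^ 3"
        unfolding Z_def
      proof (rule paths_dist_le)
        show "0 \<le> q + S \<omega> / q ^ 3" using q0 S0 by simp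
        fix t assume t: "t \<in> {0..T}"
        show "norm (polygon T (Suc p) (increments T (Suc p) (\<lambda>t. Y t \<omega>)) t - polygon T p (increments T p (\<lambda>t. Y t \<omega>)) t) \<le> q + S \<omega> / q ^ 3"
        proof (rule polygon_refine[OF T t])
          fix k :: nat assume k: "k < 2 ^ Suc p"
          let ?x = "norm (increments T (Suc p) (\<lambda>t. Y t \<omega>) k)"
          have "?x ^ 4 \<le> S \<omega>" unfolding S_def using k by (intro member_le_sum) auto
          then have "?x ^ 4 / q ^ 3 \<le> S \<omega> / q ^ 3" using q0 by (intro divide_right_mono) auto
          then show "?x \<le> q + S \<omega> / q ^ 3" using le_add_fourth_power[of ?x q] q0 by simp
        qed
      qed
      then show ?thesis using lip[OF Zm Zm, of "Suc p" \<omega> p \<omega>] L by (meson mult_left_mono order_trans)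
    qed
    have "\<bar>\<Phi> (Suc p) - \<Phi> p\<bar> = \<bar>expectation (\<lambda>\<omega>. f (Z (Suc p) \<omega>) - f (Z p \<omega>))\<bar>"
      unfolding \<Phi>_def by (simp add: Bochner_Integration.integral_diff[OF Zint Zint])
    also have "\<dots> \<le> expectation (\<lambda>\<omega>. \<bar>f (Z (Suc p) \<omega>) - f (Z p \<omega>)\<bar>)" by (rule integral_abs_bound)
    also have "\<dots> \<le> expectation (\<lambda>\<omega>. L * (q + S \<omega> / q ^ 3))"
      using Sint by (intro integral_mono mono integrable_abs Bochner_Integration.integrable_diff Zint) auto
    also have "\<dots> = L * (q + expectation S / q ^ 3)"
      using Sint by (simp add: prob_space)
    also have "\<dots> \<le> L * (q + C * T\<^sup>2 * q)"
    proof (intro mult_left_mono add_left_mono L)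
      have "expectation S / q ^ 3 \<le> C * T\<^sup>2 * (1 / 2) ^ Suc p / q ^ 3"
        using ES q0 by (intro divide_right_mono) auto
      also have "\<dots> = C * T\<^sup>2 * ((1 / 2) ^ Suc p / q ^ 3)" by simp
      \<comment> \<open>1/2 divided by (9/10)^3 is 500/729, which is below 9/10, so this term decays
        at least as fast as \<open>q\<close>.\<close>
      also have "(1 / 2) ^ Suc p / q ^ 3 = (500 / 729) ^ Suc p"
      proof -
        have "(1 / 2) ^ Suc p / q ^ 3 = (1 / 2) ^ Suc p / ((9 / 10) ^ 3) ^ Suc p"
          unfolding q_def power_mult[symmetric] by (simp only: mult.commute)
        also have "\<dots> = ((1 / 2) / (9 / 10) ^ 3) ^ Suc p" by (simp only: power_divide)
        also have "(1 / 2) / (9 / 10) ^ 3 = (500 / 729 :: real)" by (simp add: power3_eq_cube)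
        finally show ?thesis .
      qed
      also have "C * T\<^sup>2 * (500 / 729) ^ Suc p \<le> C * T\<^sup>2 * q"
        unfolding q_def using C by (intro mult_left_mono power_mono) auto
      finally show "expectation S / q ^ 3 \<le> C * T\<^sup>2 * q" .
    qed
    also have "\<dots> = D * q" by (simp add: D_def algebra_simps)
    also have "\<dots> \<le> D * (9 / 10) ^ p" using q0 D0 by (intro mult_left_mono) auto
    finally show ?thesis .
  qed
  \<comment> \<open>The factor 10 is 1 / (1 - 9/10); keeping the subtracted power makes the
    induction step an identity.\<close>
  have tele: "\<bar>\<Phi> (m + n) - \<Phi> n\<bar> \<le> 10 * D * ((9 / 10) ^ n - (9 / 10) ^ (m + n))" for m
  proof (induction m)
    case (Suc m)
    have "\<bar>\<Phi> (Suc m + n) - \<Phi> n\<bar> \<le> \<bar>\<Phi> (Suc (m + n)) - \<Phi> (m + n)\<bar> + \<bar>\<Phi> (m + n) - \<Phi> n\<bar>" by simp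
    also have "\<dots> \<le> D * (9 / 10) ^ (m + n) + 10 * D * ((9 / 10) ^ n - (9 / 10) ^ (m + n))"
      by (intro add_mono step Suc)
    also have "\<dots> = 10 * D * ((9 / 10) ^ n - (9 / 10) ^ (Suc m + n))" by (simp add: algebra_simps)
    finally show ?case .
  qed simp
  have lim: "\<Phi> \<longlonglongrightarrow> expectation (\<lambda>\<omega>. f (\<lambda>t\<in>{0..T}. Y t \<omega>))"
    unfolding \<Phi>_def
  proof (rule integral_dominated_convergence[where w="\<lambda>_. B"])
    show "(\<lambda>\<omega>. f (\<lambda>t\<in>{0..T}. Y t \<omega>)) \<in> borel_measurable M" by (rule path_functional_measurable[OF T Y cont fc])
    show "AE \<omega> in M. (\<lambda>p. f (Z p \<omega>)) \<longlonglongrightarrow> f (\<lambda>t\<in>{0..T}. Y t \<omega>)"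
      unfolding Z_def by (intro AE_I2 polygon_functional_tendsto[OF T cont fc])
  qed (use Zmeas bnd[OF Zm] in auto)
  have "(\<lambda>m. \<bar>\<Phi> (m + n) - \<Phi> n\<bar>) \<longlonglongrightarrow> \<bar>expectation (\<lambda>\<omega>. f (\<lambda>t\<in>{0..T}. Y t \<omega>)) - \<Phi> n\<bar>"
    by (intro tendsto_intros LIMSEQ_ignore_initial_segment lim)
  moreover have "\<bar>\<Phi> (m + n) - \<Phi> n\<bar> \<le> 10 * D * (9 / 10) ^ n" for m
  proof -
    have "10 * D * ((9 / 10) ^ n - (9 / 10) ^ (m + n)) \<le> 10 * D * (9 / 10) ^ n"
      using D0 by (intro mult_left_mono) auto
    then show ?thesis using tele[of m] by linarith
  qed
  ultimately have "\<bar>expectation (\<lambda>\<omega>. f (\<lambda>t\<in>{0..T}. Y t \<omega>)) - \<Phi> n\<bar> \<le> 10 * D * (9 / 10) ^ n"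
    by (intro LIMSEQ_le_const2) auto
  then show ?thesis unfolding \<Phi>_def Z_def D_def .
qed

text \<open>Markov's inequality for the sum of the fourth powers, which contains the union
  bound.\<close>

lemma increments_tail:
  assumes Y0: "\<And>\<omega>. \<omega> \<in> space M \<Longrightarrow> Y 0 \<omega> = 0" and R: "R > 0" and C: "C \<ge> 0"
  shows "measure M {\<omega> \<in> space M. \<exists>k<Suc (2 ^ n). norm (increments T n (\<lambda>t. Y t \<omega>) k) > R} \<le> 2 ^ n * (C * (T / 2 ^ n)\<^sup>2) / R ^ 4"
proof -
  interpret prob_space M by (rule M)
  define A where "A = {\<omega> \<in> space M. \<exists>k<Suc (2 ^ n). norm (increments T n (\<lambda>t. Y t \<omega>) k) > R}"
  define S where "S \<omega> = (\<Sum>k<2 ^ n. norm (increments T n (\<lambda>t. Y t \<omega>) k) ^ 4)" for \<omega>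
  have A: "A \<in> sets M" unfolding A_def using increments_measurable[OF T Y] by measurable
  have Sint: "integrable M S" unfolding S_def by (intro Bochner_Integration.integrable_sum increments_moment) auto
  have S0: "S \<omega> \<ge> 0" for \<omega> unfolding S_def by (intro sum_nonneg) auto
  have "measure M A = expectation (indicator A)" using A by simp
  also have "\<dots> \<le> expectation (\<lambda>\<omega>. S \<omega> / R ^ 4)"
  proof (rule integral_mono')
    show "integrable M (\<lambda>\<omega>. S \<omega> / R ^ 4)" using Sint by simp
    show "0 \<le> S \<omega> / R ^ 4" for \<omega> using S0 R by simp
    show "indicator A \<omega> \<le> S \<omega> / R ^ 4" if "\<omega> \<in> space M" for \<omega>
    proof (cases "\<omega> \<in> A")
      case True
      then obtain k where k: "k < Suc (2 ^ n)" "norm (increments T n (\<lambda>t. Y t \<omega>) k) > R" unfolding A_def by blast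
      \<comment> \<open>The index 2^n carries the initial value, which is zero and cannot exceed
        \<open>R\<close>.\<close>
      have "k \<noteq> 2 ^ n" using k(2) Y0[OF that] R by (auto simp: increments_def)
      then have "k < 2 ^ n" using k(1) by simp
      then have "norm (increments T n (\<lambda>t. Y t \<omega>) k) ^ 4 \<le> S \<omega>" unfolding S_def by (intro member_le_sum) auto
      moreover have "R ^ 4 \<le> norm (increments T n (\<lambda>t. Y t \<omega>) k) ^ 4" using k(2) R by (intro power_mono) auto
      ultimately have "R ^ 4 \<le> S \<omega>" by linarith
      then show ?thesis using True R by simp
    qed (use S0 R in simp)
  qed
  also have "\<dots> = expectation S / R ^ 4" by simp
  also have "\<dots> \<le> (\<Sum>k<(2::nat) ^ n. C * (T / 2 ^ n)\<^sup>2) / R ^ 4"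
  proof (rule divide_right_mono)
    have "expectation S = (\<Sum>k<2 ^ n. expectation (\<lambda>\<omega>. norm (increments T n (\<lambda>t. Y t \<omega>) k) ^ 4))"
      unfolding S_def by (intro Bochner_Integration.integral_sum increments_moment(1)) auto
    also have "\<dots> \<le> (\<Sum>k<(2::nat) ^ n. C * (T / 2 ^ n)\<^sup>2)"
      by (intro sum_mono increments_moment(2)) auto
    finally show "expectation S \<le> (\<Sum>k<(2::nat) ^ n. C * (T / 2 ^ n)\<^sup>2)" .
  qed (use R in simp)
  finally show ?thesis unfolding A_def by simp
qed

end

text \<open>For a Lipschitz functional the error has three parts: interpolation of x, eventually
  uniform in the index by the moment bound; convergence of finitely many increments at a fixed
  level; interpolation of w. The last concerns a single law, so dominated convergence handles
  it.\<close>

theorem weak_convergence_paths: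
  fixes x :: "'i \<Rightarrow> real \<Rightarrow> 'a \<Rightarrow> complex ^ 'm" and w :: "real \<Rightarrow> 'c \<Rightarrow> complex ^ 'm"
  assumes M: "prob_space M" and N: "prob_space N" and T: "T > 0" and C: "C \<ge> 0"
    and x: "\<And>i t. t \<in> {0..T} \<Longrightarrow> x i t \<in> borel_measurable M"
    and xc: "\<And>i \<omega>. \<omega> \<in> space M \<Longrightarrow> continuous_on {0..T} (\<lambda>t. x i t \<omega>)"
    and x0: "\<And>i \<omega>. \<omega> \<in> space M \<Longrightarrow> x i 0 \<omega> = 0"
    and w: "\<And>t. t \<in> {0..T} \<Longrightarrow> w t \<in> borel_measurable N"
    and wc: "\<And>\<omega>. \<omega> \<in> space N \<Longrightarrow> continuous_on {0..T} (\<lambda>t. w t \<omega>)"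
    and w0: "\<And>\<omega>. \<omega> \<in> space N \<Longrightarrow> w 0 \<omega> = 0"
    and moment: "eventually (\<lambda>i. \<forall>s t. 0 \<le> s \<longrightarrow> s \<le> t \<longrightarrow> t \<le> T \<longrightarrow> integrable M (\<lambda>\<omega>. norm (x i t \<omega> - x i s \<omega>) ^ 4) \<and>
       (LINT \<omega>|M. norm (x i t \<omega> - x i s \<omega>) ^ 4) \<le> C * (t - s)\<^sup>2) F"
    and char: "\<And>n l. ((\<lambda>i. LINT \<omega>|M. exp (\<i> * of_real (\<Sum>k<2 ^ n. l k \<bullet> (x i (grid T n (Suc k)) \<omega> - x i (grid T n k) \<omega>)))) \<longlongrightarrow>
        (LINT \<omega>|N. exp (\<i> * of_real (\<Sum>k<2 ^ n. l k \<bullet> (w (grid T n (Suc k)) \<omega> - w (grid T n k) \<omega>))))) F"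
    and f: "continuous_map (path_space T) euclideanreal f" and bnd: "bounded (f ` topspace (path_space T))"
  shows "((\<lambda>i. LINT \<omega>|M. f (\<lambda>t\<in>{0..T}. x i t \<omega>)) \<longlongrightarrow> (LINT \<omega>|N. f (\<lambda>t\<in>{0..T}. w t \<omega>) :: real)) F"
proof -
  interpret M: prob_space M by (rule M)
  interpret N: prob_space N by (rule N)
  obtain B0 where B0: "\<And>y. y \<in> mspace (paths T) \<Longrightarrow> \<bar>f y\<bar> \<le> B0"
    using bnd unfolding bounded_iff path_space_def by auto
  show ?thesis
  proof (rule weak_convergence_from_lipschitz[OF M N, where m="paths T" and B=B0])
    show "(\<lambda>t\<in>{0..T}. x i t \<omega>) \<in> mspace (paths T)" if "\<omega> \<in> space M" for i \<omega> by (rule restrict_in_paths[OF xc[OF that]])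
    show "(\<lambda>t\<in>{0..T}. w t \<omega>) \<in> mspace (paths T)" if "\<omega> \<in> space N" for \<omega> by (rule restrict_in_paths[OF wc[OF that]])
    show "(\<lambda>\<omega>. g (\<lambda>t\<in>{0..T}. x i t \<omega>)) \<in> borel_measurable M" if "continuous_map (mtopology_of (paths T)) euclideanreal g" for g i
      by (rule path_functional_measurable[OF T x xc that])
    show "(\<lambda>\<omega>. g (\<lambda>t\<in>{0..T}. w t \<omega>)) \<in> borel_measurable N" if "continuous_map (mtopology_of (paths T)) euclideanreal g" for g
      by (rule path_functional_measurable[OF T w wc that])
    show "continuous_map (mtopology_of (paths T)) euclideanreal f" using f unfolding path_space_def .
    show "\<bar>f y\<bar> \<le> B0" if "y \<in> mspace (paths T)" for y by (rule B0[OF that])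
  next
    fix g :: "(real \<Rightarrow> complex ^ 'm) \<Rightarrow> real" and L' B
    assume lip': "\<And>y z. y \<in> mspace (paths T) \<Longrightarrow> z \<in> mspace (paths T) \<Longrightarrow> \<bar>g y - g z\<bar> \<le> L' * mdist (paths T) y z"
      and B: "\<And>y. y \<in> mspace (paths T) \<Longrightarrow> \<bar>g y\<bar> \<le> B"
    \<comment> \<open>The Lipschitz hypothesis does not fix the sign of its constant, whereas the
      interpolation estimate multiplies by it.\<close>
    define L where "L = \<bar>L'\<bar>"
    have L0: "L \<ge> 0" by (simp add: L_def)
    have lip: "\<bar>g y - g z\<bar> \<le> L * mdist (paths T) y z" if "y \<in> mspace (paths T)" "z \<in> mspace (paths T)" for y z
      using lip'[OF that] mult_right_mono[OF abs_ge_self[of L'], of "mdist (paths T) y z"] by (simp add: L_def)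
    have gc: "continuous_map (mtopology_of (paths T)) euclideanreal g" by (rule lipschitz_continuous_map[OF lip])
    define G where "G n d = g (\<lambda>t\<in>{0..T}. polygon T n d t)" for n d
    have GB: "\<bar>G n d\<bar> \<le> B" for n d unfolding G_def by (rule B[OF restrict_in_paths[OF continuous_polygon]])
    have a: "((\<lambda>i. LINT \<omega>|M. G n (increments T n (\<lambda>t. x i t \<omega>))) \<longlongrightarrow> (LINT \<omega>|N. G n (increments T n (\<lambda>t. w t \<omega>)))) F" for n
    proof (rule levy_continuity_finite_dim[where n="Suc (2 ^ n)", OF M N _ _ _ _ _ _ GB])
      show "(\<lambda>\<omega>. increments T n (\<lambda>t. x i t \<omega>) k) \<in> borel_measurable M" for i k by (rule increments_measurable[OF T x])
      show "(\<lambda>\<omega>. increments T n (\<lambda>t. w t \<omega>) k) \<in> borel_measurable N" for k by (rule increments_measurable[OF T w])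
      show "continuous_on UNIV (G n)" unfolding G_def by (rule continuous_polygon_functional[OF gc])
      show "G n d = G n d'" if "\<forall>k<Suc (2 ^ n). d k = d' k" for d d'
      proof -
        have "polygon T n d t = polygon T n d' t" for t using that by (simp add: polygon_def)
        then show ?thesis by (simp add: G_def)
      qed
      show "((\<lambda>i. LINT \<omega>|M. exp (\<i> * of_real (\<Sum>k<Suc (2 ^ n). l k \<bullet> increments T n (\<lambda>t. x i t \<omega>) k))) \<longlongrightarrow>
         (LINT \<omega>|N. exp (\<i> * of_real (\<Sum>k<Suc (2 ^ n). l k \<bullet> increments T n (\<lambda>t. w t \<omega>) k)))) F" for l
      proof -
        have 1: "(LINT \<omega>|M. exp (\<i> * of_real (\<Sum>k<Suc (2 ^ n). l k \<bullet> increments T n (\<lambda>t. x i t \<omega>) k)))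
          = (LINT \<omega>|M. exp (\<i> * of_real (\<Sum>k<2 ^ n. l k \<bullet> (x i (grid T n (Suc k)) \<omega> - x i (grid T n k) \<omega>))))" for i
          by (rule Bochner_Integration.integral_cong[OF refl]) (simp add: increments_def x0)
        have 2: "(LINT \<omega>|N. exp (\<i> * of_real (\<Sum>k<Suc (2 ^ n). l k \<bullet> increments T n (\<lambda>t. w t \<omega>) k)))
          = (LINT \<omega>|N. exp (\<i> * of_real (\<Sum>k<2 ^ n. l k \<bullet> (w (grid T n (Suc k)) \<omega> - w (grid T n k) \<omega>))))"
          by (rule Bochner_Integration.integral_cong[OF refl]) (simp add: increments_def w0)
        show ?thesis unfolding 1 2 by (rule char)
      qed
      fix e :: real assume e: "e > 0"
      define K where "K = 2 ^ n * (C * (T / 2 ^ n)\<^sup>2)"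
      have K: "K \<ge> 0" using C by (simp add: K_def)
      \<comment> \<open>\<open>R \<ge> 1\<close> gives R^4 \<ge> R, and e R \<ge> K, so the tail
        bound K / R^4 is at most e.\<close>
      define R where "R = 1 + K / e"
      have R: "R > 0" "R \<ge> 1" using K e by (auto simp: R_def add_pos_nonneg)
      have "K / R ^ 4 \<le> e"
      proof -
        have "R \<le> R ^ 4" using R(2) by (intro self_le_power) auto
        moreover have "K \<le> e * R" using e by (simp add: R_def algebra_simps)
        ultimately have "K \<le> e * R ^ 4" using e mult_left_mono[of R "R ^ 4" e] by linarith
        then show ?thesis using R by (simp add: field_simps)
      qed
      moreover have "eventually (\<lambda>i. measure M {\<omega> \<in> space M. \<exists>k<Suc (2 ^ n). norm (increments T n (\<lambda>t. x i t \<omega>) k) > R} \<le> K / R ^ 4) F"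
        using moment
      proof eventually_elim
        case (elim i)
        show ?case unfolding K_def
          by (rule increments_tail[OF M T x xc _ x0 R(1) C]) (use elim in auto)
      qed
      ultimately show "\<exists>R>0. eventually (\<lambda>i. measure M {\<omega> \<in> space M. \<exists>k<Suc (2 ^ n). norm (increments T n (\<lambda>t. x i t \<omega>) k) > R} \<le> e) F"
        using R(1) by (intro exI[of _ R]) (auto elim: eventually_mono)
    qed
    have c: "(\<lambda>n. LINT \<omega>|N. G n (increments T n (\<lambda>t. w t \<omega>))) \<longlonglongrightarrow> (LINT \<omega>|N. g (\<lambda>t\<in>{0..T}. w t \<omega>))"
    proof (rule integral_dominated_convergence[where w="\<lambda>_. B"])
      show "(\<lambda>\<omega>. g (\<lambda>t\<in>{0..T}. w t \<omega>)) \<in> borel_measurable N" by (rule path_functional_measurable[OF T w wc gc])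
      show "(\<lambda>\<omega>. G n (increments T n (\<lambda>t. w t \<omega>))) \<in> borel_measurable N" for n
        unfolding G_def by (rule polygon_functional_measurable[OF T w gc])
      show "AE \<omega> in N. (\<lambda>n. G n (increments T n (\<lambda>t. w t \<omega>))) \<longlonglongrightarrow> g (\<lambda>t\<in>{0..T}. w t \<omega>)"
        unfolding G_def by (intro AE_I2 polygon_functional_tendsto[OF T wc gc])
    qed (use GB in auto)
    show "((\<lambda>i. LINT \<omega>|M. g (\<lambda>t\<in>{0..T}. x i t \<omega>)) \<longlongrightarrow> (LINT \<omega>|N. g (\<lambda>t\<in>{0..T}. w t \<omega>))) F"
    proof (rule tendstoI)
      fix e :: real assume e: "e > 0"
      define D where "D = 10 * (L * (1 + C * T\<^sup>2))"
      have "(\<lambda>n. D * (9 / 10) ^ n) \<longlonglongrightarrow> D * 0" by (intro tendsto_intros LIMSEQ_realpow_zero) auto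
      then have "eventually (\<lambda>n. D * (9 / 10) ^ n < e / 3) sequentially" using e by (intro order_tendstoD(2)) auto
      moreover have "eventually (\<lambda>n. dist (LINT \<omega>|N. G n (increments T n (\<lambda>t. w t \<omega>))) (LINT \<omega>|N. g (\<lambda>t\<in>{0..T}. w t \<omega>)) < e / 3) sequentially"
        using e by (intro tendstoD[OF c]) auto
      ultimately have "eventually (\<lambda>n. D * (9 / 10) ^ n < e / 3 \<and> dist (LINT \<omega>|N. G n (increments T n (\<lambda>t. w t \<omega>))) (LINT \<omega>|N. g (\<lambda>t\<in>{0..T}. w t \<omega>)) < e / 3) sequentially"
        by eventually_elim auto
      then obtain n where n: "D * (9 / 10) ^ n < e / 3" "dist (LINT \<omega>|N. G n (increments T n (\<lambda>t. w t \<omega>))) (LINT \<omega>|N. g (\<lambda>t\<in>{0..T}. w t \<omega>)) < e / 3"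
        by (auto simp: eventually_sequentially)
      have "eventually (\<lambda>i. dist (LINT \<omega>|M. G n (increments T n (\<lambda>t. x i t \<omega>))) (LINT \<omega>|N. G n (increments T n (\<lambda>t. w t \<omega>))) < e / 3) F"
        using e by (intro tendstoD[OF a]) auto
      then show "eventually (\<lambda>i. dist (LINT \<omega>|M. g (\<lambda>t\<in>{0..T}. x i t \<omega>)) (LINT \<omega>|N. g (\<lambda>t\<in>{0..T}. w t \<omega>)) < e) F"
        using moment
      proof eventually_elim
        case (elim i)
        have "\<bar>(LINT \<omega>|M. g (\<lambda>t\<in>{0..T}. x i t \<omega>)) - (LINT \<omega>|M. G n (increments T n (\<lambda>t. x i t \<omega>)))\<bar> \<le> D * (9 / 10) ^ n"
          unfolding D_def G_def
          by (rule polygon_functional_close[OF M T x xc _ lip B L0 C]) (use elim(2) in auto)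
        then show ?case using n elim(1) unfolding dist_real_def by linarith
      qed
    qed
  qed
qed

section \<open>Characteristic functions of complex Brownian motion\<close>

lemma (in prob_space) expectation_exp_normal:
  assumes s: "s > 0" and D: "distributed M lborel D (normal_density 0 s)"
  shows "expectation (\<lambda>\<omega>. exp (\<i> * of_real (a * D \<omega>))) = of_real (exp (- (a\<^sup>2 * s\<^sup>2 / 2)))"
proof -
  have d: "distributed M lborel (\<lambda>\<omega>. (D \<omega> - 0) / s) std_normal_density"
    using D unfolding normal_standard_normal_convert[OF s, of D 0] .
  have Dm: "D \<in> borel_measurable M" using distributed_measurable[OF D] by simp
  have dd: "distr M lborel (\<lambda>\<omega>. D \<omega> / s) = std_normal_distribution"
    using distributed_distr_eq_density[OF d] by simp
  have "expectation (\<lambda>\<omega>. exp (\<i> * of_real (a * D \<omega>))) = expectation (\<lambda>\<omega>. exp (\<i> * of_real (a * s * (D \<omega> / s))))"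
    using s by simp
  also have "\<dots> = (LINT y|distr M lborel (\<lambda>\<omega>. D \<omega> / s). exp (\<i> * of_real (a * s * y)))"
    using Dm by (subst integral_distr) auto
  also have "\<dots> = char std_normal_distribution (a * s)" unfolding dd char_def ..
  also have "\<dots> = of_real (exp (- (a\<^sup>2 * s\<^sup>2 / 2)))" unfolding char_std_normal_distribution by (simp add: power_mult_distrib)
  finally show ?thesis .
qed

text \<open>Times increase strictly because an increment over a degenerate interval has no normal
  density.\<close>

lemma brownian_char:
  assumes B: "std_brownian_motion N B" and \<tau>: "0 \<le> \<tau> 0" "\<And>k. \<tau> k < \<tau> (Suc k)"
  shows "(LINT \<omega>|N. exp (\<i> * of_real (\<Sum>k<n. a k * (B (\<tau> (Suc k)) \<omega> - B (\<tau> k) \<omega>))))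
    = of_real (exp (- (\<Sum>k<n. (\<tau> (Suc k) - \<tau> k) * (a k)\<^sup>2 / 2)))"
proof -
  interpret prob_space N using B unfolding std_brownian_motion_def by blast
  have "mono \<tau>" unfolding mono_iff_le_Suc using \<tau>(2) by (blast intro: less_imp_le)
  then have \<tau>0: "0 \<le> \<tau> k" for k using monoD[of \<tau> 0 k] \<tau>(1) by simp
  define D where "D k \<omega> = B (\<tau> (Suc k)) \<omega> - B (\<tau> k) \<omega>" for k \<omega>
  have dist: "distributed N lborel (D k) (normal_density 0 (sqrt (\<tau> (Suc k) - \<tau> k)))" for k
    using B \<tau>0[of k] \<tau>(2)[of k] unfolding std_brownian_motion_def D_def[abs_def] by blast
  have Dm: "D k \<in> borel_measurable N" for k using distributed_measurable[OF dist[of k]] by simp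
  have ind: "indep_vars (\<lambda>_. borel) D {..<n}"
    using B \<tau>(1) less_imp_le[OF \<tau>(2)] unfolding std_brownian_motion_def independent_increments_def D_def[abs_def] by blast
  have "indep_vars (\<lambda>_. borel) (\<lambda>k \<omega>. exp (\<i> * complex_of_real (a k * D k \<omega>))) {..<n}"
    by (rule indep_vars_compose2[OF ind]) measurable
  then have "expectation (\<lambda>\<omega>. \<Prod>k<n. exp (\<i> * complex_of_real (a k * D k \<omega>)))
     = (\<Prod>k<n. expectation (\<lambda>\<omega>. exp (\<i> * complex_of_real (a k * D k \<omega>))))"
    using Dm by (intro indep_vars_lebesgue_integral) (auto intro!: integrable_const_bound[of _ 1])
  also have "(\<lambda>\<omega>. \<Prod>k<n. exp (\<i> * complex_of_real (a k * D k \<omega>))) = (\<lambda>\<omega>. exp (\<i> * of_real (\<Sum>k<n. a k * D k \<omega>)))"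
    by (simp add: exp_sum[symmetric] sum_distrib_left)
  also have "(\<Prod>k<n. expectation (\<lambda>\<omega>. exp (\<i> * complex_of_real (a k * D k \<omega>))))
    = (\<Prod>k<n. complex_of_real (exp (- ((\<tau> (Suc k) - \<tau> k) * (a k)\<^sup>2 / 2))))"
  proof (rule prod.cong[OF refl])
    fix k
    have "sqrt (\<tau> (Suc k) - \<tau> k) > 0" using \<tau>(2)[of k] by simp
    from expectation_exp_normal[OF this dist[of k], of "a k"] \<tau>(2)[of k]
    show "expectation (\<lambda>\<omega>. exp (\<i> * complex_of_real (a k * D k \<omega>))) = complex_of_real (exp (- ((\<tau> (Suc k) - \<tau> k) * (a k)\<^sup>2 / 2)))"
      by (simp add: mult.commute)
  qed
  also have "\<dots> = of_real (exp (- (\<Sum>k<n. (\<tau> (Suc k) - \<tau> k) * (a k)\<^sup>2 / 2)))"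
    unfolding of_real_prod[symmetric] by (simp add: exp_sum[symmetric] sum_negf)
  finally show ?thesis unfolding D_def .
qed

text \<open>Independence is given for whole sample paths. Exponentials of finitely many increments
  are measurable functionals on the product space, so the expectation factors over the components
  and then over real and imaginary parts; the squares add up to |l|^2.\<close>

lemma multi_brownian_char:
  fixes W :: "real \<Rightarrow> 'b \<Rightarrow> complex ^ 'm" and l :: "nat \<Rightarrow> complex ^ 'm"
  assumes W: "multi_complex_brownian_motion N W" and \<tau>: "0 \<le> \<tau> 0" "\<And>k. \<tau> k < \<tau> (Suc k)"
  shows "(LINT \<omega>|N. exp (\<i> * of_real (\<Sum>k<n. l k \<bullet> (W (\<tau> (Suc k)) \<omega> - W (\<tau> k) \<omega>))))
    = of_real (exp (- (\<Sum>k<n. (\<tau> (Suc k) - \<tau> k) * (norm (l k))\<^sup>2 / 2)))"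
proof -
  have cb: "complex_brownian_motion N (\<lambda>t \<omega>. W t \<omega> $ j)" for j
    using W unfolding multi_complex_brownian_motion_def by blast
  have re: "std_brownian_motion N (\<lambda>t \<omega>. Re (W t \<omega> $ j))" and im: "std_brownian_motion N (\<lambda>t \<omega>. Im (W t \<omega> $ j))" for j
    using cb[of j] unfolding complex_brownian_motion_def by blast+
  interpret prob_space N using re unfolding std_brownian_motion_def by blast
  have "mono \<tau>" unfolding mono_iff_le_Suc using \<tau>(2) by (blast intro: less_imp_le)
  then have \<tau>0: "0 \<le> \<tau> k" for k using monoD[of \<tau> 0 k] \<tau>(1) by simp
  have rm: "(\<lambda>\<omega>. Re (W t \<omega> $ j)) \<in> borel_measurable N" "(\<lambda>\<omega>. Im (W t \<omega> $ j)) \<in> borel_measurable N" if "t \<ge> 0" for t j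
    using re[of j] im[of j] that unfolding std_brownian_motion_def by blast+
  define R where "R j \<omega> = (\<Sum>k<n. Re (l k $ j) * (Re (W (\<tau> (Suc k)) \<omega> $ j) - Re (W (\<tau> k) \<omega> $ j)))" for j \<omega>
  define I where "I j \<omega> = (\<Sum>k<n. Im (l k $ j) * (Im (W (\<tau> (Suc k)) \<omega> $ j) - Im (W (\<tau> k) \<omega> $ j)))" for j \<omega>
  have RIm: "R j \<in> borel_measurable N" "I j \<in> borel_measurable N" for j
    unfolding R_def[abs_def] I_def[abs_def] using rm \<tau>0
    by (intro borel_measurable_sum borel_measurable_times borel_measurable_diff borel_measurable_const; simp)+
  have coord: "(\<lambda>p. p (\<tau> k)) \<in> measurable (PiM {0..} (\<lambda>_. K)) K" for k and K :: "'k measure"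
    using \<tau>0[of k] by (intro measurable_component_singleton) auto
  have eR: "expectation (\<lambda>\<omega>. exp (\<i> * of_real (R j \<omega>))) = of_real (exp (- (\<Sum>k<n. (\<tau> (Suc k) - \<tau> k) * (Re (l k $ j))\<^sup>2 / 2)))" for j
    unfolding R_def by (rule brownian_char[OF re \<tau>])
  have eI: "expectation (\<lambda>\<omega>. exp (\<i> * of_real (I j \<omega>))) = of_real (exp (- (\<Sum>k<n. (\<tau> (Suc k) - \<tau> k) * (Im (l k $ j))\<^sup>2 / 2)))" for j
    unfolding I_def by (rule brownian_char[OF im \<tau>])
  have e1: "expectation (\<lambda>\<omega>. exp (\<i> * of_real (R j \<omega> + I j \<omega>)))
     = of_real (exp (- (\<Sum>k<n. (\<tau> (Suc k) - \<tau> k) * (norm (l k $ j))\<^sup>2 / 2)))" for j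
  proof -
    define \<Phi> where "\<Phi> c p = exp (\<i> * complex_of_real (\<Sum>k<n. c k * (p (\<tau> (Suc k)) - p (\<tau> k))))" for c :: "nat \<Rightarrow> real" and p :: "real \<Rightarrow> real"
    have \<Phi>: "\<Phi> c \<in> borel_measurable (PiM {0..} (\<lambda>_. borel))" for c
    proof -
      have "(\<lambda>p. \<Sum>k<n. c k * (p (\<tau> (Suc k)) - p (\<tau> k))) \<in> borel_measurable (PiM {0..} (\<lambda>_. borel :: real measure))"
        by (intro borel_measurable_sum borel_measurable_times borel_measurable_diff borel_measurable_const coord)
      then show ?thesis unfolding \<Phi>_def[abs_def] by measurable
    qed
    have "indep_var (PiM {0..} (\<lambda>_. borel)) (\<lambda>\<omega>. \<lambda>t\<in>{0..}. Re (W t \<omega> $ j)) (PiM {0..} (\<lambda>_. borel)) (\<lambda>\<omega>. \<lambda>t\<in>{0..}. Im (W t \<omega> $ j))"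
      using cb[of j] unfolding complex_brownian_motion_def by blast
    from indep_var_compose[OF this \<Phi>[of "\<lambda>k. Re (l k $ j)"] \<Phi>[of "\<lambda>k. Im (l k $ j)"]]
    have "indep_var borel (\<lambda>\<omega>. exp (\<i> * of_real (R j \<omega>))) borel (\<lambda>\<omega>. exp (\<i> * of_real (I j \<omega>)))"
      unfolding comp_def \<Phi>_def R_def I_def using \<tau>0 by simp
    then have "expectation (\<lambda>\<omega>. exp (\<i> * of_real (R j \<omega>)) * exp (\<i> * of_real (I j \<omega>)))
      = expectation (\<lambda>\<omega>. exp (\<i> * of_real (R j \<omega>))) * expectation (\<lambda>\<omega>. exp (\<i> * of_real (I j \<omega>)))"
      using RIm by (intro indep_var_lebesgue_integral integrable_const_bound[of _ 1]) auto
    also have "\<dots> = of_real (exp (- (\<Sum>k<n. (\<tau> (Suc k) - \<tau> k) * (Re (l k $ j))\<^sup>2 / 2) + - (\<Sum>k<n. (\<tau> (Suc k) - \<tau> k) * (Im (l k $ j))\<^sup>2 / 2)))"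
      unfolding eR eI exp_add by simp
    also have "- (\<Sum>k<n. (\<tau> (Suc k) - \<tau> k) * (Re (l k $ j))\<^sup>2 / 2) + - (\<Sum>k<n. (\<tau> (Suc k) - \<tau> k) * (Im (l k $ j))\<^sup>2 / 2)
        = - (\<Sum>k<n. (\<tau> (Suc k) - \<tau> k) * (norm (l k $ j))\<^sup>2 / 2)"
      unfolding minus_add_distrib[symmetric] sum.distrib[symmetric]
      by (intro arg_cong[where f=uminus] sum.cong) (auto simp: cmod_power2 add_divide_distrib distrib_left)
    finally show ?thesis by (simp add: exp_add[symmetric] distrib_left)
  qed
  \<comment> \<open>Stated on raw paths, so that independence of the component paths passes to it by
    composition.\<close>
  define \<Psi> where "\<Psi> j p = exp (\<i> * complex_of_real (\<Sum>k<n. Re (l k $ j) * (Re (p (\<tau> (Suc k))) - Re (p (\<tau> k))) + Im (l k $ j) * (Im (p (\<tau> (Suc k))) - Im (p (\<tau> k)))))" for j and p :: "real \<Rightarrow> complex"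
  have \<Psi>: "\<Psi> j \<in> borel_measurable (PiM {0..} (\<lambda>_. borel))" for j
  proof -
    note [measurable] = coord
    have "(\<lambda>p. \<Sum>k<n. Re (l k $ j) * (Re (p (\<tau> (Suc k))) - Re (p (\<tau> k))) + Im (l k $ j) * (Im (p (\<tau> (Suc k))) - Im (p (\<tau> k)))) \<in> borel_measurable (PiM {0..} (\<lambda>_. borel :: complex measure))"
      by measurable
    then show ?thesis unfolding \<Psi>_def[abs_def] by measurable
  qed
  have "indep_vars (\<lambda>_. PiM {0..} (\<lambda>_. borel)) (\<lambda>j \<omega>. \<lambda>t\<in>{0..}. W t \<omega> $ j) UNIV"
    using W unfolding multi_complex_brownian_motion_def by blast
  from indep_vars_compose2[OF this \<Psi>]
  have "indep_vars (\<lambda>_. borel) (\<lambda>j \<omega>. exp (\<i> * complex_of_real (R j \<omega> + I j \<omega>))) UNIV"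
    unfolding \<Psi>_def R_def I_def sum.distrib[symmetric] using \<tau>0 by simp
  then have "expectation (\<lambda>\<omega>. \<Prod>j\<in>UNIV. exp (\<i> * complex_of_real (R j \<omega> + I j \<omega>)))
     = (\<Prod>j\<in>UNIV. expectation (\<lambda>\<omega>. exp (\<i> * complex_of_real (R j \<omega> + I j \<omega>))))"
    using RIm by (intro indep_vars_lebesgue_integral) (auto intro!: integrable_const_bound[of _ 1])
  also have "(\<lambda>\<omega>. \<Prod>j\<in>UNIV. exp (\<i> * complex_of_real (R j \<omega> + I j \<omega>)))
     = (\<lambda>\<omega>. exp (\<i> * of_real (\<Sum>k<n. l k \<bullet> (W (\<tau> (Suc k)) \<omega> - W (\<tau> k) \<omega>))))"
  proof
    fix \<omega>
    have "(\<Sum>k<n. l k \<bullet> (W (\<tau> (Suc k)) \<omega> - W (\<tau> k) \<omega>)) = (\<Sum>j\<in>UNIV. R j \<omega> + I j \<omega>)"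
      unfolding inner_vec_def R_def I_def sum.distrib[symmetric]
      by (subst sum.swap) (simp add: inner_complex_def)
    then show "(\<Prod>j\<in>UNIV. exp (\<i> * complex_of_real (R j \<omega> + I j \<omega>))) = exp (\<i> * of_real (\<Sum>k<n. l k \<bullet> (W (\<tau> (Suc k)) \<omega> - W (\<tau> k) \<omega>)))"
      by (simp add: exp_sum[symmetric] sum_distrib_left)
  qed
  also have "(\<Prod>j\<in>UNIV. expectation (\<lambda>\<omega>. exp (\<i> * complex_of_real (R j \<omega> + I j \<omega>))))
     = of_real (exp (\<Sum>j\<in>UNIV. - (\<Sum>k<n. (\<tau> (Suc k) - \<tau> k) * (norm (l k $ j))\<^sup>2 / 2)))"
    unfolding e1 by (simp add: exp_sum)
  also have "(\<Sum>j\<in>UNIV. - (\<Sum>k<n. (\<tau> (Suc k) - \<tau> k) * (norm (l k $ j))\<^sup>2 / 2)) = - (\<Sum>k<n. (\<tau> (Suc k) - \<tau> k) * (norm (l k))\<^sup>2 / 2)"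
    unfolding sum_negf by (subst sum.swap) (simp add: norm_vec_def L2_set_def sum_nonneg sum_distrib_left sum_divide_distrib)
  finally show ?thesis .
qed

section \<open>The limit theorem\<close>

context pinned_levy_process
begin

text \<open>The path is Lipschitz since waves have modulus 1. No sign of e is assumed: at e = 0
  division yields 0 and the path is constant, so the result holds for every index of the
  family.\<close>

lemma approx_continuous:
  assumes w: "\<omega> \<in> space M"
  shows "continuous_on {0..T} (\<lambda>t. approx_process X \<psi> \<theta> e t \<omega>)"
proof -
  have "continuous_on {0..T} (\<lambda>t. occ u 0 (2 * t / e\<^sup>2) \<omega>)" for u
  proof -
    have "norm (occ u 0 (2 * t / e\<^sup>2) \<omega> - occ u 0 (2 * s / e\<^sup>2) \<omega>) \<le> 2 / e\<^sup>2 * (t - s)" if "0 \<le> s" "s \<le> t" for s t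
    proof -
      have st: "0 \<le> 2 * s / e\<^sup>2" "2 * s / e\<^sup>2 \<le> 2 * t / e\<^sup>2" using that by (auto intro!: divide_right_mono)
      have "occ u 0 (2 * t / e\<^sup>2) \<omega> - occ u 0 (2 * s / e\<^sup>2) \<omega> = occ u (2 * s / e\<^sup>2) (2 * t / e\<^sup>2) \<omega>"
        using occ_split[OF order_refl st w] by simp
      then show ?thesis using norm_occ_le[OF st w, of u] by (simp add: right_diff_distrib diff_divide_distrib)
    qed note step = this
    have "(2 / e\<^sup>2)-lipschitz_on {0..T} (\<lambda>t. occ u 0 (2 * t / e\<^sup>2) \<omega>)"
    proof (rule lipschitz_onI)
      fix s t assume "s \<in> {0..T}" "t \<in> {0..T}"
      then show "dist (occ u 0 (2 * s / e\<^sup>2) \<omega>) (occ u 0 (2 * t / e\<^sup>2) \<omega>) \<le> 2 / e\<^sup>2 * dist s t"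
        using step[of s t] step[of t s] by (cases "s \<le> t") (auto simp: dist_norm norm_minus_commute)
    qed simp
    then show ?thesis by (rule lipschitz_on_continuous_on)
  qed
  then have "continuous_on {0..T} (\<lambda>t. \<chi> j. approx_process X \<psi> \<theta> e t \<omega> $ j)"
    unfolding approx_component by (intro continuous_on_vec_lambda continuous_intros)
  then show ?thesis by simp
qed

lemma approx_measurable:
  assumes "0 \<le> t"
  shows "approx_process X \<psi> \<theta> e t \<in> borel_measurable M"
proof (rule borel_measurable_vecI)
  fix j
  have "occ (\<theta> $ j) 0 (2 * t / e\<^sup>2) \<in> borel_measurable M"
    by (rule past_M[OF occ_past[OF order_refl order_refl]])
  then show "(\<lambda>\<omega>. approx_process X \<psi> \<theta> e t \<omega> $ j) \<in> borel_measurable M" unfolding approx_component by measurable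
qed

lemma approx_fourth_power_integrable:
  assumes st: "0 \<le> s" "s \<le> t"
  shows "integrable M (\<lambda>\<omega>. norm (approx_incr \<theta> e s t \<omega>) ^ 4)"
proof (rule integrable_const_bound)
  define b where "b = (\<Sum>j\<in>UNIV. \<bar>e * levy_c \<psi> (\<theta> $ j)\<bar> * (2 * t / e\<^sup>2 - 2 * s / e\<^sup>2))"
  show "AE \<omega> in M. norm (norm (approx_incr \<theta> e s t \<omega>) ^ 4) \<le> b ^ 4"
  proof (rule AE_I2)
    fix \<omega> assume w: "\<omega> \<in> space M"
    have ab: "0 \<le> 2 * s / e\<^sup>2" "2 * s / e\<^sup>2 \<le> 2 * t / e\<^sup>2" using st by (auto intro!: divide_right_mono)
    have "norm (approx_incr \<theta> e s t \<omega>)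
        \<le> (\<Sum>j\<in>UNIV. norm ((approx_incr \<theta> e s t \<omega>) $ j))"
      unfolding norm_vec_def by (rule L2_set_le_sum) simp
    also have "\<dots> \<le> b"
      unfolding b_def approx_increment[OF st w] using norm_occ_le[OF ab w]
      by (intro sum_mono) (simp add: norm_mult abs_mult mult_left_mono)
    finally have "norm (approx_incr \<theta> e s t \<omega>) ^ 4 \<le> b ^ 4"
      by (rule power_mono) simp
    then show "norm (norm (approx_incr \<theta> e s t \<omega>) ^ 4) \<le> b ^ 4" by simp
  qed
  show "(\<lambda>\<omega>. norm (approx_incr \<theta> e s t \<omega>) ^ 4) \<in> borel_measurable M"
  proof -
    have "approx_process X \<psi> \<theta> e t \<in> borel_measurable M" "approx_process X \<psi> \<theta> e s \<in> borel_measurable M"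
      using st by (auto intro: approx_measurable)
    then show ?thesis by measurable
  qed
qed

text \<open>The limit process enters only through measurability, continuity, the start at zero and
  its characteristic functions, so that a Brownian motion with its initial value subtracted can be
  inserted.\<close>

theorem pinned_limit:
  fixes \<theta> :: "real ^ 'm" and w :: "real \<Rightarrow> 'b \<Rightarrow> complex ^ 'm"
  assumes nz: "\<And>j. Re (\<psi> (\<theta> $ j)) * Re (\<psi> (2 * \<theta> $ j)) \<noteq> 0"
    and nz2: "\<And>j h c1. j \<noteq> h \<Longrightarrow> c1 \<in> {-1, 1} \<Longrightarrow> Re (\<psi> (\<theta> $ j + c1 * \<theta> $ h)) \<noteq> 0"
    and T: "T > 0" and N: "prob_space N"
    and w: "\<And>t. t \<in> {0..T} \<Longrightarrow> w t \<in> borel_measurable N"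
    and wc: "\<And>\<omega>. \<omega> \<in> space N \<Longrightarrow> continuous_on {0..T} (\<lambda>t. w t \<omega>)"
    and w0: "\<And>\<omega>. \<omega> \<in> space N \<Longrightarrow> w 0 \<omega> = 0"
    and char: "\<And>n l \<tau>. 0 \<le> \<tau> 0 \<Longrightarrow> (\<And>k. \<tau> k < \<tau> (Suc k)) \<Longrightarrow>
      (LINT \<omega>|N. exp (\<i> * of_real (\<Sum>k<n. l k \<bullet> (w (\<tau> (Suc k)) \<omega> - w (\<tau> k) \<omega>))))
        = of_real (exp (- (\<Sum>k<n. (\<tau> (Suc k) - \<tau> k) * (norm (l k))\<^sup>2 / 2)))"
    and f: "continuous_map (path_space T) euclideanreal f" and bnd: "bounded (f ` topspace (path_space T))"
  shows "((\<lambda>e. expectation (\<lambda>\<omega>. f (\<lambda>t\<in>{0..T}. approx_process X \<psi> \<theta> e t \<omega>))) \<longlongrightarrow> (LINT \<omega>|N. f (\<lambda>t\<in>{0..T}. w t \<omega>) :: real)) (at_right 0)"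
proof -
  obtain C where C: "C \<ge> 0" "\<And>e s t. 0 < e \<Longrightarrow> 0 \<le> s \<Longrightarrow> s \<le> t \<Longrightarrow>
     expectation (\<lambda>\<omega>. norm (approx_incr \<theta> e s t \<omega>) ^ 4) \<le> C * (t - s)\<^sup>2"
    using approx_fourth_moment[OF nz nz2] by blast
  show ?thesis
  proof (rule weak_convergence_paths[OF prob_space_axioms N T C(1) _ _ _ w wc w0 _ _ f bnd])
    show "approx_process X \<psi> \<theta> e t \<in> borel_measurable M" if "t \<in> {0..T}" for e t
      using that by (intro approx_measurable) auto
    show "continuous_on {0..T} (\<lambda>t. approx_process X \<psi> \<theta> e t \<omega>)" if "\<omega> \<in> space M" for e \<omega>
      by (rule approx_continuous[OF that])
    show "approx_process X \<psi> \<theta> e 0 \<omega> = 0" for e \<omega>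
      by (simp add: vec_eq_iff approx_component)
    have "eventually (\<lambda>e::real. 0 < e) (at_right 0)" by (rule eventually_at_right_less)
    then show "eventually (\<lambda>e. \<forall>s t. 0 \<le> s \<longrightarrow> s \<le> t \<longrightarrow> t \<le> T \<longrightarrow>
        integrable M (\<lambda>\<omega>. norm (approx_incr \<theta> e s t \<omega>) ^ 4) \<and>
        expectation (\<lambda>\<omega>. norm (approx_incr \<theta> e s t \<omega>) ^ 4) \<le> C * (t - s)\<^sup>2) (at_right 0)"
      by eventually_elim (auto intro: C(2) approx_fourth_power_integrable)
    have g: "0 \<le> grid T n 0" "grid T n k < grid T n (Suc k)" for n k
      using T by (auto simp: grid_def intro!: divide_strict_right_mono mult_strict_right_mono)
    show "((\<lambda>e. expectation (\<lambda>\<omega>. exp (\<i> * of_real (\<Sum>k<2 ^ n. l k \<bullet> (approx_incr \<theta> e (grid T n k) (grid T n (Suc k)) \<omega>)))))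
       \<longlongrightarrow> (LINT \<omega>|N. exp (\<i> * of_real (\<Sum>k<2 ^ n. l k \<bullet> (w (grid T n (Suc k)) \<omega> - w (grid T n k) \<omega>))))) (at_right 0)" for n l
      unfolding char[of "grid T n", OF g]
      by (rule approx_char_increments[OF nz nz2 g(1) less_imp_le[OF g(2)]])
  qed
qed

end

text \<open>Subtracting the initial value changes no increment, and the exponent is unaffected
  because that value vanishes almost surely.\<close>

lemma pinned_levy_process_diff:
  assumes X: "levy_process M X" and \<psi>: "levy_exponent M X \<psi>"
  shows "pinned_levy_process M (\<lambda>t \<omega>. X t \<omega> - X 0 \<omega>) \<psi>"
proof -
  have M: "prob_space M" and Xm: "\<And>t. t \<ge> 0 \<Longrightarrow> X t \<in> borel_measurable M" and X0: "AE \<omega> in M. X 0 \<omega> = 0"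
    and ii: "independent_increments M X" and si: "stationary_increments M X"
    and cad: "\<And>\<omega>. \<omega> \<in> space M \<Longrightarrow> cadlag (\<lambda>t. X t \<omega>)"
    using X unfolding levy_process_def by auto
  interpret prob_space M by (rule M)
  show ?thesis
  proof
    show "(\<lambda>\<omega>. X t \<omega> - X 0 \<omega>) \<in> borel_measurable M" if "t \<ge> 0" for t
      using Xm[OF that] Xm[of 0] by simp
    show "independent_increments M (\<lambda>t \<omega>. X t \<omega> - X 0 \<omega>)" using ii unfolding independent_increments_def by simp
    show "stationary_increments M (\<lambda>t \<omega>. X t \<omega> - X 0 \<omega>)" using si unfolding stationary_increments_def by simp
    show "cadlag (\<lambda>t. X t \<omega> - X 0 \<omega>)" if "\<omega> \<in> space M" for \<omega>
      unfolding cadlag_def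
    proof (intro conjI allI impI)
      fix t :: real
      show "((\<lambda>t. X t \<omega> - X 0 \<omega>) \<longlongrightarrow> X t \<omega> - X 0 \<omega>) (at_right t)" if "t \<ge> 0"
        using cad[OF \<open>\<omega> \<in> space M\<close>] that unfolding cadlag_def by (intro tendsto_intros) auto
      show "\<exists>l. ((\<lambda>t. X t \<omega> - X 0 \<omega>) \<longlongrightarrow> l) (at_left t)" if t: "t > 0"
      proof -
        obtain l where "((\<lambda>t. X t \<omega>) \<longlongrightarrow> l) (at_left t)" using cad[OF \<open>\<omega> \<in> space M\<close>] t unfolding cadlag_def by blast
        then have "((\<lambda>t. X t \<omega> - X 0 \<omega>) \<longlongrightarrow> l - X 0 \<omega>) (at_left t)" by (intro tendsto_intros)
        then show ?thesis by blast
      qed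
    qed
    show "levy_exponent M (\<lambda>t \<omega>. X t \<omega> - X 0 \<omega>) \<psi>"
      unfolding levy_exponent_def
    proof (intro allI impI)
      fix u t :: real assume t: "t \<ge> 0"
      have "(LINT \<omega>|M. exp (\<i> * complex_of_real (u * (X t \<omega> - X 0 \<omega>)))) = (LINT \<omega>|M. exp (\<i> * complex_of_real (u * X t \<omega>)))"
        using Xm[OF t] Xm[of 0] X0 by (intro integral_cong_AE) auto
      then show "(LINT \<omega>|M. exp (\<i> * complex_of_real (u * (X t \<omega> - X 0 \<omega>)))) = exp (- (complex_of_real t * \<psi> u))"
        using \<psi> t unfolding levy_exponent_def by simp
    qed
  qed simp
qed

text \<open>The initial phase factors out of the time integral at every sample point. Measurability
  and continuity pass through it everywhere, and it equals 1 almost surely.\<close>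

lemma approx_process_shift:
  "approx_process X \<psi> \<theta> e t \<omega> = (\<chi> j. exp (\<i> * of_real (\<theta> $ j * X 0 \<omega>)) * approx_process (\<lambda>t \<omega>. X t \<omega> - X 0 \<omega>) \<psi> \<theta> e t \<omega> $ j)"
proof -
  have eq: "exp (\<i> * of_real (u * X 0 \<omega>)) * exp (\<i> * of_real (u * (X s \<omega> - X 0 \<omega>))) = exp (\<i> * complex_of_real (u * X s \<omega>))" for u s
    unfolding exp_add[symmetric] by (simp add: algebra_simps)
  have "(LINT s:A|lborel. exp (\<i> * complex_of_real (u * X s \<omega>)))
     = exp (\<i> * of_real (u * X 0 \<omega>)) * (LINT s:A|lborel. exp (\<i> * of_real (u * (X s \<omega> - X 0 \<omega>))))" for u A
    unfolding set_lebesgue_integral_def integral_mult_right_zero[symmetric] mult_scaleR_right eq ..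
  then show ?thesis unfolding approx_process_def by (simp add: vec_eq_iff)
qed

theorem theorem4p2:
  fixes T :: real
    and M :: "'a measure" and X :: "real \<Rightarrow> 'a \<Rightarrow> real" and \<psi> :: "real \<Rightarrow> complex"
    and \<theta> :: "real ^ 'm"
    and N :: "'b measure" and W :: "real \<Rightarrow> 'b \<Rightarrow> complex ^ 'm"
  assumes "T > 0"
    and "levy_process M X"
    and "levy_exponent M X \<psi>"
    and "\<And>j. Re (\<psi> (\<theta> $ j)) * Re (\<psi> (2 * \<theta> $ j)) \<noteq> 0"
    and "\<And>j h c1. j \<noteq> h \<Longrightarrow> c1 \<in> {-1, 1} \<Longrightarrow> Re (\<psi> (\<theta> $ j + c1 * \<theta> $ h)) \<noteq> 0"
    and "multi_complex_brownian_motion N W"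
  shows "converges_weakly (path_space T)
           (\<lambda>\<epsilon>. path_law M T (approx_process X \<psi> \<theta> \<epsilon>))
           (path_law N T W)
           (at_right 0)"
  unfolding converges_weakly_def
proof (intro allI impI, elim conjE)
  fix f :: "(real \<Rightarrow> complex ^ 'm) \<Rightarrow> real"
  assume f: "continuous_map (path_space T) euclideanreal f" and bnd: "bounded (f ` topspace (path_space T))"
  have f': "continuous_map (mtopology_of (paths T)) euclideanreal f" using f unfolding path_space_def .
  define X' where "X' t \<omega> = X t \<omega> - X 0 \<omega>" for t \<omega>
  interpret L: pinned_levy_process M X' \<psi>
    unfolding X'_def[abs_def] by (rule pinned_levy_process_diff[OF assms(2,3)])
  have X0: "AE \<omega> in M. X 0 \<omega> = 0" and X0m: "X 0 \<in> borel_measurable M" using assms(2) unfolding levy_process_def by auto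
  have shift: "approx_process X \<psi> \<theta> e t \<omega> = (\<chi> j. exp (\<i> * of_real (\<theta> $ j * X 0 \<omega>)) * approx_process X' \<psi> \<theta> e t \<omega> $ j)" for e t \<omega>
    unfolding X'_def[abs_def] by (rule approx_process_shift)
  have Am: "approx_process X \<psi> \<theta> e t \<in> borel_measurable M" if "t \<in> {0..T}" for e t
  proof (rule borel_measurable_vecI)
    fix j
    have "(\<lambda>\<omega>. approx_process X' \<psi> \<theta> e t \<omega> $ j) \<in> borel_measurable M"
      using that unfolding L.approx_component by (intro borel_measurable_times borel_measurable_const L.past_M[OF L.occ_past[OF order_refl order_refl]])
    then show "(\<lambda>\<omega>. approx_process X \<psi> \<theta> e t \<omega> $ j) \<in> borel_measurable M"
      unfolding shift using X0m by simp
  qed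
  have Ac: "continuous_on {0..T} (\<lambda>t. approx_process X \<psi> \<theta> e t \<omega>)" if "\<omega> \<in> space M" for e \<omega>
    unfolding shift using L.approx_continuous[OF that]
    by (intro continuous_on_vec_lambda continuous_intros)
  \<comment> \<open>The two paths agree only off a null set, so integrals are compared;
    measurability of both functionals is needed for that.\<close>
  have A: "(LINT x|path_law M T (approx_process X \<psi> \<theta> e). f x) = (LINT \<omega>|M. f (\<lambda>t\<in>{0..T}. approx_process X' \<psi> \<theta> e t \<omega>))" for e
  proof -
    have "(LINT x|path_law M T (approx_process X \<psi> \<theta> e). f x) = (LINT \<omega>|M. f (\<lambda>t\<in>{0..T}. approx_process X \<psi> \<theta> e t \<omega>))"
      by (rule integral_path_law[OF assms(1) Am Ac f])
    also have "\<dots> = (LINT \<omega>|M. f (\<lambda>t\<in>{0..T}. approx_process X' \<psi> \<theta> e t \<omega>))"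
    proof (rule integral_cong_AE)
      show "(\<lambda>\<omega>. f (\<lambda>t\<in>{0..T}. approx_process X \<psi> \<theta> e t \<omega>)) \<in> borel_measurable M"
        by (rule path_functional_measurable[OF assms(1) Am Ac f'])
      show "(\<lambda>\<omega>. f (\<lambda>t\<in>{0..T}. approx_process X' \<psi> \<theta> e t \<omega>)) \<in> borel_measurable M"
        by (rule path_functional_measurable[OF assms(1) L.approx_measurable L.approx_continuous f']) auto
      show "AE \<omega> in M. f (\<lambda>t\<in>{0..T}. approx_process X \<psi> \<theta> e t \<omega>) = f (\<lambda>t\<in>{0..T}. approx_process X' \<psi> \<theta> e t \<omega>)"
        using X0 by eventually_elim (simp add: shift)
    qed
    finally show ?thesis .
  qed
  \<comment> \<open>The same reduction for the Brownian motion, whose start at zero also holds only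
    almost surely.\<close>
  define W' where "W' t \<omega> = W t \<omega> - W 0 \<omega>" for t \<omega>
  have re: "std_brownian_motion N (\<lambda>t \<omega>. Re (W t \<omega> $ j))" and im: "std_brownian_motion N (\<lambda>t \<omega>. Im (W t \<omega> $ j))" for j
    using assms(6) unfolding multi_complex_brownian_motion_def complex_brownian_motion_def by blast+
  have N: "prob_space N" using re unfolding std_brownian_motion_def by blast
  have Wm: "W t \<in> borel_measurable N" if "t \<in> {0..T}" for t
  proof (rule borel_measurable_vecI)
    fix j
    have "(\<lambda>\<omega>. Re (W t \<omega> $ j)) \<in> borel_measurable N" "(\<lambda>\<omega>. Im (W t \<omega> $ j)) \<in> borel_measurable N"
      using re[of j] im[of j] that unfolding std_brownian_motion_def by auto
    then show "(\<lambda>\<omega>. W t \<omega> $ j) \<in> borel_measurable N" unfolding borel_measurable_complex_iff by blast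
  qed
  have Wc: "continuous_on {0..T} (\<lambda>t. W t \<omega>)" if w: "\<omega> \<in> space N" for \<omega>
  proof -
    have "continuous_on {0..T} (\<lambda>t. Complex (Re (W t \<omega> $ j)) (Im (W t \<omega> $ j)))" for j
    proof -
      have "continuous_on {0..} (\<lambda>t. Re (W t \<omega> $ j))" "continuous_on {0..} (\<lambda>t. Im (W t \<omega> $ j))"
        using re[of j] im[of j] w unfolding std_brownian_motion_def by auto
      then have "continuous_on {0..T} (\<lambda>t. Re (W t \<omega> $ j))" "continuous_on {0..T} (\<lambda>t. Im (W t \<omega> $ j))"
        by (auto elim!: continuous_on_subset)
      then show ?thesis by (intro continuous_on_Complex)
    qed
    then have "continuous_on {0..T} (\<lambda>t. \<chi> j. W t \<omega> $ j)" by (intro continuous_on_vec_lambda) simp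
    then show ?thesis by simp
  qed
  have W0: "AE \<omega> in N. W 0 \<omega> = 0"
  proof -
    have "AE \<omega> in N. \<forall>j\<in>UNIV. Re (W 0 \<omega> $ j) = 0 \<and> Im (W 0 \<omega> $ j) = 0"
      using re im unfolding std_brownian_motion_def by (intro AE_finite_allI AE_conjI) auto
    then show ?thesis by eventually_elim (simp add: vec_eq_iff complex_eq_iff)
  qed
  have Wm': "W' t \<in> borel_measurable N" if "t \<in> {0..T}" for t
    unfolding W'_def[abs_def] using Wm[OF that] Wm[of 0] assms(1) by simp
  have Wc': "continuous_on {0..T} (\<lambda>t. W' t \<omega>)" if "\<omega> \<in> space N" for \<omega>
    unfolding W'_def by (intro continuous_intros Wc[OF that])
  have B: "(LINT x|path_law N T W. f x) = (LINT \<omega>|N. f (\<lambda>t\<in>{0..T}. W' t \<omega>))"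
  proof -
    have "(LINT x|path_law N T W. f x) = (LINT \<omega>|N. f (\<lambda>t\<in>{0..T}. W t \<omega>))"
      by (rule integral_path_law[OF assms(1) Wm Wc f])
    also have "\<dots> = (LINT \<omega>|N. f (\<lambda>t\<in>{0..T}. W' t \<omega>))"
    proof (rule integral_cong_AE)
      show "(\<lambda>\<omega>. f (\<lambda>t\<in>{0..T}. W t \<omega>)) \<in> borel_measurable N"
        by (rule path_functional_measurable[OF assms(1) Wm Wc f'])
      show "(\<lambda>\<omega>. f (\<lambda>t\<in>{0..T}. W' t \<omega>)) \<in> borel_measurable N"
        by (rule path_functional_measurable[OF assms(1) Wm' Wc' f'])
      show "AE \<omega> in N. f (\<lambda>t\<in>{0..T}. W t \<omega>) = f (\<lambda>t\<in>{0..T}. W' t \<omega>)"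
        using W0 by eventually_elim (simp add: W'_def)
    qed
    finally show ?thesis .
  qed
  show "((\<lambda>\<epsilon>. LINT x|path_law M T (approx_process X \<psi> \<theta> \<epsilon>). f x) \<longlongrightarrow> (LINT x|path_law N T W. f x)) (at_right 0)"
    unfolding A B
  proof (rule L.pinned_limit[OF assms(4,5,1) N Wm' Wc' _ _ f bnd])
    show "W' 0 \<omega> = 0" for \<omega> by (simp add: W'_def)
    show "(LINT \<omega>|N. exp (\<i> * of_real (\<Sum>k<n. l k \<bullet> (W' (\<tau> (Suc k)) \<omega> - W' (\<tau> k) \<omega>))))
        = of_real (exp (- (\<Sum>k<n. (\<tau> (Suc k) - \<tau> k) * (norm (l k))\<^sup>2 / 2)))"
      if "0 \<le> \<tau> 0" "\<And>k. \<tau> k < \<tau> (Suc k)" for n l \<tau>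
      using multi_brownian_char[where n=n and l=l, OF assms(6) that] by (simp add: W'_def)
  qed
qed

end
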